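(* Let $p,q,s$ be integers with $p\ge 3$, $q\ge 1$, $\gcd(p,q)=1$, and suppose $s=2n$ for some positive integer $n$. Let $k,\ell$ be the integers determined by $p,q$ as in the context. Then the Jones polynomial of the twisted torus knot $T((p,q),(2,s))=T(p,q,2,n)$ is $$\frac{t^{\frac{(p-1)(q-1)+s}{2}}}{1-t^{2}}\left[J'_{p,q}-\sum_{i=0}^{s-1}(-1)^i\, t^{\,-i+s+k+\ell-k\ell+\frac{kq+\ell p-1}{2}}\,J'_{p-2k,q-2\ell}\right],$$ where $J'_{p,q}=1-t^{p+1}-t^{q+1}+t^{p+q}$ and $J'_{p-2k,q-2\ell}=1-t^{p-2k+1}-t^{q-2\ell+1}+t^{p+q-2k-2\ell}$.
   Context: The twisted torus link $T((p,q),(2,s))$ is the closure of the braid $(\sigma_1\sigma_2\cdots\sigma_{p-1})^q\sigma_1^{s}$ on $p$ strands, where $\sigma_i$ are the standard braid generators, with all strands oriented in parallel and each $\sigma_i$ a positive crossing (writhe $+1$). When $s=2n$ it is the twisted torus knot $T(p,q,2,n)$, obtained from the $(p,q)$-torus knot by adding $n$ full twists to $2$ adjacent strands. The Jones polynomial $V(L)$ is defined via the Kauffman bracket: $\langle\bigcirc\rangle=1$, $\langle L\sqcup\bigcirc\rangle=(-A^2-A^{-2})\langle L\rangle$, and resolving a crossing $\sigma_i$ of a braid closure gives $\langle\sigma_i\rangle=A\langle \mathrm{id}\rangle+A^{-1}\langle e_i\rangle$, where $\mathrm{id}$ replaces the crossing by two vertical strands and $e_i$ replaces it by a cap and a cup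 (so $\langle\sigma_i^{-1}\rangle=A^{-1}\langle \mathrm{id}\rangle+A\langle e_i\rangle$). The auxiliary polynomial is $X(L)=(-A)^{-3w(L)}\langle L\rangle$, with $w$ the writhe, and $V(L)$ is obtained from $X(L)$ by $A\mapsto t^{-1/4}$. (With this convention the torus knot $T(m,n)$, $m,n>0$, has $V=t^{(m-1)(n-1)/2}(1-t^{m+1}-t^{n+1}+t^{m+n})/(1-t^2)$.) Definition of $k,\ell$: let $\hat q$ be the residue of $q$ modulo $p$. Let $k$ be the smallest positive integer such that $1+\hat q k\equiv i \pmod p$ for some $i\in\{0,1,2\}$, and for this $k$ and the corresponding $i$ let $\ell$ be the integer with $p\ell+i-1=qk$. *)

theory Defs
  imports
    "HOL-Library.Poly_Mapping"
    "HOL-Computational_Algebra.Computational_Algebra"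
    "HOL-Number_Theory.Cong"
begin

text \<open>
  Laurent polynomials are finitely supported functions from exponents to integer coefficients,
  multiplied by convolution. Exponents of \<open>A\<close> are integers; exponents of \<open>t\<close> are rationals, so that
  \<open>A \<mapsto> t\<^sup>-\<^sup>1\<^sup>/\<^sup>4\<close> makes sense for every diagram. Both rings are integral domains.
\<close>

type_synonym A_laurent = "int \<Rightarrow>\<^sub>0 int"
type_synonym t_laurent = "rat \<Rightarrow>\<^sub>0 int"

definition A_pow :: "int \<Rightarrow> A_laurent" where
  "A_pow m = Poly_Mapping.single m 1"

definition t_pow :: "rat \<Rightarrow> t_laurent" where
  "t_pow r = Poly_Mapping.single r 1"

text \<open>\<open>Sig i\<close> is the \<open>i\<close>-th standard generator (\<open>1 \<le> i < p\<close> on \<open>p\<close> strands), \<open>Sig_inv i\<close> its inverse.\<close>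

datatype braid_letter = Sig nat | Sig_inv nat

type_synonym braid_word = "braid_letter list"

fun letter_sign :: "braid_letter \<Rightarrow> int" where
  "letter_sign (Sig i) = 1"
| "letter_sign (Sig_inv i) = - 1"

definition writhe :: "braid_word \<Rightarrow> int" where
  "writhe w = (\<Sum>x\<leftarrow>w. letter_sign x)"

text \<open>A resolved crossing: \<open>p\<close> vertical strands, or a cap and a cup joining strands \<open>i\<close> and \<open>i + 1\<close>.\<close>

datatype smoothing = Vertical | Cap_Cup nat

text \<open>
  The points \<open>(x, j)\<close> with \<open>1 \<le> x \<le> p\<close> and \<open>0 \<le> j \<le> m\<close> are the strand positions on the horizontal
  lines separating the \<open>m\<close> pieces of a fully resolved word. The \<open>j\<close>-th piece lies between lines \<open>j\<close>
  and \<open>j + 1\<close>, and closing up joins \<open>(x, m)\<close> to \<open>(x, 0)\<close>. Every point is an end of exactly two arcs,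
  so the circles of the resulting crossingless diagram are the classes of points connected by arcs.
\<close>

fun piece_arcs :: "nat \<Rightarrow> nat \<Rightarrow> smoothing \<Rightarrow> ((nat \<times> nat) \<times> (nat \<times> nat)) set" where
  "piece_arcs p j Vertical = {((x, j), (x, Suc j)) | x. x \<in> {1..p}}"
| "piece_arcs p j (Cap_Cup i) =
     {((x, j), (x, Suc j)) | x. x \<in> {1..p} - {i, Suc i}}
     \<union> {((i, j), (Suc i, j)), ((i, Suc j), (Suc i, Suc j))}"

definition closure_arcs :: "nat \<Rightarrow> smoothing list \<Rightarrow> ((nat \<times> nat) \<times> (nat \<times> nat)) set" where
  "closure_arcs p fs =
     (\<Union>j<length fs. piece_arcs p j (fs ! j)) \<union> {((x, length fs), (x, 0)) | x. x \<in> {1..p}}"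

definition num_circles :: "nat \<Rightarrow> smoothing list \<Rightarrow> nat" where
  "num_circles p fs =
     card (({1..p} \<times> {0..length fs}) // (closure_arcs p fs \<union> (closure_arcs p fs)\<inverse>)\<^sup>*)"

text \<open>
  \<open>bracket_from p fs w\<close> is the Kauffman bracket of the closure of the pieces \<open>fs\<close> followed by the
  still unresolved word \<open>w\<close>; \<open>c\<close> disjoint circles have bracket \<open>(- A\<^sup>2 - A\<^sup>-\<^sup>2)\<^sup>c\<^sup>-\<^sup>1\<close>.
\<close>

fun bracket_from :: "nat \<Rightarrow> smoothing list \<Rightarrow> braid_word \<Rightarrow> A_laurent" where
  "bracket_from p fs [] = (- A_pow 2 - A_pow (- 2)) ^ (num_circles p fs - 1)"
| "bracket_from p fs (Sig i # w) =
     A_pow 1 * bracket_from p (fs @ [Vertical]) w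
     + A_pow (- 1) * bracket_from p (fs @ [Cap_Cup i]) w"
| "bracket_from p fs (Sig_inv i # w) =
     A_pow (- 1) * bracket_from p (fs @ [Vertical]) w
     + A_pow 1 * bracket_from p (fs @ [Cap_Cup i]) w"

definition kauffman_bracket :: "nat \<Rightarrow> braid_word \<Rightarrow> A_laurent" where
  "kauffman_bracket p w = bracket_from p [] w"

text \<open>\<open>(- A)\<^sup>m\<close> for a possibly negative exponent \<open>m\<close>.\<close>

definition minus_A_pow :: "int \<Rightarrow> A_laurent" where
  "minus_A_pow m = (if even m then A_pow m else - A_pow m)"

definition X_polynomial :: "nat \<Rightarrow> braid_word \<Rightarrow> A_laurent" where
  "X_polynomial p w = minus_A_pow (- 3 * writhe w) * kauffman_bracket p w"

text \<open>The substitution \<open>A \<mapsto> t\<^sup>-\<^sup>1\<^sup>/\<^sup>4\<close>.\<close>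

definition A_to_t :: "A_laurent \<Rightarrow> t_laurent" where
  "A_to_t f = (\<Sum>m\<in>Poly_Mapping.keys f.
     Poly_Mapping.single (- of_int m / 4) (Poly_Mapping.lookup f m))"

text \<open>The Jones polynomial of the closure of the braid word \<open>w\<close> on \<open>p\<close> strands.\<close>

definition jones_polynomial :: "nat \<Rightarrow> braid_word \<Rightarrow> t_laurent" where
  "jones_polynomial p w = A_to_t (X_polynomial p w)"

text \<open>The braid \<open>(\<sigma>\<^sub>1 \<sigma>\<^sub>2 \<dots> \<sigma>\<^sub>p\<^sub>-\<^sub>1)\<^sup>q \<sigma>\<^sub>1\<^sup>s\<close>, whose closure is \<open>T((p,q),(2,s))\<close>.\<close>

definition twisted_torus_braid :: "nat \<Rightarrow> nat \<Rightarrow> nat \<Rightarrow> braid_word" where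
  "twisted_torus_braid p q s =
     concat (replicate q (map Sig [1..<p])) @ replicate s (Sig 1)"

definition torus_J :: "int \<Rightarrow> int \<Rightarrow> t_laurent" where
  "torus_J a b = 1 - t_pow (of_int (a + 1)) - t_pow (of_int (b + 1)) + t_pow (of_int (a + b))"

definition hits_residue :: "int \<Rightarrow> int \<Rightarrow> int \<Rightarrow> int \<Rightarrow> bool" where
  "hits_residue p q k r \<longleftrightarrow> k > 0 \<and> r \<in> {0, 1, 2} \<and> [1 + (q mod p) * k = r] (mod p)"

text \<open>For \<open>p \<ge> 3\<close> the residue \<open>r\<close> belonging to the minimal \<open>k\<close> is unique, hence so is \<open>\<ell>\<close>.\<close>

definition is_twist_pair :: "int \<Rightarrow> int \<Rightarrow> int \<Rightarrow> int \<Rightarrow> bool" where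
  "is_twist_pair p q k l \<longleftrightarrow>
     (\<exists>r. hits_residue p q k r \<and> (\<forall>k' r'. hits_residue p q k' r' \<longrightarrow> k \<le> k')
        \<and> p * l + r - 1 = q * k)"

end

theory Submission
  imports Defs
begin

text \<open>
  Write \<open>\<delta> = \<sigma>\<^sub>1 \<dots> \<sigma>\<^sub>p\<^sub>-\<^sub>1\<close>. Resolving the \<open>s\<close> crossings \<open>\<sigma>\<^sub>1\<^sup>s\<close> in the skein module gives
  \<open>A\<^sup>s\<close> times the closure of \<open>\<delta>\<^sup>q\<close>, a torus knot, plus an explicit alternating sum of powers of \<open>A\<close>
  times the closure of \<open>\<delta>\<^sup>q e\<^sub>1\<close>. The theorem follows from two evaluations.

  First, the cup and the cap of \<open>e\<^sub>1\<close> can be slid through the torus braid. A cup moves one step with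
  every \<open>\<delta>\<close>, and the remaining strands form the torus braid on \<open>p - 2\<close> strands; when the cup has
  travelled all the way round it has shed two of the factors \<open>\<delta>\<close> and a framing factor \<open>A\<^sup>-\<^sup>6\<close>. When
  it finally meets the cap at distance one they cancel; if it meets the cap elsewhere the roles are
  exchanged and the process continues on \<open>p - 2\<close> strands. The positions visited are governed by the
  multiples \<open>q, 2q, 3q, \<dots>\<close> modulo \<open>p\<close>, and the first multiple congruent to \<open>1\<close> or \<open>-1\<close> ends the
  process. Hence the closure of \<open>\<delta>\<^sup>q e\<^sub>1\<close> equals \<open>A\<^sup>-\<^sup>6\<^sup>l\<close> times the closure of the torus braid with
  parameters \<open>(p - 2k, q - 2l)\<close> (\<open>wtrace_twist_smoothing\<close>).

  Second, the bracket of a torus knot has to be computed (\<open>wtrace_torus\<close>). The bracket is turned into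
  a weighted trace on the space with basis the sequences of \<open>p\<close> bits, where \<open>e\<^sub>i\<close> acts as a matrix.
  A diagram consists of circles, and the trace of a diagram is a power of the loop value: the
  defining relations of the Temperley-Lieb algebra together with the Markov properties determine
  every such trace, so the exponent can be read off in the model with loop value \<open>2\<close>, where the
  trace counts the two-colourings of the circles (\<open>wtrace_num_circles\<close>).

  The space decomposes by weight (zeros minus ones), and quantum \<open>sl\<^sub>2\<close> acts on it, commuting with the
  braids. On the highest weight vectors of weight \<open>n\<close> the full twist \<open>\<delta>\<^sup>p\<close> is multiplication by
  \<open>A\<^sup>c\<close> with \<open>c = (n+1)\<^sup>2 - 1 - 3p\<close> (\<open>full_twist_on_kernel\<close>), so that the difference \<open>f\<close> of the traces of
  \<open>\<delta>\<^sup>q\<close> on the weight spaces \<open>n\<close> and \<open>n + 2\<close> satisfies \<open>p A f' = q c f\<close>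
  (\<open>weight_trace_difference_ode\<close>). Therefore \<open>f\<close> is a monomial, and its coefficient is found at
  \<open>A = 1\<close>, where \<open>\<delta>\<close> is a cyclic permutation of the bits: as \<open>p\<close> and \<open>q\<close> are coprime, \<open>\<delta>\<^sup>q\<close> fixes only
  the constant sequences. Among the weights \<open>n \<ge> 0\<close> only the differences for \<open>p\<close> and \<open>p - 2\<close> do not vanish, and these two
  give the four terms of the Jones polynomial of a torus knot.
\<close>

section \<open>Operators on functions of bit sequences\<close>

text \<open>
  Configurations are infinite, so operators near the left end need no strand number and their
  relations hold without side conditions. The number of strands enters only through the finite set
  \<open>configs p\<close> over which traces are taken.
\<close>

type_synonym config = "nat \<Rightarrow> bool"

definition scons :: "bool \<Rightarrow> config \<Rightarrow> config" (infixr "##" 65) where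
  "x ## s = case_nat x s"

definition stl :: "config \<Rightarrow> config" where
  "stl s = (\<lambda>i. s (Suc i))"

lemma scons_0 [simp]: "(x ## s) 0 = x"
  and scons_Suc [simp]: "(x ## s) (Suc i) = s i"
  and stl_scons [simp]: "stl (x ## s) = s"
  and stl_apply [simp]: "stl s i = s (Suc i)"
  and scons_inject [simp]: "x ## s = y ## t \<longleftrightarrow> x = y \<and> s = t"
  by (auto simp: scons_def stl_def fun_eq_iff split: nat.split)

lemma scons_collapse [simp]: "s 0 ## stl s = s"
  by (auto simp: scons_def stl_def fun_eq_iff split: nat.split)

lemma scons_cases [case_names scons]: obtains x t where "s = x ## t"
  by (metis scons_collapse)

lemma config_ext: "(\<And>x t. f (x ## t) = g (x ## t)) \<Longrightarrow> f = g"
  by (metis ext scons_collapse)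

type_synonym 'a op = "(config \<Rightarrow> 'a) \<Rightarrow> config \<Rightarrow> 'a"

definition lin :: "'a::comm_ring_1 op \<Rightarrow> bool" where
  "lin X \<longleftrightarrow> (\<forall>f g. X (\<lambda>s. f s + g s) = (\<lambda>s. X f s + X g s)) \<and> (\<forall>c f. X (\<lambda>s. c * f s) = (\<lambda>s. c * X f s))"

lemma lin_add: "lin X \<Longrightarrow> X (\<lambda>s. f s + g s) = (\<lambda>s. X f s + X g s)"
  and lin_scale: "lin X \<Longrightarrow> X (\<lambda>s. c * f s) = (\<lambda>s. c * X f s)"
  by (auto simp: lin_def)

lemma lin_zero: "lin X \<Longrightarrow> X (\<lambda>s. 0) = (\<lambda>s. 0)"
  using lin_scale[of X 0 "\<lambda>s. 0"] by simp

lemma lin_uminus: "lin X \<Longrightarrow> X (\<lambda>s. - f s) = (\<lambda>s. - X f s)"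
  using lin_scale[of X "-1" f] by simp

lemma lin_diff: "lin X \<Longrightarrow> X (\<lambda>s. f s - g s) = (\<lambda>s. X f s - X g s)"
  using lin_add[of X f "\<lambda>s. - g s"] lin_uminus[of X g] by simp

lemma lin_sum: "lin X \<Longrightarrow> X (\<lambda>s. \<Sum>i\<in>A. f i s) = (\<lambda>s. \<Sum>i\<in>A. X (f i) s)"
proof (induction A rule: infinite_finite_induct)
  case (insert i A)
  then show ?case using lin_add[of X "f i" "\<lambda>s. \<Sum>i\<in>A. f i s"] by (simp add: fun_eq_iff)
qed (auto simp: lin_zero)

lemma lin_id: "lin (\<lambda>f. f)"
  by (simp add: lin_def)

lemma lin_comp: "lin X \<Longrightarrow> lin Y \<Longrightarrow> lin (\<lambda>f. X (Y f))"
  by (simp add: lin_def)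

lemma lin_plus: "lin X \<Longrightarrow> lin Y \<Longrightarrow> lin (\<lambda>f s. X f s + Y f s)"
  by (simp add: lin_def fun_eq_iff algebra_simps)

lemma lin_mult: "lin X \<Longrightarrow> lin (\<lambda>f s. c s * X f s)"
  by (simp add: lin_def fun_eq_iff algebra_simps)

lemma lin_funpow: "lin X \<Longrightarrow> lin (X ^^ n)"
  by (induction n) (auto simp: lin_def)

text \<open>
  Tensoring with the identity on the left: the same operator placed one strand further to the right.
\<close>

definition lift :: "'a op \<Rightarrow> 'a op" where
  "lift X f s = X (\<lambda>t. f (s 0 ## t)) (stl s)"

lemma lift_scons [simp]: "lift X f (x ## s) = X (\<lambda>t. f (x ## t)) s"
  by (simp add: lift_def)

lemma lift_comp: "lift (\<lambda>f. X (Y f)) f = lift X (lift Y f)"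
  by (rule config_ext) simp

lemma lift_id: "lift (\<lambda>f. f) f = f"
  by (rule config_ext) simp

lemma lin_lift: "lin X \<Longrightarrow> lin (lift X)"
  by (simp add: lin_def lift_def fun_eq_iff)

text \<open>
  Locality: the values of \<open>X f\<close> on \<open>I\<close> see \<open>f\<close> only on \<open>J\<close>. For a linear operator and finite \<open>J\<close> this
  means that \<open>X\<close> is an \<open>I\<close> by \<open>J\<close> matrix, although it acts on functions of infinite sequences.
\<close>

definition depends :: "config set \<Rightarrow> config set \<Rightarrow> 'a op \<Rightarrow> bool" where
  "depends I J X \<longleftrightarrow> (\<forall>f g. (\<forall>t\<in>J. f t = g t) \<longrightarrow> (\<forall>s\<in>I. X f s = X g s))"

lemma dependsD: "depends I J X \<Longrightarrow> (\<And>t. t \<in> J \<Longrightarrow> f t = g t) \<Longrightarrow> s \<in> I \<Longrightarrow> X f s = X g s"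
  unfolding depends_def by blast

lemma depends_comp: "depends I J X \<Longrightarrow> depends J K Y \<Longrightarrow> depends I K (\<lambda>f. X (Y f))"
  unfolding depends_def by blast

lemma depends_id: "depends I I (\<lambda>f. f)"
  unfolding depends_def by blast

lemma depends_funpow: "depends I I X \<Longrightarrow> depends I I (X ^^ n)"
  by (induction n) (auto simp: depends_def)

definition ind :: "config \<Rightarrow> config \<Rightarrow> 'a::comm_ring_1" where
  "ind s t = (if t = s then 1 else 0)"

lemma expand:
  assumes "lin X" "depends I J X" "finite J" "s \<in> I"
  shows "X f s = (\<Sum>t\<in>J. f t * X (ind t) s)"
proof -
  have "X f s = X (\<lambda>u. \<Sum>t\<in>J. f t * ind t u) s"
    by (rule dependsD[OF assms(2)]) (use assms in \<open>auto simp: ind_def if_distrib sum.delta cong: if_cong\<close>)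
  also have "\<dots> = (\<Sum>t\<in>J. f t * X (ind t) s)"
    by (simp add: lin_sum[OF assms(1)] lin_scale[OF assms(1)])
  finally show ?thesis .
qed

definition tr :: "config set \<Rightarrow> 'a::comm_ring_1 op \<Rightarrow> 'a" where
  "tr I X = (\<Sum>s\<in>I. X (ind s) s)"

lemma tr_comm:
  assumes "finite I" "finite J" "lin X" "lin Y" "depends I J X" "depends J I Y"
  shows "tr I (\<lambda>f. X (Y f)) = tr J (\<lambda>f. Y (X f))"
proof -
  have "tr I (\<lambda>f. X (Y f)) = (\<Sum>s\<in>I. \<Sum>t\<in>J. Y (ind s) t * X (ind t) s)"
    unfolding tr_def by (intro sum.cong refl expand) (use assms in auto)
  also have "\<dots> = (\<Sum>t\<in>J. \<Sum>s\<in>I. X (ind t) s * Y (ind s) t)"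
    by (subst sum.swap) (simp add: mult.commute)
  also have "\<dots> = tr J (\<lambda>f. Y (X f))"
    unfolding tr_def by (intro sum.cong refl expand[symmetric]) (use assms in auto)
  finally show ?thesis .
qed

lemma tr_cong: "(\<And>f s. s \<in> I \<Longrightarrow> X f s = Y f s) \<Longrightarrow> tr I X = tr I Y"
  unfolding tr_def by (auto intro: sum.cong)

definition configs :: "nat \<Rightarrow> config set" where
  "configs p = {s. \<forall>i\<ge>p. \<not> s i}"

lemma configs_0: "configs 0 = {\<lambda>_. False}"
  by (auto simp: configs_def)

lemma scons_in_configs [simp]: "x ## s \<in> configs (Suc p) \<longleftrightarrow> s \<in> configs p"
  unfolding configs_def by (auto simp: scons_def split: nat.splits)

lemma sum_configs_Suc: "(\<Sum>s\<in>configs (Suc p). f s) = (\<Sum>s\<in>configs p. f (False ## s) + f (True ## s))"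
  and finite_configs: "finite (configs p)"
proof -
  have *: "configs (Suc p) = (\<lambda>s. False ## s) ` configs p \<union> (\<lambda>s. True ## s) ` configs p" for p
  proof (intro set_eqI iffI)
    fix s assume "s \<in> configs (Suc p)"
    then show "s \<in> (\<lambda>s. False ## s) ` configs p \<union> (\<lambda>s. True ## s) ` configs p"
      by (cases s rule: scons_cases; cases "s 0") auto
  qed auto
  show fin: "finite (configs p)" for p
    by (induction p) (auto simp: configs_0 *)
  show "(\<Sum>s\<in>configs (Suc p). f s) = (\<Sum>s\<in>configs p. f (False ## s) + f (True ## s))"
    unfolding * by (subst sum.union_disjoint) (auto simp: fin sum.reindex inj_on_def sum.distrib)
qed

lemma depends_lift:
  assumes "depends (configs p) (configs r) X" shows "depends (configs (Suc p)) (configs (Suc r)) (lift X)"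
  unfolding depends_def
proof (intro allI impI ballI)
  fix f g :: "config \<Rightarrow> 'a" and s
  assume H: "\<forall>t\<in>configs (Suc r). f t = g t" and s: "s \<in> configs (Suc p)"
  obtain x u where u: "s = x ## u" by (cases s rule: scons_cases)
  have "X (\<lambda>t. f (x ## t)) u = X (\<lambda>t. g (x ## t)) u"
    by (rule dependsD[OF assms]) (use H s u in auto)
  then show "lift X f s = lift X g s" using u by simp
qed

section \<open>Loop models and their weighted traces\<close>

definition bool_sum :: "(bool \<Rightarrow> 'a::comm_ring_1) \<Rightarrow> 'a" where
  "bool_sum f = f False + f True"

text \<open>
  Cups and caps between adjacent strands are given by weights \<open>n\<close> and \<open>m\<close> of two bits. The zigzag
  identities straighten a strand, \<open>d\<close> is the value of a small circle, and \<open>k\<close> weighs a strand that is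
  closed up. The axiom \<open>markov_k\<close> says that closing the left strand of a cup-cap pair straightens it,
  and the last two axioms say that cups and caps do not change the total closing weight.
\<close>

locale loop_model =
  fixes n m :: "bool \<Rightarrow> bool \<Rightarrow> 'a::comm_ring_1" and k :: "bool \<Rightarrow> 'a" and d :: 'a
  assumes zigzag1: "bool_sum (\<lambda>b. m a b * n b c) = (if a = c then 1 else 0)"
    and zigzag2: "bool_sum (\<lambda>b. n a b * m b c) = (if a = c then 1 else 0)"
    and loop: "bool_sum (\<lambda>a. bool_sum (\<lambda>b. m a b * n a b)) = d"
    and ksum: "bool_sum k = d"
    and markov_k: "bool_sum (\<lambda>x. k x * n x y * m x b) = (if y = b then 1 else 0)"
    and k_n: "k x * k y * n x y = n x y"
    and k_m: "k x * k y * m x y = m x y"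
begin

definition cup0 :: "'a op" where
  "cup0 f s = n (s 0) (s 1) * f (stl (stl s))"

definition cap0 :: "'a op" where
  "cap0 f s = bool_sum (\<lambda>a. bool_sum (\<lambda>b. m a b * f (a ## b ## s)))"

fun cup :: "nat \<Rightarrow> 'a op" where
  "cup 0 = cup0"
| "cup (Suc i) = lift (cup i)"

fun cap :: "nat \<Rightarrow> 'a op" where
  "cap 0 = cap0"
| "cap (Suc i) = lift (cap i)"

definition e :: "nat \<Rightarrow> 'a op" where
  "e i f = cup i (cap i f)"

lemma cup0_scons [simp]: "cup0 f (x ## y ## s) = n x y * f s"
  by (simp add: cup0_def)

lemma e_Suc: "e (Suc i) = lift (e i)"
  by (rule ext, rule config_ext) (simp add: e_def)

lemma lin_cup0: "lin cup0" and lin_cap0: "lin cap0"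
  by (auto simp: lin_def cup0_def cap0_def bool_sum_def fun_eq_iff algebra_simps)

lemma lin_cup: "lin (cup i)"
  by (induction i) (simp_all add: lin_cup0 lin_lift)

lemma lin_cap: "lin (cap i)"
  by (induction i) (simp_all add: lin_cap0 lin_lift)

lemma lin_e: "lin (e i)"
  using lin_comp[OF lin_cup lin_cap, of i i] by (simp add: lin_def e_def)

lemma cap_cup: "cap i (cup i f) = (\<lambda>s. d * f s)"
proof (induction i arbitrary: f)
  case 0
  show ?case
    by (simp add: fun_eq_iff cap0_def bool_sum_def loop[symmetric] algebra_simps)
next
  case (Suc i)
  show ?case by (rule config_ext) (simp add: Suc)
qed

lemma cap_Suc_cup: "cap (Suc i) (cup i f) = f"
proof (induction i arbitrary: f)
  case 0
  show ?case
  proof (rule config_ext)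
    fix x t
    have "cap (Suc 0) (cup 0 f) (x ## t) = bool_sum (\<lambda>a. n x a * m a False) * f (False ## t) + bool_sum (\<lambda>a. n x a * m a True) * f (True ## t)"
      by (simp add: cap0_def bool_sum_def algebra_simps)
    then show "cap (Suc 0) (cup 0 f) (x ## t) = f (x ## t)"
      unfolding zigzag2 by (cases x) simp_all
  qed
next
  case (Suc i)
  show ?case
  proof (rule config_ext)
    fix x t
    have "cap (Suc (Suc i)) (cup (Suc i) f) (x ## t) = cap (Suc i) (cup i (\<lambda>t. f (x ## t))) t"
      unfolding cap.simps(2)[of "Suc i"] cup.simps(2) lift_scons ..
    then show "cap (Suc (Suc i)) (cup (Suc i) f) (x ## t) = f (x ## t)"
      unfolding Suc.IH .
  qed
qed
end

definition valid :: "nat \<Rightarrow> nat list \<Rightarrow> bool" where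
  "valid p w \<longleftrightarrow> (\<forall>i\<in>set w. Suc i < p)"

text \<open>
  \<open>T p w\<close> stands for the value of the closure of \<open>e\<^sub>i\<^sub>1 \<dots> e\<^sub>i\<^sub>r\<close> on \<open>p\<close> strands, with the strands and the
  generators counted from \<open>0\<close>. The last two conditions remove the leftmost strand: if no generator
  touches it, it closes to a circle, and a single \<open>e\<^sub>0\<close> is pulled straight.
\<close>

locale markov =
  fixes T :: "nat \<Rightarrow> nat list \<Rightarrow> 'a::comm_ring_1" and d :: 'a
  assumes T_empty: "T 0 [] = 1"
    and T_cyclic: "valid p u \<Longrightarrow> valid p v \<Longrightarrow> T p (u @ v) = T p (v @ u)"
    and T_sq: "T p (u @ [i, i] @ v) = d * T p (u @ [i] @ v)"
    and T_zig: "T p (u @ [i, Suc i, i] @ v) = T p (u @ [i] @ v)"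
    and T_far: "i + 2 \<le> j \<Longrightarrow> T p (u @ [i, j] @ v) = T p (u @ [j, i] @ v)"
    and T_map_Suc: "T (Suc p) (map Suc w) = d * T p w"
    and T_Cons_map_Suc: "p \<ge> 1 \<Longrightarrow> T (Suc p) (0 # map Suc w) = T p w"

context loop_model
begin

lemma cap_cup_Suc: "cap i (cup (Suc i) f) = f"
proof (induction i arbitrary: f)
  case 0
  show ?case
  proof (rule config_ext)
    fix x t
    have "cap 0 (cup (Suc 0) f) (x ## t) = bool_sum (\<lambda>b. m False b * n b x) * f (False ## t) + bool_sum (\<lambda>b. m True b * n b x) * f (True ## t)"
      by (simp add: cap0_def bool_sum_def algebra_simps)
    then show "cap 0 (cup (Suc 0) f) (x ## t) = f (x ## t)"
      unfolding zigzag1 by (cases x) simp_all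
  qed
next
  case (Suc i)
  show ?case
  proof (rule config_ext)
    fix x t
    have "cap (Suc i) (cup (Suc (Suc i)) f) (x ## t) = cap i (cup (Suc i) (\<lambda>t. f (x ## t))) t"
      unfolding cup.simps(2)[of "Suc i"] cap.simps(2) lift_scons ..
    then show "cap (Suc i) (cup (Suc (Suc i)) f) (x ## t) = f (x ## t)"
      unfolding Suc.IH .
  qed
qed

lemma cap0_lift2: "lin X \<Longrightarrow> cap0 (lift (lift X) f) = X (cap0 f)"
  unfolding cap0_def[abs_def] bool_sum_def by (simp add: lin_add[of X] lin_scale[of X])

lemma lift2_cup0: "lin X \<Longrightarrow> lift (lift X) (cup0 f) = cup0 (X f)"
  by (intro config_ext) (simp add: lift_def lin_scale fun_eq_iff cup0_def)

lemma e_sq: "e i (e i f) = (\<lambda>s. d * e i f s)"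
  unfolding e_def by (simp add: cap_cup lin_scale[OF lin_cup])

lemma e_zig: "e i (e (Suc i) (e i f)) = e i f"
  unfolding e_def cap_cup_Suc cap_Suc_cup ..

lemma e_zig': "e (Suc i) (e i (e (Suc i) f)) = e (Suc i) f"
  unfolding e_def cap_cup_Suc cap_Suc_cup ..

lemma cap0_cup_far: "cap 0 (cup (Suc (Suc j)) f) = cup j (cap 0 f)"
  using cap0_lift2[OF lin_cup] by simp

lemma e0_lift2: "lin X \<Longrightarrow> e 0 (lift (lift X) f) = lift (lift X) (e 0 f)"
  by (simp add: e_def cap0_lift2 lift2_cup0)

lemma e_far: "i + 2 \<le> j \<Longrightarrow> e i (e j f) = e j (e i f)"
proof (induction i arbitrary: j f)
  case 0
  then obtain r where "j = Suc (Suc r)" by (metis add_2_eq_Suc add_0 le_Suc_ex)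
  then show ?case by (simp add: e_Suc e0_lift2[OF lin_e])
next
  case (Suc i)
  then obtain r where r: "j = Suc r" by (cases j) auto
  with Suc have *: "e i (e r g) = e r (e i g)" for g by simp
  show ?case unfolding r e_Suc by (rule config_ext) (simp add: *)
qed

definition closing_weight :: "nat \<Rightarrow> config \<Rightarrow> 'a" where
  "closing_weight p s = (\<Prod>i<p. k (s i))"

lemma closing_weight_0 [simp]: "closing_weight 0 s = 1"
  and closing_weight_Suc [simp]: "closing_weight (Suc p) (x ## s) = k x * closing_weight p s"
  unfolding closing_weight_def by (simp_all add: prod.lessThan_Suc_shift del: prod.lessThan_Suc)

text \<open>
  Operators from \<open>q\<close> strands to \<open>p\<close> strands that respect the closing weight. These are the operators
  for which the weighted trace is cyclic.
\<close>

definition strand_op :: "nat \<Rightarrow> nat \<Rightarrow> 'a op \<Rightarrow> bool" where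
  "strand_op p q X \<longleftrightarrow> lin X \<and> depends (configs p) (configs q) X
     \<and> (\<forall>f s. X (\<lambda>t. closing_weight q t * f t) s = closing_weight p s * X f s)"

lemma strand_op_id: "strand_op p p (\<lambda>f. f)"
  by (simp add: strand_op_def lin_id depends_id)

lemma strand_op_comp: "strand_op p q X \<Longrightarrow> strand_op q r Y \<Longrightarrow> strand_op p r (\<lambda>f. X (Y f))"
  unfolding strand_op_def
proof (intro conjI allI; elim conjE)
  assume X: "\<forall>f s. X (\<lambda>t. closing_weight q t * f t) s = closing_weight p s * X f s"
    and Y: "\<forall>f s. Y (\<lambda>t. closing_weight r t * f t) s = closing_weight q s * Y f s"
  have "Y (\<lambda>t. closing_weight r t * f t) = (\<lambda>s. closing_weight q s * Y f s)" for f using Y by (simp add: fun_eq_iff)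
  then show "X (Y (\<lambda>t. closing_weight r t * f t)) s = closing_weight p s * X (Y f) s" for f s using X by simp
qed (rule lin_comp depends_comp; assumption)+

lemma depends_plus: "depends I J X \<Longrightarrow> depends I J Y \<Longrightarrow> depends I J (\<lambda>f s. X f s + Y f s)"
  unfolding depends_def by metis

lemma depends_mult: "depends I J X \<Longrightarrow> depends I J (\<lambda>f s. c s * X f s)"
  unfolding depends_def by metis

lemma strand_op_plus: "strand_op p q X \<Longrightarrow> strand_op p q Y \<Longrightarrow> strand_op p q (\<lambda>f s. X f s + Y f s)"
  unfolding strand_op_def by (simp add: lin_plus depends_plus algebra_simps)

lemma strand_op_scale: "strand_op p q X \<Longrightarrow> strand_op p q (\<lambda>f s. c * X f s)"
  unfolding strand_op_def by (simp add: lin_mult depends_mult algebra_simps)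

lemma strand_op_lift: assumes "strand_op p q X" shows "strand_op (Suc p) (Suc q) (lift X)"
  unfolding strand_op_def
proof (intro conjI allI)
  show "lin (lift X)" "depends (configs (Suc p)) (configs (Suc q)) (lift X)"
    using assms by (simp_all add: strand_op_def lin_lift depends_lift)
  fix f s
  obtain x t where s: "s = x ## t" by (rule scons_cases)
  have "X (\<lambda>t. k x * (closing_weight q t * f (x ## t))) t = k x * (closing_weight p t * X (\<lambda>t. f (x ## t)) t)"
    using assms lin_scale[of X "k x" "\<lambda>t. closing_weight q t * f (x ## t)"] by (simp add: strand_op_def)
  then show "lift X (\<lambda>t. closing_weight (Suc q) t * f t) s = closing_weight (Suc p) s * lift X f s"
    by (simp add: s mult.assoc)
qed

lemma strand_op_cup0: "strand_op (Suc (Suc p)) p cup0"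
  unfolding strand_op_def
proof (intro conjI allI)
  show "depends (configs (Suc (Suc p))) (configs p) cup0"
    by (auto simp: depends_def cup0_def configs_def)
  fix f s
  obtain x y t where s: "s = x ## y ## t" by (metis scons_cases)
  show "cup0 (\<lambda>t. closing_weight p t * f t) s = closing_weight (Suc (Suc p)) s * cup0 f s"
    using k_n[of x y, symmetric] by (simp add: s) (metis (no_types, lifting) mult.assoc mult.commute)
qed (rule lin_cup0)

lemma strand_op_cap0: "strand_op p (Suc (Suc p)) cap0"
  unfolding strand_op_def
proof (intro conjI allI)
  show "depends (configs p) (configs (Suc (Suc p))) cap0"
    by (auto simp: depends_def cap0_def bool_sum_def)
  fix f s
  have *: "m a b * (k a * (k b * closing_weight p s) * g) = closing_weight p s * (m a b * g)" for a b g
    using k_m[of a b] by (metis (no_types, lifting) mult.assoc mult.commute)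
  show "cap0 (\<lambda>t. closing_weight (Suc (Suc p)) t * f t) s = closing_weight p s * cap0 f s"
    unfolding cap0_def bool_sum_def closing_weight_Suc * by (simp add: algebra_simps)
qed (rule lin_cap0)

lemma strand_op_cup: "i \<le> p \<Longrightarrow> strand_op (Suc (Suc p)) p (cup i)"
proof (induction i arbitrary: p)
  case (Suc i)
  then show ?case by (cases p) (auto intro: strand_op_lift)
qed (simp add: strand_op_cup0)

lemma strand_op_cap: "i \<le> p \<Longrightarrow> strand_op p (Suc (Suc p)) (cap i)"
proof (induction i arbitrary: p)
  case (Suc i)
  then show ?case by (cases p) (auto intro: strand_op_lift)
qed (simp add: strand_op_cap0)

lemma strand_op_e: assumes "Suc i < p" shows "strand_op p p (e i)"
proof -
  obtain r where r: "p = Suc (Suc r)" "i \<le> r"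
    using assms by (cases p; cases "p - 1") auto
  have "e i = (\<lambda>f. cup i (cap i f))" by (simp add: fun_eq_iff e_def)
  then show ?thesis using strand_op_comp[OF strand_op_cup[OF r(2)] strand_op_cap[OF r(2)]] r(1) by simp
qed

definition wtrace :: "nat \<Rightarrow> 'a op \<Rightarrow> 'a" where
  "wtrace p X = (\<Sum>s\<in>configs p. closing_weight p s * X (ind s) s)"

lemma wtrace_comm: assumes "strand_op p q X" "strand_op q p Y"
  shows "wtrace p (\<lambda>f. X (Y f)) = wtrace q (\<lambda>f. Y (X f))"
proof -
  have "tr (configs p) (\<lambda>f. (\<lambda>g s. closing_weight p s * X g s) (Y f)) = tr (configs q) (\<lambda>f. Y ((\<lambda>g s. closing_weight p s * X g s) f))"
    using assms by (intro tr_comm finite_configs lin_mult depends_mult) (auto simp: strand_op_def)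
  also have "\<dots> = wtrace q (\<lambda>f. Y (X f))"
    using assms(2) unfolding tr_def wtrace_def by (simp add: strand_op_def)
  finally show ?thesis by (simp add: tr_def wtrace_def)
qed

lemma wtrace_plus: "wtrace p (\<lambda>f s. X f s + Y f s) = wtrace p X + wtrace p Y"
  and wtrace_scale: "wtrace p (\<lambda>f s. c * X f s) = c * wtrace p X"
  by (simp_all add: wtrace_def algebra_simps sum.distrib sum_distrib_left)

lemma wtrace_cong: "(\<And>f. X f = Y f) \<Longrightarrow> wtrace p X = wtrace p Y"
  by (simp add: wtrace_def)

lemma ind_scons: "ind (x ## s) (y ## t) = (if x = y then ind s t else 0)"
  by (simp add: ind_def)

lemma wtrace_lift: assumes "lin Y" shows "wtrace (Suc p) (lift Y) = d * wtrace p Y"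
proof -
  have "lift Y (ind (x ## s)) (x ## s) = Y (ind s) s" for x s
    by (simp add: ind_scons)
  then show ?thesis
    unfolding wtrace_def sum_configs_Suc ksum[symmetric] bool_sum_def
    by (simp add: sum_distrib_left algebra_simps)
qed

text \<open>
  Closing the leftmost strand of \<open>e 0\<close> produces the left-hand side of \<open>markov_k\<close>, hence straightens the
  strand and leaves the closure of \<open>Y\<close>.
\<close>

lemma wtrace_e0_lift: assumes "lin Y" shows "wtrace (Suc (Suc p)) (\<lambda>f. e 0 (lift Y f)) = wtrace (Suc p) Y"
proof -
  have *: "e 0 (lift Y (ind (x ## y ## s))) (x ## y ## s) = n x y * (m x False * Y (ind (y ## s)) (False ## s) + m x True * Y (ind (y ## s)) (True ## s))" for x y s
    using lin_zero[OF assms] by (cases x) (simp_all add: e_def cap0_def bool_sum_def ind_scons)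
  have "(\<Sum>x\<in>{False,True}. k x * (closing_weight (Suc p) (y ## s) * e 0 (lift Y (ind (x ## y ## s))) (x ## y ## s)))
      = closing_weight (Suc p) (y ## s) * (bool_sum (\<lambda>x. k x * n x y * m x False) * Y (ind (y ## s)) (False ## s)
       + bool_sum (\<lambda>x. k x * n x y * m x True) * Y (ind (y ## s)) (True ## s))" for y s
    unfolding * by (simp add: bool_sum_def algebra_simps)
  then have "(\<Sum>x\<in>{False,True}. k x * (closing_weight (Suc p) (y ## s) * e 0 (lift Y (ind (x ## y ## s))) (x ## y ## s)))
      = closing_weight (Suc p) (y ## s) * Y (ind (y ## s)) (y ## s)" for y s
    unfolding markov_k by (cases y) simp_all
  then have "k False * closing_weight (Suc p) s * e 0 (lift Y (ind (False ## s))) (False ## s) + k True * closing_weight (Suc p) s * e 0 (lift Y (ind (True ## s))) (True ## s)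
     = closing_weight (Suc p) s * Y (ind s) s" for s
    by (cases s rule: scons_cases) (simp add: mult.assoc)
  then show ?thesis
    unfolding wtrace_def by (subst sum_configs_Suc) (simp only: closing_weight_Suc)
qed

fun e_word :: "nat list \<Rightarrow> 'a op" where
  "e_word [] f = f"
| "e_word (i # w) f = e i (e_word w f)"

lemma e_word_append: "e_word (u @ v) f = e_word u (e_word v f)"
  by (induction u) auto

lemma lin_e_word: "lin (e_word w)"
proof (induction w)
  case Nil then show ?case by (simp add: lin_def)
next
  case (Cons i w)
  then show ?case using lin_comp[OF lin_e[of i] Cons.IH] by (simp add: lin_def)
qed

lemma strand_op_e_word: "valid p w \<Longrightarrow> strand_op p p (e_word w)"
proof (induction w)
  case Nil
  have "e_word [] = (\<lambda>f. f)" by (simp add: fun_eq_iff)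
  then show ?case using strand_op_id by simp
next
  case (Cons i w)
  have "e_word (i # w) = (\<lambda>f. e i (e_word w f))" by (simp add: fun_eq_iff)
  then show ?case using Cons strand_op_comp[OF strand_op_e[of i p], of p "e_word w"] by (simp add: valid_def)
qed

lemma e_word_map_Suc: "e_word (map Suc w) f = lift (e_word w) f"
proof (induction w)
  case Nil
  show ?case by (rule config_ext) simp
next
  case (Cons i w)
  then show ?case by (auto intro: config_ext simp: e_Suc)
qed

theorem markov_wtrace: "markov (\<lambda>p w. wtrace p (e_word w)) d"
proof
  show "wtrace 0 (e_word []) = 1"
    by (simp add: wtrace_def configs_0 ind_def)
next
  fix p u v assume *: "valid p u" "valid p v"
  have "e_word (a @ b) = (\<lambda>f. e_word a (e_word b f))" for a b by (simp add: fun_eq_iff e_word_append)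
  then show "wtrace p (e_word (u @ v)) = wtrace p (e_word (v @ u))"
    using wtrace_comm[OF strand_op_e_word strand_op_e_word, OF *] by simp
next
  fix p w
  have "e_word (map Suc w) = lift (e_word w)" by (simp add: fun_eq_iff e_word_map_Suc)
  then show "wtrace (Suc p) (e_word (map Suc w)) = d * wtrace p (e_word w)"
    by (simp add: wtrace_lift lin_e_word)
next
  fix p :: nat and w assume "p \<ge> 1"
  then obtain r where "p = Suc r" by (cases p) auto
  moreover have "e_word (0 # map Suc w) = (\<lambda>f. e 0 (lift (e_word w) f))" by (simp add: fun_eq_iff e_word_map_Suc)
  ultimately show "wtrace (Suc p) (e_word (0 # map Suc w)) = wtrace p (e_word w)"
    using wtrace_e0_lift[OF lin_e_word[of w], of r] by simp
next
  fix p u v i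
  show "wtrace p (e_word (u @ [i, i] @ v)) = d * wtrace p (e_word (u @ [i] @ v))"
    unfolding wtrace_scale[symmetric]
    by (rule wtrace_cong) (simp add: e_word_append e_sq lin_scale[OF lin_e_word])
next
  fix p u v i
  show "wtrace p (e_word (u @ [i, Suc i, i] @ v)) = wtrace p (e_word (u @ [i] @ v))"
    by (rule wtrace_cong) (simp add: e_word_append e_zig)
next
  fix p u v and i j :: nat assume "i + 2 \<le> j"
  then have "e i (e j f) = e j (e i f)" for f by (rule e_far)
  then show "wtrace p (e_word (u @ [i, j] @ v)) = wtrace p (e_word (u @ [j, i] @ v))"
    by (intro wtrace_cong) (simp add: e_word_append)
qed

end

section \<open>Markov functionals depend only on the loop value\<close>

text \<open>
  \<open>tl_reduces w c v\<close>: the Temperley-Lieb relations turn the word \<open>w\<close> into \<open>d\<^sup>c\<close> times the word \<open>v\<close>,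
  whatever the loop value \<open>d\<close> is. The exponent is a number and not a power of a fixed \<open>d\<close>, so one
  reduction serves all models at once.
\<close>

inductive tl_reduces :: "nat list \<Rightarrow> nat \<Rightarrow> nat list \<Rightarrow> bool" where
  refl: "tl_reduces w 0 w"
| sq: "tl_reduces w c (u @ [i, i] @ v) \<Longrightarrow> tl_reduces w (Suc c) (u @ [i] @ v)"
| zig: "tl_reduces w c (u @ [i, Suc i, i] @ v) \<Longrightarrow> tl_reduces w c (u @ [i] @ v)"
| far: "tl_reduces w c (u @ [i, j] @ v) \<Longrightarrow> i + 2 \<le> j \<or> j + 2 \<le> i \<Longrightarrow> tl_reduces w c (u @ [j, i] @ v)"

lemma tl_reduces_trans: "tl_reduces v b w \<Longrightarrow> tl_reduces u c v \<Longrightarrow> tl_reduces u (c + b) w"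
proof (induction rule: tl_reduces.induct)
  case (sq w c' u' i v)
  show ?case using tl_reduces.sq[OF sq.IH[OF sq.prems]] by simp
next
  case (zig w c' u' i v)
  show ?case by (rule tl_reduces.zig[OF zig.IH[OF zig.prems]])
next
  case (far w c' u' i j v)
  show ?case by (rule tl_reduces.far[OF far.IH[OF far.prems] far.hyps(2)])
qed simp

lemma tl_reduces_context: "tl_reduces u c v \<Longrightarrow> tl_reduces (a @ u @ b) c (a @ v @ b)"
proof (induction rule: tl_reduces.induct)
  case (sq w c u i v)
  then show ?case using tl_reduces.sq[of "a @ w @ b" c "a @ u" i "v @ b"] by simp
next
  case (zig w c u i v)
  then show ?case using tl_reduces.zig[of "a @ w @ b" c "a @ u" i "v @ b"] by simp
next
  case (far w c u i j v)
  then show ?case using tl_reduces.far[of "a @ w @ b" c "a @ u" i j "v @ b"] by simp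
qed (rule tl_reduces.refl)

lemma tl_reduces_valid: "tl_reduces u c v \<Longrightarrow> set v \<subseteq> set u"
  by (induction rule: tl_reduces.induct) auto

lemma markov_tl_reduces: "tl_reduces u c v \<Longrightarrow> markov T d \<Longrightarrow> T p u = d ^ c * T p v"
proof (induction rule: tl_reduces.induct)
  case (sq w c u i v)
  then show ?case using markov.T_sq[OF sq.prems, of p u i v] by (simp add: mult.assoc mult.left_commute)
next
  case (zig w c u i v)
  then show ?case using markov.T_zig[OF zig.prems, of p u i v] by simp
next
  case (far w c u i j v)
  have "T p (u @ [i, j] @ v) = T p (u @ [j, i] @ v)"
    using far.hyps(2) markov.T_far[OF far.prems, of i j p u v] markov.T_far[OF far.prems, of j i p u v]
    by (elim disjE) simp_all
  with far show ?case by simp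
qed simp

lemma tl_reduces_pull_right: "\<forall>j\<in>set b. i + 2 \<le> j \<Longrightarrow> tl_reduces ([i] @ b) 0 (b @ [i])"
proof (induction b)
  case Nil
  show ?case using tl_reduces.refl[of "[i]"] by simp
next
  case (Cons j b)
  have "tl_reduces ([i] @ j # b) 0 ([] @ [i, j] @ b)" using tl_reduces.refl by simp
  then have "tl_reduces ([i] @ j # b) 0 ([] @ [j, i] @ b)" by (rule tl_reduces.far) (use Cons in simp)
  moreover have "tl_reduces ([j] @ ([i] @ b) @ []) 0 ([j] @ (b @ [i]) @ [])"
    by (rule tl_reduces_context) (use Cons in simp)
  ultimately show ?case using tl_reduces_trans by fastforce
qed

lemma tl_reduces_pull_left: "\<forall>j\<in>set b. i + 2 \<le> j \<Longrightarrow> tl_reduces (b @ [i]) 0 ([i] @ b)"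
proof (induction b)
  case Nil
  show ?case using tl_reduces.refl[of "[i]"] by simp
next
  case (Cons j b)
  have "tl_reduces ([j] @ (b @ [i]) @ []) 0 ([j] @ ([i] @ b) @ [])"
    by (rule tl_reduces_context) (use Cons in simp)
  then have "tl_reduces ((j # b) @ [i]) 0 ([] @ [j, i] @ b)" by simp
  then have "tl_reduces ((j # b) @ [i]) 0 ([] @ [i, j] @ b)" by (rule tl_reduces.far) (use Cons in simp)
  then show ?case by simp
qed

text \<open>
  Between two consecutive occurrences of the smallest generator \<open>m\<close> the word can be assumed, by
  induction on the number of generators, to contain \<open>m + 1\<close> at most once. Without \<open>m + 1\<close> the two
  letters \<open>m\<close> can be moved together and squared; with one \<open>m + 1\<close> they form a zigzag. Either way the
  word gets shorter.
\<close>

lemma jones_normal_form: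
  "set w \<subseteq> {m..<m + N} \<Longrightarrow> \<exists>c v. tl_reduces w c v \<and> length v \<le> length w \<and> count_list v m \<le> 1"
proof (induction N arbitrary: m w)
  case 0
  then show ?case by (intro exI[of _ 0] exI[of _ w]) (auto intro: tl_reduces.refl)
next
  case (Suc N)
  note outer = Suc.IH
  show ?case using Suc.prems
  proof (induction "length w" arbitrary: w rule: less_induct)
    case less
    \<comment> \<open>any reduction to a shorter word suffices, by the inner induction on the length\<close>
    have step: "\<exists>c v. tl_reduces w c v \<and> length v \<le> length w \<and> count_list v m \<le> 1"
      if "tl_reduces w c v" "length v < length w" for c v
    proof -
      have "set v \<subseteq> {m..<m + Suc N}" using tl_reduces_valid[OF that(1)] less.prems by blast
      from less.hyps[OF that(2) this] obtain c' v' where "tl_reduces v c' v'" "length v' \<le> length v" "count_list v' m \<le> 1"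
        by blast
      then show ?thesis using tl_reduces_trans[OF _ that(1)] that(2) by (meson le_trans less_imp_le)
    qed
    show ?case
    proof (cases "count_list w m \<le> 1")
      case True
      then show ?thesis by (intro exI[of _ 0] exI[of _ w]) (auto intro: tl_reduces.refl)
    next
      case False
      then have "m \<in> set w" by (metis count_notin zero_le)
      then obtain a r where a: "w = a @ m # r" "m \<notin> set a" by (meson split_list_first)
      then have "m \<in> set r" using False by (cases "m \<in> set r") auto
      then obtain b c where b: "r = b @ m # c" "m \<notin> set b" by (meson split_list_first)
      have "set b \<subseteq> {Suc m..<Suc m + N}"
      proof
        fix j assume "j \<in> set b"
        then have "j \<in> {m..<m + Suc N}" "j \<noteq> m" using less.prems a b by auto
        then show "j \<in> {Suc m..<Suc m + N}" by auto
      qed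
      note bset = this
      from outer[OF bset] obtain c1 b' where b': "tl_reduces b c1 b'" "length b' \<le> length b" "count_list b' (Suc m) \<le> 1"
        by blast
      have b'set: "set b' \<subseteq> {Suc m..}" using tl_reduces_valid[OF b'(1)] bset by auto
      have w: "w = (a @ [m]) @ b @ (m # c)" using a b by simp
      have t1: "tl_reduces w c1 ((a @ [m]) @ b' @ (m # c))" unfolding w by (rule tl_reduces_context[OF b'(1)])
      show ?thesis
      proof (cases "Suc m \<in> set b'")
        case False
        have "\<forall>j\<in>set b'. m + 2 \<le> j"
        proof
          fix j assume "j \<in> set b'"
          then have "j \<noteq> Suc m" "Suc m \<le> j" using False b'set by auto
          then show "m + 2 \<le> j" by simp
        qed
        from tl_reduces_context[OF tl_reduces_pull_right[OF this], of a "m # c"]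
        have "tl_reduces (a @ ([m] @ b') @ m # c) 0 (a @ (b' @ [m]) @ m # c)" .
        with t1 have "tl_reduces w c1 ((a @ b') @ [m, m] @ c)"
          using tl_reduces_trans[of "a @ m # b' @ m # c" 0 "a @ b' @ m # m # c" w c1] by simp
        from tl_reduces.sq[OF this] show ?thesis by (rule step) (use w b' in simp)
      next
        case True
        then obtain x y where xy: "b' = x @ Suc m # y" by (meson split_list)
        have nx: "Suc m \<notin> set x" "Suc m \<notin> set y"
          using b'(3) unfolding xy by (auto simp: count_list_0_iff[symmetric])
        have fx: "\<forall>j\<in>set x. m + 2 \<le> j" and fy: "\<forall>j\<in>set y. m + 2 \<le> j"
        proof -
          have "m + 2 \<le> j" if "j \<in> set x \<union> set y" for j
          proof -
            have "j \<noteq> Suc m" "Suc m \<le> j" using that nx b'set xy by auto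
            then show ?thesis by simp
          qed
          then show "\<forall>j\<in>set x. m + 2 \<le> j" "\<forall>j\<in>set y. m + 2 \<le> j" by auto
        qed
        have "tl_reduces (a @ m # x @ Suc m # y @ m # c) 0 (a @ m # x @ Suc m # m # y @ c)"
          using tl_reduces_context[OF tl_reduces_pull_left[OF fy], of "a @ m # x @ [Suc m]" c] by simp
        moreover have "tl_reduces (a @ m # x @ Suc m # m # y @ c) 0 (a @ x @ m # Suc m # m # y @ c)"
          using tl_reduces_context[OF tl_reduces_pull_right[OF fx], of a "[Suc m, m] @ y @ c"] by simp
        ultimately have "tl_reduces (a @ m # x @ Suc m # y @ m # c) 0 (a @ x @ m # Suc m # m # y @ c)"
          using tl_reduces_trans by fastforce
        with t1 have "tl_reduces w c1 ((a @ x) @ [m, Suc m, m] @ (y @ c))"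
          using tl_reduces_trans[of "a @ m # x @ Suc m # y @ m # c" 0 "a @ x @ m # Suc m # m # y @ c" w c1] xy by simp
        from tl_reduces.zig[OF this] show ?thesis
          by (rule step) (use w b'(2) xy in simp)
      qed
    qed
  qed
qed

text \<open>
  A word with at most one \<open>e\<^sub>0\<close> is evaluated by removing the leftmost strand. The exponent is the same
  for all \<open>T\<close> and \<open>d\<close>; this uniformity transfers the count of circles from the model with loop value
  \<open>2\<close> to the quantum model.
\<close>

theorem markov_unique:
  assumes "valid p w"
  shows "\<exists>c. \<forall>(T :: nat \<Rightarrow> nat list \<Rightarrow> 'a::comm_ring_1) d. markov T d \<longrightarrow> T p w = d ^ c"
  using assms
proof (induction p arbitrary: w)
  case 0
  then have "w = []" by (cases w) (auto simp: valid_def)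
  then show ?case by (intro exI[of _ 0]) (simp add: markov.T_empty)
next
  case (Suc p)
  have "set w \<subseteq> {0..<0 + p}" using Suc.prems by (auto simp: valid_def)
  from jones_normal_form[OF this] obtain c v where v: "tl_reduces w c v" "count_list v 0 \<le> 1" by blast
  have vset: "set v \<subseteq> {0..<p}" using tl_reduces_valid[OF v(1)] \<open>set w \<subseteq> _\<close> by auto
  have unmap: "\<exists>x. y = map Suc x \<and> valid p x" if "0 \<notin> set y" "set y \<subseteq> {0..<p}" for y
  proof (intro exI[of _ "map (\<lambda>i. i - 1) y"] conjI)
    have i: "i = Suc (i - 1)" "Suc (i - 1) < p" if "i \<in> set y" for i
    proof -
      have "i \<noteq> 0" "i < p" using that \<open>0 \<notin> set y\<close> \<open>set y \<subseteq> _\<close> by (metis, auto)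
      then show "i = Suc (i - 1)" "Suc (i - 1) < p" by auto
    qed
    show "y = map Suc (map (\<lambda>i. i - 1) y)"
      unfolding map_map by (rule map_idI[symmetric]) (use i in auto)
    show "valid p (map (\<lambda>i. i - 1) y)"
      unfolding valid_def set_map using i by blast
  qed
  show ?case
  proof (cases "0 \<in> set v")
    case False
    from unmap[OF False vset] obtain x where x: "v = map Suc x" "valid p x" by blast
    from Suc.IH[OF x(2)] obtain c' where c': "\<forall>(T :: nat \<Rightarrow> nat list \<Rightarrow> 'a) d. markov T d \<longrightarrow> T p x = d ^ c'" by blast
    have "T (Suc p) w = d ^ (c + Suc c')" if "markov T d" for T :: "nat \<Rightarrow> nat list \<Rightarrow> 'a" and d
    proof -
      have "T (Suc p) w = d ^ c * T (Suc p) v" by (rule markov_tl_reduces[OF v(1) that])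
      also have "T (Suc p) v = d * T p x" using markov.T_map_Suc[OF that] x by simp
      finally show ?thesis using c' that by (simp add: power_add)
    qed
    then show ?thesis by blast
  next
    case True
    then obtain a b where ab: "v = a @ 0 # b" by (meson split_list)
    then have "0 \<notin> set (b @ a)" using v(2) by (auto simp: count_list_0_iff[symmetric])
    moreover have "set (b @ a) \<subseteq> {0..<p}" using vset ab by auto
    ultimately obtain x where x: "b @ a = map Suc x" "valid p x" using unmap by blast
    have p: "p \<ge> 1" using vset ab by auto
    \<comment> \<open>rotate the word cyclically until its only \<open>e\<^sub>0\<close> stands in front\<close>
    have va: "valid (Suc p) a" "valid (Suc p) (0 # b)" using vset ab by (auto simp: valid_def)
    from Suc.IH[OF x(2)] obtain c' where c': "\<forall>(T :: nat \<Rightarrow> nat list \<Rightarrow> 'a) d. markov T d \<longrightarrow> T p x = d ^ c'" by blast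
    have "T (Suc p) w = d ^ (c + c')" if "markov T d" for T :: "nat \<Rightarrow> nat list \<Rightarrow> 'a" and d
    proof -
      have "T (Suc p) w = d ^ c * T (Suc p) v" by (rule markov_tl_reduces[OF v(1) that])
      also have "T (Suc p) v = T (Suc p) ((0 # b) @ a)"
        using markov.T_cyclic[OF that va] ab by simp
      also have "(0 # b) @ a = 0 # map Suc x" using x by simp
      also have "T (Suc p) (0 # map Suc x) = T p x" using markov.T_Cons_map_Suc[OF that p] .
      finally show ?thesis using c' that by (simp add: power_add)
    qed
    then show ?thesis by blast
  qed
qed

section \<open>Counting the circles of a resolved diagram\<close>

text \<open>
  A set that contains both or neither end of every edge is a union of connected components.
\<close>

lemma card_unions_of_classes:
  assumes "finite X" "R \<subseteq> X \<times> X"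
  shows "card {S. S \<subseteq> X \<and> (\<forall>(a, b)\<in>R. a \<in> S \<longleftrightarrow> b \<in> S)} = 2 ^ card (X // (R \<union> R\<inverse>)\<^sup>*)"
proof -
  define E where "E = (R \<union> R\<inverse>)\<^sup>*"
  have symE: "sym E" unfolding E_def by (intro sym_rtrancl) (auto simp: sym_def)
  have transE: "(x, y) \<in> E \<Longrightarrow> (y, z) \<in> E \<Longrightarrow> (x, z) \<in> E" for x y z
    unfolding E_def by (rule rtrancl_trans)
  have EX: "(x, y) \<in> E \<Longrightarrow> x \<in> X \<Longrightarrow> y \<in> X" for x y
    unfolding E_def by (induction rule: rtrancl_induct) (use assms(2) in auto)
  have reflE: "(x, x) \<in> E" for x unfolding E_def by simp
  have class_eq: "c = E `` {y}" if cy: "c \<in> X // E" "y \<in> c" for c y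
  proof -
    obtain x where x: "c = E `` {x}" using cy(1) by (rule quotientE)
    then have "(x, y) \<in> E" using cy(2) by simp
    moreover then have "(y, x) \<in> E" using symE by (simp add: symD)
    ultimately show ?thesis using x transE by blast
  qed
  have class_sub: "c \<subseteq> X" if "c \<in> X // E" for c
    using that EX unfolding quotient_def by blast
  have closed: "a \<in> S \<longleftrightarrow> b \<in> S" if "\<forall>(a, b)\<in>R. a \<in> S \<longleftrightarrow> b \<in> S" "(a, b) \<in> E" for a b S
    using that(2) unfolding E_def by (induction rule: rtrancl_induct) (use that(1) in auto)
  have "bij_betw Union (Pow (X // E)) {S. S \<subseteq> X \<and> (\<forall>(a, b)\<in>R. a \<in> S \<longleftrightarrow> b \<in> S)}"
    unfolding bij_betw_def
  proof
    have sub: "C \<subseteq> D" if CD: "C \<subseteq> X // E" "D \<subseteq> X // E" "\<Union>C = \<Union>D" for C D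
    proof
      fix c assume c: "c \<in> C"
      then obtain x where x: "x \<in> X" "c = E `` {x}" using CD(1) by (meson quotientE subsetD)
      then have "x \<in> c" using reflE by auto
      then obtain d where d: "d \<in> D" "x \<in> d" using CD(3) c by blast
      then have "d = E `` {x}" using class_eq CD(2) by blast
      then show "c \<in> D" using d x by simp
    qed
    show "inj_on Union (Pow (X // E))"
    proof (rule inj_onI)
      fix C D assume "C \<in> Pow (X // E)" "D \<in> Pow (X // E)" "\<Union>C = \<Union>D"
      then show "C = D" using sub[of C D] sub[of D C] by (simp add: subset_antisym)
    qed
    show "Union ` Pow (X // E) = {S. S \<subseteq> X \<and> (\<forall>(a, b)\<in>R. a \<in> S \<longleftrightarrow> b \<in> S)}"
    proof (intro equalityI subsetI)
      fix S assume "S \<in> Union ` Pow (X // E)"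
      then obtain C where C: "C \<subseteq> X // E" "S = \<Union>C" by auto
      have step: "b \<in> S" if ab: "(a, b) \<in> E" "a \<in> S" for a b
      proof -
        obtain c where c: "c \<in> C" "a \<in> c" using ab(2) C by auto
        then have "c = E `` {a}" using class_eq C by blast
        then show ?thesis using c ab C by auto
      qed
      have "(a, b) \<in> E" "(b, a) \<in> E" if "(a, b) \<in> R" for a b
        using that unfolding E_def by auto
      then have "\<forall>(a, b)\<in>R. a \<in> S \<longleftrightarrow> b \<in> S" using step by blast
      moreover have "S \<subseteq> X" using C class_sub by blast
      ultimately show "S \<in> {S. S \<subseteq> X \<and> (\<forall>(a, b)\<in>R. a \<in> S \<longleftrightarrow> b \<in> S)}" by simp
    next
      fix S assume S: "S \<in> {S. S \<subseteq> X \<and> (\<forall>(a, b)\<in>R. a \<in> S \<longleftrightarrow> b \<in> S)}"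
      have "S = \<Union>((\<lambda>x. E `` {x}) ` S)" using reflE closed S by blast
      moreover have "(\<lambda>x. E `` {x}) ` S \<subseteq> X // E" using S by (auto simp: quotient_def)
      ultimately show "S \<in> Union ` Pow (X // E)" by blast
    qed
  qed
  then have "card {S. S \<subseteq> X \<and> (\<forall>(a, b)\<in>R. a \<in> S \<longleftrightarrow> b \<in> S)} = card (Pow (X // E))"
    by (simp add: bij_betw_same_card)
  also have "finite (X // E)"
    using assms(1) by (simp add: quotient_def)
  then have "card (Pow (X // E)) = 2 ^ card (X // E)" by (rule card_Pow)
  finally show ?thesis unfolding E_def .
qed

text \<open>
  Positions are shifted because the generators of the braid words are numbered from \<open>1\<close> and the
  operators from \<open>0\<close>.
\<close>

fun cap_cup_indices :: "smoothing list \<Rightarrow> nat list" where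
  "cap_cup_indices [] = []"
| "cap_cup_indices (Vertical # fs) = cap_cup_indices fs"
| "cap_cup_indices (Cap_Cup i # fs) = (i - 1) # cap_cup_indices fs"

lemma cap_cup_indices_append: "cap_cup_indices (fs @ gs) = cap_cup_indices fs @ cap_cup_indices gs"
  by (induction fs rule: cap_cup_indices.induct) auto

definition smoothings_ok :: "nat \<Rightarrow> smoothing list \<Rightarrow> bool" where
  "smoothings_ok p fs \<longleftrightarrow> (\<forall>i. Cap_Cup i \<in> set fs \<longrightarrow> 1 \<le> i \<and> i < p)"

lemma valid_cap_cup_indices: "smoothings_ok p fs \<Longrightarrow> valid p (cap_cup_indices fs)"
  by (induction fs rule: cap_cup_indices.induct) (auto simp: smoothings_ok_def valid_def)

definition delta_bool :: "bool \<Rightarrow> bool \<Rightarrow> 'a::comm_ring_1" where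
  "delta_bool a b = (if a = b then 1 else 0)"

interpretation brauer: loop_model "delta_bool :: bool \<Rightarrow> bool \<Rightarrow> 'a::comm_ring_1" delta_bool "\<lambda>_. 1" 2
  by standard (auto simp: delta_bool_def bool_sum_def)

lemma scons_upd_0: "(x ## t)(0 := b) = b ## t"
  and scons_upd_Suc: "(x ## t)(Suc i := b) = x ## t(i := b)"
  by (auto simp: scons_def fun_eq_iff split: nat.split)

text \<open>
  With all weights equal to Kronecker deltas, a cup-cap pair requires equal bits on either side of the
  resolved crossing, so a matrix entry of a product counts colourings of the diagram by bits.
\<close>

lemma brauer_e: "brauer.e i f s = (if s i = s (Suc i) then f (s(i := False, Suc i := False)) + f (s(i := True, Suc i := True)) else 0)"
proof (induction i arbitrary: f s)
  case 0
  obtain x y t where s: "s = x ## y ## t" by (metis scons_cases)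
  show ?case
    unfolding s brauer.e_def brauer.cap.simps brauer.cup.simps brauer.cup0_def brauer.cap0_def bool_sum_def
    by (simp add: delta_bool_def scons_upd_0 scons_upd_Suc)
next
  case (Suc i)
  obtain x t where s: "s = x ## t" by (metis scons_cases)
  show ?case unfolding s by (simp add: brauer.e_Suc Suc scons_upd_Suc)
qed

fun compatible :: "smoothing \<Rightarrow> config \<Rightarrow> config \<Rightarrow> bool" where
  "compatible Vertical s t \<longleftrightarrow> s = t"
| "compatible (Cap_Cup i) s t \<longleftrightarrow> s (i - 1) = s i \<and> t (i - 1) = t i \<and> (\<forall>j. j \<noteq> i - 1 \<longrightarrow> j \<noteq> i \<longrightarrow> s j = t j)"

lemma brauer_step:
  assumes "smoothings_ok p [x]" "s \<in> configs p"
  shows "brauer.e_word (cap_cup_indices [x]) f s = (\<Sum>t | t \<in> configs p \<and> compatible x s t. f t)"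
proof (cases x)
  case Vertical
  then have "{t. t \<in> configs p \<and> compatible x s t} = {s}" using assms by auto
  then show ?thesis by (simp add: Vertical)
next
  case (Cap_Cup i)
  define a where "a = i - 1"
  have i: "i = Suc a" "Suc a < p" using assms(1) Cap_Cup by (auto simp: smoothings_ok_def a_def)
  show ?thesis
  proof (cases "s a = s (Suc a)")
    case True
    have "t = s(a := t a, Suc a := t a)" if "compatible x s t" for t
      using that Cap_Cup i by (auto simp: fun_eq_iff)
    moreover have "compatible x s (s(a := b, Suc a := b))" for b
      using True Cap_Cup i by auto
    moreover have "s(a := b, Suc a := b) \<in> configs p" for b
      using assms(2) i by (auto simp: configs_def)
    ultimately have "{t. t \<in> configs p \<and> compatible x s t} = {s(a := False, Suc a := False), s(a := True, Suc a := True)}"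
      by (auto, metis)
    moreover have "s(a := False, Suc a := False) \<noteq> s(a := True, Suc a := True)"
      by (metis fun_upd_same)
    ultimately show ?thesis by (simp add: Cap_Cup i brauer_e True)
  next
    case False
    then have "{t. t \<in> configs p \<and> compatible x s t} = {}" using Cap_Cup i by auto
    then show ?thesis using False by (simp add: Cap_Cup i brauer_e)
  qed
qed

definition row :: "(nat \<times> nat) set \<Rightarrow> nat \<Rightarrow> config" where
  "row S j = (\<lambda>i. (Suc i, j) \<in> S)"

definition labellings :: "nat \<Rightarrow> smoothing list \<Rightarrow> (nat \<times> nat) set set" where
  "labellings p fs = {S. S \<subseteq> {1..p} \<times> {0..length fs} \<and> (\<forall>j<length fs. compatible (fs ! j) (row S j) (row S (Suc j)))}"

lemma configs_less: "s \<in> configs p \<Longrightarrow> s i \<Longrightarrow> i < p"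
  unfolding configs_def using not_le by blast

lemma row_in_configs: "S \<subseteq> {1..p} \<times> J \<Longrightarrow> row S j \<in> configs p"
  by (auto simp: row_def configs_def)

lemma finite_labellings: "finite (labellings p fs)"
  by (rule finite_subset[of _ "Pow ({1..p} \<times> {0..length fs})"]) (auto simp: labellings_def)

text \<open>
  A function applied to the rows of a colouring, summed over all colourings with prescribed first
  row. Stating this for arbitrary \<open>f\<close> makes the induction on the last piece work.
\<close>

lemma brauer_labellings:
  assumes "smoothings_ok p fs" "s \<in> configs p"
  shows "brauer.e_word (cap_cup_indices fs) f s = (\<Sum>S | S \<in> labellings p fs \<and> row S 0 = s. f (row S (length fs)))"
  using assms
proof (induction fs arbitrary: f rule: rev_induct)
  case Nil
  have "{S. S \<in> labellings p [] \<and> row S 0 = s} = {{(Suc i, 0) |i. s i}}"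
  proof (intro equalityI subsetI)
    fix S assume "S \<in> {S. S \<in> labellings p [] \<and> row S 0 = s}"
    then have S: "S \<subseteq> {1..p} \<times> {0}" "row S 0 = s" by (auto simp: labellings_def)
    have "S = {(Suc i, 0) |i. s i}"
    proof (intro equalityI subsetI)
      fix z assume z: "z \<in> S"
      then obtain i where "z = (Suc i, 0)" using S(1) by (cases z; cases "fst z") auto
      with z S(2) show "z \<in> {(Suc i, 0) |i. s i}" by (auto simp: row_def)
    qed (use S(2) in \<open>auto simp: row_def\<close>)
    then show "S \<in> {{(Suc i, 0) |i. s i}}" by simp
  next
    fix S assume "S \<in> {{(Suc i, 0::nat) |i. s i}}"
    moreover have "Suc i \<in> {1..p}" if "s i" for i
      using configs_less[OF Nil.prems(2) that] by simp
    ultimately show "S \<in> {S. S \<in> labellings p [] \<and> row S 0 = s}"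
      by (auto simp: labellings_def row_def)
  qed
  moreover have "row {(Suc i, 0) |i. s i} 0 = s" by (simp add: row_def)
  ultimately show ?case by simp
next
  case (snoc x fs)
  define m where "m = length fs"
  have ok: "smoothings_ok p fs" "smoothings_ok p [x]"
    using snoc.prems by (auto simp: smoothings_ok_def)
  define top :: "config \<Rightarrow> (nat \<times> nat) set" where "top t = {(Suc i, Suc m) |i. t i}" for t
  define A where "A = {S. S \<in> labellings p fs \<and> row S 0 = s}"
  define B where "B = {S. S \<in> labellings p (fs @ [x]) \<and> row S 0 = s}"
  have row_top: "row (S \<union> top t) j = (if j = Suc m then t else row S j)" if "S \<in> A" for S t j
    using that by (auto simp: A_def labellings_def row_def top_def m_def fun_eq_iff)
  have top_sub: "top t \<subseteq> {1..p} \<times> {0..Suc m}" if "t \<in> configs p" for t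
    using configs_less[OF that] by (auto simp: top_def Suc_le_eq)
  have "brauer.e_word (cap_cup_indices (fs @ [x])) f s = brauer.e_word (cap_cup_indices fs) (brauer.e_word (cap_cup_indices [x]) f) s"
    by (simp add: cap_cup_indices_append brauer.e_word_append)
  also have "\<dots> = (\<Sum>S\<in>A. brauer.e_word (cap_cup_indices [x]) f (row S m))"
    unfolding A_def m_def by (rule snoc.IH) (use ok snoc.prems in auto)
  also have "\<dots> = (\<Sum>S\<in>A. \<Sum>t | t \<in> configs p \<and> compatible x (row S m) t. f t)"
  proof (rule sum.cong)
    fix S assume "S \<in> A"
    then have "S \<subseteq> {1..p} \<times> {0..m}" by (simp add: A_def labellings_def m_def)
    then show "brauer.e_word (cap_cup_indices [x]) f (row S m) = (\<Sum>t | t \<in> configs p \<and> compatible x (row S m) t. f t)"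
      by (intro brauer_step[OF ok(2)] row_in_configs)
  qed simp
  also have "\<dots> = (\<Sum>(S, t)\<in>(SIGMA S:A. {t. t \<in> configs p \<and> compatible x (row S m) t}). f t)"
    by (rule sum.Sigma) (auto simp: A_def finite_labellings finite_configs)
  also have "\<dots> = (\<Sum>S\<in>B. f (row S (Suc m)))"
  proof (rule sum.reindex_bij_witness[of _ "\<lambda>S. (S \<inter> UNIV \<times> {0..m}, row S (Suc m))" "\<lambda>(S, t). S \<union> top t"])
    fix a assume "a \<in> (SIGMA S:A. {t. t \<in> configs p \<and> compatible x (row S m) t})"
    then obtain S t where a: "a = (S, t)" "S \<in> A" "t \<in> configs p" "compatible x (row S m) t" by auto
    have Ssub: "S \<subseteq> {1..p} \<times> {0..m}" using a by (auto simp: A_def labellings_def m_def)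
    show "f (row (case a of (S, t) \<Rightarrow> S \<union> top t) (Suc m)) = (case a of (S, t) \<Rightarrow> f t)"
      using a by (simp add: row_top)
    have "(S \<union> top t) \<inter> UNIV \<times> {0..m} = S" using Ssub by (auto simp: top_def)
    then show "((case a of (S, t) \<Rightarrow> S \<union> top t) \<inter> UNIV \<times> {0..m}, row (case a of (S, t) \<Rightarrow> S \<union> top t) (Suc m)) = a"
      using a by (simp add: row_top)
    have "S \<union> top t \<subseteq> {1..p} \<times> {0..Suc m}" using Ssub top_sub[OF a(3)] by auto
    moreover have "compatible ((fs @ [x]) ! j) (row (S \<union> top t) j) (row (S \<union> top t) (Suc j))" if "j < Suc m" for j
      using that a by (cases "j = m") (auto simp: row_top nth_append m_def A_def labellings_def)
    ultimately have "S \<union> top t \<in> B"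
      using a by (auto simp: B_def labellings_def m_def row_top[unfolded m_def] A_def)
    then show "(case a of (S, t) \<Rightarrow> S \<union> top t) \<in> B" using a by simp
  next
    fix S assume S: "S \<in> B"
    then have Ssub: "S \<subseteq> {1..p} \<times> {0..Suc m}" by (auto simp: B_def labellings_def m_def)
    have row_int: "row (S \<inter> UNIV \<times> {0..m}) j = row S j" if "j \<le> m" for j
      using that by (auto simp: row_def)
    show "(case (S \<inter> UNIV \<times> {0..m}, row S (Suc m)) of (S, t) \<Rightarrow> S \<union> top t) = S"
    proof -
      have "z \<in> S \<inter> UNIV \<times> {0..m} \<union> top (row S (Suc m))" if zS: "z \<in> S" for z
      proof -
        obtain i j where z: "z = (Suc i, j)" "j \<le> Suc m" using zS Ssub by (cases z; cases "fst z") auto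
        then show ?thesis using zS by (cases "j = Suc m") (auto simp: top_def row_def)
      qed
      moreover have "top (row S (Suc m)) \<subseteq> S" by (auto simp: top_def row_def)
      ultimately show ?thesis by auto
    qed
    have c: "compatible ((fs @ [x]) ! j) (row S j) (row S (Suc j))" if "j < Suc m" for j
      using S that by (auto simp: B_def labellings_def m_def)
    have "S \<inter> UNIV \<times> {0..m} \<in> A"
      using S Ssub c by (auto simp: A_def B_def labellings_def m_def row_int[unfolded m_def] nth_append less_Suc_eq)
    moreover have "compatible x (row S m) (row S (Suc m))" using c[of m] by (simp add: m_def)
    ultimately show "(S \<inter> UNIV \<times> {0..m}, row S (Suc m)) \<in> (SIGMA S:A. {t. t \<in> configs p \<and> compatible x (row S m) t})"
      using row_in_configs[OF Ssub] by (auto simp: row_int)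
  qed
  finally show ?case by (simp add: B_def m_def)
qed

lemma compatible_piece_arcs:
  assumes "S \<subseteq> {1..p} \<times> J" "smoothings_ok p [x]"
  shows "compatible x (row S j) (row S (Suc j)) \<longleftrightarrow> (\<forall>(a, b)\<in>piece_arcs p j x. a \<in> S \<longleftrightarrow> b \<in> S)"
proof (cases x)
  case Vertical
  have "row S j = row S (Suc j) \<longleftrightarrow> (\<forall>y\<in>{1..p}. (y, j) \<in> S \<longleftrightarrow> (y, Suc j) \<in> S)"
  proof
    assume "row S j = row S (Suc j)"
    then have "(Suc i, j) \<in> S \<longleftrightarrow> (Suc i, Suc j) \<in> S" for i by (auto simp: row_def fun_eq_iff)
    then show "\<forall>y\<in>{1..p}. (y, j) \<in> S \<longleftrightarrow> (y, Suc j) \<in> S" by (metis atLeastAtMost_iff Suc_pred' Suc_le_eq One_nat_def)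
  next
    assume *: "\<forall>y\<in>{1..p}. (y, j) \<in> S \<longleftrightarrow> (y, Suc j) \<in> S"
    have "(Suc i, j) \<in> S \<longleftrightarrow> (Suc i, Suc j) \<in> S" for i
      using * assms(1) by (cases "Suc i \<le> p") auto
    then show "row S j = row S (Suc j)" by (auto simp: row_def)
  qed
  then show ?thesis by (auto simp: Vertical)
next
  case (Cap_Cup i)
  define a where "a = i - 1"
  have i: "i = Suc a" "Suc a < p" using assms(2) Cap_Cup by (auto simp: smoothings_ok_def a_def)
  have "(\<forall>l. l \<noteq> a \<longrightarrow> l \<noteq> Suc a \<longrightarrow> row S j l = row S (Suc j) l) \<longleftrightarrow> (\<forall>y\<in>{1..p} - {Suc a, Suc (Suc a)}. (y, j) \<in> S \<longleftrightarrow> (y, Suc j) \<in> S)"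
  proof
    assume *: "\<forall>l. l \<noteq> a \<longrightarrow> l \<noteq> Suc a \<longrightarrow> row S j l = row S (Suc j) l"
    show "\<forall>y\<in>{1..p} - {Suc a, Suc (Suc a)}. (y, j) \<in> S \<longleftrightarrow> (y, Suc j) \<in> S"
    proof
      fix y assume "y \<in> {1..p} - {Suc a, Suc (Suc a)}"
      then obtain l where "y = Suc l" "l \<noteq> a" "l \<noteq> Suc a" by (cases y) auto
      then show "(y, j) \<in> S \<longleftrightarrow> (y, Suc j) \<in> S" using * by (auto simp: row_def)
    qed
  next
    assume *: "\<forall>y\<in>{1..p} - {Suc a, Suc (Suc a)}. (y, j) \<in> S \<longleftrightarrow> (y, Suc j) \<in> S"
    have "(Suc l, j) \<in> S \<longleftrightarrow> (Suc l, Suc j) \<in> S" if "l \<noteq> a" "l \<noteq> Suc a" for l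
      using * that assms(1) by (cases "Suc l \<le> p") auto
    then show "\<forall>l. l \<noteq> a \<longrightarrow> l \<noteq> Suc a \<longrightarrow> row S j l = row S (Suc j) l" by (auto simp: row_def)
  qed
  moreover have "row S j a = row S j (Suc a) \<longleftrightarrow> ((Suc a, j) \<in> S \<longleftrightarrow> (Suc (Suc a), j) \<in> S)" for j
    by (simp add: row_def)
  moreover have "(\<forall>(u, v)\<in>piece_arcs p j (Cap_Cup (Suc a)). u \<in> S \<longleftrightarrow> v \<in> S) \<longleftrightarrow>
      (\<forall>y\<in>{1..p} - {Suc a, Suc (Suc a)}. (y, j) \<in> S \<longleftrightarrow> (y, Suc j) \<in> S) \<and>
      ((Suc a, j) \<in> S \<longleftrightarrow> (Suc (Suc a), j) \<in> S) \<and> ((Suc a, Suc j) \<in> S \<longleftrightarrow> (Suc (Suc a), Suc j) \<in> S)"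
  proof -
    have *: "{((x, j), x, Suc j) |x. x \<in> Y} = (\<lambda>x. ((x, j), x, Suc j)) ` Y" for Y by auto
    show ?thesis unfolding piece_arcs.simps ball_Un * ball_simps by simp
  qed
  ultimately show ?thesis unfolding Cap_Cup i compatible.simps diff_Suc_1 by (simp only: conj_ac)
qed

lemma piece_arcs_sub:
  assumes "smoothings_ok p [x]" "j < m"
  shows "piece_arcs p j x \<subseteq> ({1..p} \<times> {0..m}) \<times> ({1..p} \<times> {0..m})"
  using assms by (cases x) (auto simp: smoothings_ok_def)

text \<open>
  The trace identifies the first with the last row, so it counts the colourings of the closed diagram;
  each of the circles is coloured independently by one of two bits.
\<close>

lemma brauer_wtrace:
  assumes "smoothings_ok p fs"
  shows "brauer.wtrace p (brauer.e_word (cap_cup_indices fs)) = (2 :: 'a::comm_ring_1) ^ num_circles p fs"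
proof -
  let ?X = "{1..p} \<times> {0..length fs}" and ?m = "length fs"
  have ok: "smoothings_ok p [fs ! j]" if "j < ?m" for j
    using assms that by (auto simp: smoothings_ok_def)
  have sub: "closure_arcs p fs \<subseteq> ?X \<times> ?X"
    unfolding closure_arcs_def
  proof (intro Un_least UN_least)
    fix j assume "j \<in> {..<?m}"
    then show "piece_arcs p j (fs ! j) \<subseteq> ?X \<times> ?X" by (intro piece_arcs_sub ok) auto
  qed auto
  have close: "row S ?m = row S 0 \<longleftrightarrow> (\<forall>y\<in>{1..p}. (y, ?m) \<in> S \<longleftrightarrow> (y, 0) \<in> S)" if "S \<subseteq> ?X" for S
  proof
    assume "row S ?m = row S 0"
    then have "(Suc i, ?m) \<in> S \<longleftrightarrow> (Suc i, 0) \<in> S" for i by (auto simp: row_def fun_eq_iff)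
    then show "\<forall>y\<in>{1..p}. (y, ?m) \<in> S \<longleftrightarrow> (y, 0) \<in> S" by (metis atLeastAtMost_iff Suc_pred' Suc_le_eq One_nat_def)
  next
    assume *: "\<forall>y\<in>{1..p}. (y, ?m) \<in> S \<longleftrightarrow> (y, 0) \<in> S"
    have "(Suc i, ?m) \<in> S \<longleftrightarrow> (Suc i, 0) \<in> S" for i
      using * that by (cases "Suc i \<le> p") auto
    then show "row S ?m = row S 0" by (auto simp: row_def)
  qed
  have set_eq: "{S \<in> labellings p fs. row S ?m = row S 0} = {S. S \<subseteq> ?X \<and> (\<forall>(a, b)\<in>closure_arcs p fs. a \<in> S \<longleftrightarrow> b \<in> S)}"
  proof -
    have "S \<in> labellings p fs \<and> row S ?m = row S 0 \<longleftrightarrow> S \<subseteq> ?X \<and> (\<forall>(a, b)\<in>closure_arcs p fs. a \<in> S \<longleftrightarrow> b \<in> S)" for S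
    proof (cases "S \<subseteq> ?X")
      case True
      have "S \<in> labellings p fs \<longleftrightarrow> (\<forall>j<?m. \<forall>(a, b)\<in>piece_arcs p j (fs ! j). a \<in> S \<longleftrightarrow> b \<in> S)"
        using True compatible_piece_arcs[OF True ok] by (simp add: labellings_def)
      moreover have "(\<forall>(a, b)\<in>closure_arcs p fs. a \<in> S \<longleftrightarrow> b \<in> S) \<longleftrightarrow>
          (\<forall>j<?m. \<forall>(a, b)\<in>piece_arcs p j (fs ! j). a \<in> S \<longleftrightarrow> b \<in> S) \<and> (\<forall>y\<in>{1..p}. (y, ?m) \<in> S \<longleftrightarrow> (y, 0) \<in> S)"
      proof -
        have *: "{((x, ?m), x, 0::nat) |x. x \<in> Y} = (\<lambda>x. ((x, ?m), x, 0)) ` Y" for Y by auto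
        show ?thesis unfolding closure_arcs_def ball_Un ball_UN * ball_simps by (simp add: Ball_def)
      qed
      ultimately show ?thesis using True close[OF True] by (simp only: simp_thms)
    qed (auto simp: labellings_def)
    then show ?thesis by auto
  qed
  have closing_weight: "brauer.closing_weight p s = (1::'a)" for s by (simp add: brauer.closing_weight_def)
  have "brauer.wtrace p (brauer.e_word (cap_cup_indices fs)) = (\<Sum>s\<in>configs p. \<Sum>S | S \<in> labellings p fs \<and> row S 0 = s. ind s (row S ?m) :: 'a)"
    unfolding brauer.wtrace_def closing_weight by (simp add: brauer_labellings[OF assms])
  also have "\<dots> = (\<Sum>s\<in>configs p. \<Sum>S | S \<in> labellings p fs \<and> row S 0 = s. ind (row S 0) (row S ?m))"
    by (intro sum.cong refl) auto
  also have "\<dots> = (\<Sum>S\<in>labellings p fs. ind (row S 0) (row S ?m))"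
      proof (rule sum.group)
    show "(\<lambda>S. row S 0) ` labellings p fs \<subseteq> configs p"
      using row_in_configs[of _ p "{0..?m}"] by (auto simp: labellings_def)
  qed (auto simp: finite_labellings finite_configs)
  also have "\<dots> = of_nat (card {S \<in> labellings p fs. row S ?m = row S 0})"
    by (simp add: ind_def finite_labellings flip: sum.inter_filter)
  also have "card {S \<in> labellings p fs. row S ?m = row S 0} = 2 ^ num_circles p fs"
    unfolding set_eq num_circles_def by (rule card_unions_of_classes[OF _ sub]) simp
  finally show ?thesis by simp
qed

text \<open>
  The trace is \<open>d\<^sup>c\<close> with an exponent common to all models, and \<open>2\<^sup>c\<close> is known from counting colourings.
  The characteristic has to vanish for \<open>2\<^sup>c\<close> to determine \<open>c\<close>.
\<close>

theorem (in loop_model) wtrace_num_circles: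
  assumes "smoothings_ok p fs" "CHAR('a) = 0"
  shows "wtrace p (e_word (cap_cup_indices fs)) = d ^ num_circles p fs"
proof -
  from markov_unique[OF valid_cap_cup_indices[OF assms(1)]] obtain c
    where c: "\<forall>(T :: nat \<Rightarrow> nat list \<Rightarrow> 'a) d. markov T d \<longrightarrow> T p (cap_cup_indices fs) = d ^ c" by blast
  have "(2::'a) ^ num_circles p fs = 2 ^ c"
    using c brauer.markov_wtrace brauer_wtrace[OF assms(1)] by metis
  then have "of_nat (2 ^ num_circles p fs) = (of_nat (2 ^ c) :: 'a)" by simp
  then have "(2::nat) ^ num_circles p fs = 2 ^ c"
    unfolding of_nat_eq_iff_cong_CHAR assms(2) by (simp add: cong_def)
  then have "c = num_circles p fs" by simp
  then show ?thesis using c markov_wtrace by blast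
qed

section \<open>Laurent polynomials: derivation and evaluation at one\<close>

lemma A_pow_mult: "A_pow m * A_pow n = A_pow (m + n)"
  by (simp add: A_pow_def mult_single)

lemma A_pow_0: "A_pow 0 = 1"
  by (simp add: A_pow_def)

lemma A_pow_mult_left: "A_pow m * (A_pow n * x) = A_pow (m + n) * x"
  by (simp add: A_pow_mult flip: mult.assoc)

lemma A_pow_power: "A_pow m ^ k = A_pow (int k * m)"
  by (induction k) (simp_all add: A_pow_0 A_pow_mult algebra_simps)

lemma A_pow_neq_0: "A_pow m \<noteq> 0"
  using A_pow_mult[of m "- m"] A_pow_0 by (metis add.right_inverse mult_zero_left zero_neq_one)

lemma A_pow_inverse: "A_pow 1 * A_pow (- 1) = 1"
  by (simp add: A_pow_mult A_pow_0)

lemma A_pow_eq_power: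
  "A_pow 2 = A_pow 1 ^ 2" "A_pow (- 2) = A_pow (- 1) ^ 2" "A_pow (- 3) = A_pow (- 1) ^ 3"
  by (simp_all add: A_pow_power)

lemma laurent_induct [case_names zero monomial diff]:
  assumes "P 0" "\<And>m. P (A_pow m)" "\<And>f g. P f \<Longrightarrow> P g \<Longrightarrow> P (f - g)"
  shows "P (f :: A_laurent)"
  by (rule frag_induction[of f UNIV P]) (use assms in \<open>auto simp: A_pow_def\<close>)

text \<open>
  The Euler derivation \<open>A d/dA\<close>. It multiplies a monomial by its exponent.
\<close>

definition deriv_A :: "A_laurent \<Rightarrow> A_laurent" where
  "deriv_A f = (\<Sum>m\<in>Poly_Mapping.keys f. Poly_Mapping.single m (m * Poly_Mapping.lookup f m))"

lemma lookup_deriv_A: "Poly_Mapping.lookup (deriv_A f) m = m * Poly_Mapping.lookup f m"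
proof -
  have "Poly_Mapping.lookup (deriv_A f) m = (\<Sum>i\<in>Poly_Mapping.keys f. if i = m then i * Poly_Mapping.lookup f i else 0)"
    by (simp add: deriv_A_def lookup_sum lookup_single when_def)
  then show ?thesis by (simp add: in_keys_iff)
qed

lemma deriv_A_add: "deriv_A (f + g) = deriv_A f + deriv_A g"
  and deriv_A_diff: "deriv_A (f - g) = deriv_A f - deriv_A g"
  and deriv_A_0: "deriv_A 0 = 0"
  by (auto intro!: poly_mapping_eqI simp: lookup_deriv_A lookup_add lookup_minus algebra_simps)

lemma deriv_A_monomial: "deriv_A (A_pow m) = of_int m * A_pow m"
proof (rule poly_mapping_eqI)
  have *: "(of_int m :: A_laurent) = Poly_Mapping.single 0 m" by (simp flip: single_of_int)
  show "Poly_Mapping.lookup (deriv_A (A_pow m)) i = Poly_Mapping.lookup (of_int m * A_pow m) i" for i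
    unfolding * by (simp add: lookup_deriv_A A_pow_def mult_single lookup_single when_def)
qed

lemma deriv_A_mult: "deriv_A (f * g) = deriv_A f * g + f * deriv_A g"
proof (induction f rule: laurent_induct)
  case (monomial m)
  show ?case
  proof (induction g rule: laurent_induct)
    case (monomial n)
    show ?case
      unfolding A_pow_mult deriv_A_monomial by (simp add: algebra_simps flip: A_pow_mult)
  qed (simp_all add: deriv_A_0 deriv_A_diff algebra_simps)
qed (simp_all add: deriv_A_0 deriv_A_diff algebra_simps)

lemma deriv_A_sum: "deriv_A (\<Sum>i\<in>I. f i) = (\<Sum>i\<in>I. deriv_A (f i))"
  by (induction I rule: infinite_finite_induct) (simp_all add: deriv_A_0 deriv_A_add)

text \<open>
  The value at \<open>A = 1\<close>.
\<close>

definition at_one :: "A_laurent \<Rightarrow> int" where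
  "at_one f = (\<Sum>m\<in>Poly_Mapping.keys f. Poly_Mapping.lookup f m)"

lemma at_one_0 [simp]: "at_one 0 = 0"
  by (simp add: at_one_def)

lemma at_one_add [simp]: "at_one (f + g) = at_one f + at_one g"
  unfolding at_one_def by (rule setsum_keys_plus_distrib) auto

lemma at_one_uminus [simp]: "at_one (- f) = - at_one f"
  using at_one_add[of f "- f"] by simp

lemma at_one_diff [simp]: "at_one (f - g) = at_one f - at_one g"
  using at_one_add[of f "- g"] by simp

lemma at_one_A_pow [simp]: "at_one (A_pow m) = 1"
  by (simp add: at_one_def A_pow_def)

lemma at_one_mult [simp]: "at_one (A_pow m * f) = at_one f"
  by (induction f rule: laurent_induct) (simp_all add: A_pow_mult algebra_simps)

lemma at_one_sum [simp]: "at_one (\<Sum>i\<in>I. f i) = (\<Sum>i\<in>I. at_one (f i))"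
  by (induction I rule: infinite_finite_induct) simp_all

lemma CHAR_laurent: "CHAR(A_laurent) = 0"
  by simp

section \<open>The quantum model and its crossings\<close>

text \<open>
  These weights make \<open>e\<^sub>i\<close> act on the pairs \<open>01\<close>, \<open>10\<close> by the symmetric matrix with rows
  \<open>(- A\<^sup>2, 1)\<close> and \<open>(1, - A\<^sup>-\<^sup>2)\<close>, and by zero on \<open>00\<close> and \<open>11\<close>.
\<close>

definition quantum_cup :: "bool \<Rightarrow> bool \<Rightarrow> A_laurent" where
  "quantum_cup x y = (if x = y then 0 else if y then - A_pow 2 else 1)"

definition quantum_cap :: "bool \<Rightarrow> bool \<Rightarrow> A_laurent" where
  "quantum_cap x y = (if x = y then 0 else if y then 1 else - A_pow (- 2))"

definition quantum_close :: "bool \<Rightarrow> A_laurent" where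
  "quantum_close x = (if x then - A_pow 2 else - A_pow (- 2))"

definition loop_value :: A_laurent where
  "loop_value = - A_pow 2 - A_pow (- 2)"

lemma quantum_model: "loop_model quantum_cup quantum_cap quantum_close loop_value"
proof
  fix x y a b c :: bool
  show "bool_sum (\<lambda>b. quantum_cap a b * quantum_cup b c) = (if a = c then 1 else 0)"
    "bool_sum (\<lambda>b. quantum_cup a b * quantum_cap b c) = (if a = c then 1 else 0)"
    "bool_sum (\<lambda>x. quantum_close x * quantum_cup x y * quantum_cap x b) = (if y = b then 1 else 0)"
    "quantum_close x * quantum_close y * quantum_cup x y = quantum_cup x y" "quantum_close x * quantum_close y * quantum_cap x y = quantum_cap x y"
    by (auto simp: bool_sum_def quantum_cup_def quantum_cap_def quantum_close_def A_pow_mult A_pow_0)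
  show "bool_sum (\<lambda>a. bool_sum (\<lambda>b. quantum_cap a b * quantum_cup a b)) = loop_value" "bool_sum quantum_close = loop_value"
    by (auto simp: bool_sum_def quantum_cup_def quantum_cap_def quantum_close_def loop_value_def A_pow_mult)
qed

interpretation q: loop_model quantum_cup quantum_cap quantum_close loop_value
  by (rule quantum_model)

type_synonym lop = "A_laurent op"

definition crossing :: "nat \<Rightarrow> lop" where
  "crossing i f = (\<lambda>s. A_pow 1 * f s + A_pow (- 1) * q.e i f s)"

lemma lin_crossing: "lin (crossing i)"
proof -
  have "crossing i = (\<lambda>f s. A_pow 1 * f s + A_pow (- 1) * q.e i f s)" by (simp add: fun_eq_iff crossing_def)
  then show ?thesis using lin_plus[OF lin_mult[OF lin_id] lin_mult[OF q.lin_e[of i]]] by simp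
qed

lemma crossing_Suc: "crossing (Suc i) f = lift (crossing i) f"
  by (rule config_ext) (simp add: crossing_def q.e_Suc)

lemma e_cup: "q.e i (q.cup i f) = (\<lambda>s. loop_value * q.cup i f s)"
  unfolding q.e_def q.cap_cup by (rule lin_scale[OF q.lin_cup])

lemma cap_e: "q.cap i (q.e i f) = (\<lambda>s. loop_value * q.cap i f s)"
  unfolding q.e_def q.cap_cup ..

lemma crossing_cup: "crossing i (q.cup i f) = (\<lambda>s. - A_pow (- 3) * q.cup i f s)"
  unfolding crossing_def e_cup
proof (rule ext)
  fix s
  show "A_pow 1 * q.cup i f s + A_pow (- 1) * (loop_value * q.cup i f s) = - A_pow (- 3) * q.cup i f s"
    unfolding loop_value_def A_pow_eq_power using A_pow_inverse by algebra
qed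

lemma cap_crossing: "q.cap i (crossing i f) = (\<lambda>s. - A_pow (- 3) * q.cap i f s)"
  unfolding crossing_def lin_add[OF q.lin_cap] lin_scale[OF q.lin_cap] cap_e
proof (rule ext)
  fix s
  show "A_pow 1 * q.cap i f s + A_pow (- 1) * (loop_value * q.cap i f s) = - A_pow (- 3) * q.cap i f s"
    unfolding loop_value_def A_pow_eq_power using A_pow_inverse by algebra
qed

lemma slide_coefficients: "a * (a * x + b * y) + b * (a * (loop_value * x) + b * x) = (y :: A_laurent)"
  if "a = A_pow 1" "b = A_pow (- 1)" for a b
  unfolding loop_value_def A_pow_eq_power that using A_pow_inverse by algebra

text \<open>
  A cup slides past a strand: the second Reidemeister move in the skein module.
\<close>

lemma crossing_crossing_cup: "crossing i (crossing (Suc i) (q.cup i f)) = q.cup (Suc i) f"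
  unfolding crossing_def lin_add[OF q.lin_e] lin_scale[OF q.lin_e] e_cup
  unfolding q.e_def q.cap_Suc_cup q.cap_cup_Suc by (rule ext) (rule slide_coefficients[OF HOL.refl HOL.refl])

lemma crossing_crossing_cup': "crossing (Suc i) (crossing i (q.cup (Suc i) f)) = q.cup i f"
  unfolding crossing_def lin_add[OF q.lin_e] lin_scale[OF q.lin_e] e_cup
  unfolding q.e_def q.cap_Suc_cup q.cap_cup_Suc by (rule ext) (rule slide_coefficients[OF HOL.refl HOL.refl])

lemma cap_crossing_crossing: "q.cap i (crossing (Suc i) (crossing i f)) = q.cap (Suc i) f"
proof -
  have "q.cap i (q.e (Suc i) g) = q.cap (Suc i) g" for g by (simp only: q.e_def q.cap_cup_Suc)
  moreover have "q.cap (Suc i) (q.e i g) = q.cap i g" for g by (simp only: q.e_def q.cap_Suc_cup)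
  ultimately have "q.cap i (crossing (Suc i) (crossing i f)) = (\<lambda>s. A_pow 1 * (A_pow 1 * q.cap i f s + A_pow (- 1) * (loop_value * q.cap i f s))
      + A_pow (- 1) * (A_pow 1 * q.cap (Suc i) f s + A_pow (- 1) * q.cap i f s))"
    by (simp only: crossing_def lin_add[OF q.lin_cap] lin_scale[OF q.lin_cap] cap_e)
  also have "\<dots> = q.cap (Suc i) f"
  proof (rule ext)
    fix s
    show "A_pow 1 * (A_pow 1 * q.cap i f s + A_pow (- 1) * (loop_value * q.cap i f s))
      + A_pow (- 1) * (A_pow 1 * q.cap (Suc i) f s + A_pow (- 1) * q.cap i f s) = q.cap (Suc i) f s"
      unfolding loop_value_def A_pow_eq_power using A_pow_inverse by algebra
  qed
  finally show ?thesis .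
qed

lemma crossing_crossing_crossing: "crossing i (crossing (Suc i) (crossing i f)) = crossing (Suc i) (crossing i (crossing (Suc i) f))"
  unfolding crossing_def lin_add[OF q.lin_e] lin_scale[OF q.lin_e] q.e_sq q.e_zig q.e_zig'
proof (rule ext)
  fix s
  show "A_pow 1 * (A_pow 1 * (A_pow 1 * f s + A_pow (- 1) * q.e i f s) +
       A_pow (- 1) * (A_pow 1 * q.e (Suc i) f s + A_pow (- 1) * q.e (Suc i) (q.e i f) s)) +
      A_pow (- 1) * (A_pow 1 * (A_pow 1 * q.e i f s + A_pow (- 1) * (loop_value * q.e i f s)) +
       A_pow (- 1) * (A_pow 1 * q.e i (q.e (Suc i) f) s + A_pow (- 1) * q.e i f s)) =
      A_pow 1 * (A_pow 1 * (A_pow 1 * f s + A_pow (- 1) * q.e (Suc i) f s) +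
       A_pow (- 1) * (A_pow 1 * q.e i f s + A_pow (- 1) * q.e i (q.e (Suc i) f) s)) +
      A_pow (- 1) * (A_pow 1 * (A_pow 1 * q.e (Suc i) f s + A_pow (- 1) * (loop_value * q.e (Suc i) f s)) +
       A_pow (- 1) * (A_pow 1 * q.e (Suc i) (q.e i f) s + A_pow (- 1) * q.e (Suc i) f s))"
    unfolding loop_value_def A_pow_eq_power using A_pow_inverse by algebra
qed

lemma crossing_far: "Suc i < j \<Longrightarrow> crossing i (crossing j f) = crossing j (crossing i f)"
  by (simp add: crossing_def lin_add[OF q.lin_e] lin_scale[OF q.lin_e] q.e_far[of i j] fun_eq_iff algebra_simps)

lemma crossing_cup_above: "i \<le> j \<Longrightarrow> crossing (Suc (Suc j)) (q.cup i f) = q.cup i (crossing j f)"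
proof (induction i arbitrary: j f)
  case 0
  show ?case using q.lift2_cup0[OF lin_crossing[of j], of f]
    by (simp add: crossing_Suc[abs_def])
next
  case (Suc i)
  then obtain r where r: "j = Suc r" "i \<le> r" by (cases j) auto
  show ?case unfolding r(1) crossing_Suc[of "Suc (Suc r)"] crossing_Suc[of r]
    by (rule config_ext) (simp add: Suc.IH[OF r(2)])
qed

lemma crossing_cup_below: "Suc j < i \<Longrightarrow> crossing j (q.cup i f) = q.cup i (crossing j f)"
proof (induction j arbitrary: i f)
  case 0
  then obtain r where r: "i = Suc (Suc r)" by (cases i; cases "i - 1") auto
  have E: "q.e 0 (q.cup i f) = q.cup i (q.e 0 f)"
    using q.e0_lift2[OF q.lin_cup[of r], of f] by (simp add: r)
  show ?case by (simp only: crossing_def lin_add[OF q.lin_cup] lin_scale[OF q.lin_cup] E)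
next
  case (Suc j)
  then obtain r where r: "i = Suc r" "Suc j < r" by (cases i) auto
  show ?case unfolding r(1) crossing_Suc q.cup.simps
    by (rule config_ext) (simp add: Suc.IH[OF r(2)])
qed

section \<open>Sliding cups and caps through the torus braid\<close>

text \<open>
  \<open>sweep (p - 1)\<close> is the factor \<open>\<delta>\<close> of the torus braid on \<open>p\<close> strands; it carries one strand across all
  others.
\<close>

fun sweep :: "nat \<Rightarrow> lop" where
  "sweep 0 f = f"
| "sweep (Suc n) f = sweep n (crossing n f)"

lemma lin_sweep: "lin (sweep n)"
proof (induction n)
  case 0 then show ?case by (simp add: lin_def)
next
  case (Suc n)
  have "sweep (Suc n) = (\<lambda>f. sweep n (crossing n f))" by (simp add: fun_eq_iff)
  then show ?case using lin_comp[OF Suc lin_crossing[of n]] by simp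
qed

lemma sweep_Suc': "sweep (Suc n) f = crossing 0 (lift (sweep n) f)"
proof (induction n arbitrary: f)
  case 0
  have L: "lift (sweep 0) f = f" by (rule config_ext) simp
  show ?case by (simp only: sweep.simps(2) sweep.simps(1)[of "crossing 0 f"] L)
next
  case (Suc n)
  have "sweep (Suc (Suc n)) f = sweep (Suc n) (crossing (Suc n) f)" by simp
  also have "\<dots> = crossing 0 (lift (sweep n) (crossing (Suc n) f))" by (rule Suc)
  also have "lift (sweep n) (crossing (Suc n) f) = lift (sweep (Suc n)) f"
    unfolding crossing_Suc by (rule config_ext) simp
  finally show ?case .
qed

lemma sweep_far: "n < j \<Longrightarrow> sweep n (crossing j f) = crossing j (sweep n f)"
proof (induction n arbitrary: f)
  case (Suc n)
  then show ?case using crossing_far[of n j f] by simp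
qed simp

lemma sweep_crossing: "Suc i < n \<Longrightarrow> sweep n (crossing i f) = crossing (Suc i) (sweep n f)"
proof (induction n arbitrary: f)
  case (Suc n)
  show ?case
  proof (cases "Suc i = n")
    case True
    have "sweep (Suc n) (crossing i f) = sweep i (crossing i (crossing (Suc i) (crossing i f)))" by (simp flip: True)
    also have "\<dots> = sweep i (crossing (Suc i) (crossing i (crossing (Suc i) f)))" by (simp only: crossing_crossing_crossing)
    also have "\<dots> = crossing (Suc i) (sweep i (crossing i (crossing (Suc i) f)))" by (simp add: sweep_far)
    finally show ?thesis by (simp flip: True)
  next
    case False
    then have "Suc i < n" using Suc.prems by auto
    then show ?thesis using Suc.IH crossing_far[of i n f, symmetric] by simp
  qed
qed simp

lemma sweep_cup_below: "n < i \<Longrightarrow> sweep n (q.cup i f) = q.cup i (sweep n f)"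
  by (induction n arbitrary: f) (simp_all add: crossing_cup_below)

text \<open>
  Here \<open>j + r + 3\<close> strands are involved: the strand carried along by \<open>\<delta>\<close> passes the cup, which moves by
  one position and leaves the torus braid on two strands fewer.
\<close>

lemma sweep_cup: "sweep (Suc (Suc (j + r))) (q.cup j f) = q.cup (Suc j) (sweep (j + r) f)"
proof (induction r arbitrary: f)
  case 0
  show ?case by (simp only: add_0_right sweep.simps crossing_crossing_cup sweep_cup_below[OF lessI])
next
  case (Suc r)
  have "sweep (Suc (Suc (j + Suc r))) (q.cup j f) = sweep (Suc (Suc (j + r))) (crossing (Suc (Suc (j + r))) (q.cup j f))"
    by simp
  also have "\<dots> = sweep (Suc (Suc (j + r))) (q.cup j (crossing (j + r) f))" by (simp only: crossing_cup_above[OF le_add1])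
  also have "\<dots> = q.cup (Suc j) (sweep (j + Suc r) f)" by (simp only: Suc) simp
  finally show ?case .
qed

text \<open>
  Conjugation by \<open>\<delta>\<close> shifts the generators by one position.
\<close>

lemma sweep_lift_sweep: "m \<le> n \<Longrightarrow> sweep (Suc n) (sweep m f) = lift (sweep m) (sweep (Suc n) f)"
proof (induction m arbitrary: f)
  case 0
  show ?case by (rule config_ext) simp
next
  case (Suc m)
  have "sweep (Suc n) (sweep (Suc m) f) = lift (sweep m) (sweep (Suc n) (crossing m f))" using Suc by simp
  also have "sweep (Suc n) (crossing m f) = crossing (Suc m) (sweep (Suc n) f)" using Suc.prems by (intro sweep_crossing) simp
  also have "lift (sweep m) (crossing (Suc m) (sweep (Suc n) f)) = lift (sweep (Suc m)) (sweep (Suc n) f)"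
    unfolding crossing_Suc by (rule config_ext) simp
  finally show ?case .
qed

lemma lift_sweep_sweep_Suc: "lift (sweep (Suc m)) (sweep (Suc m) f) = lift (sweep m) (sweep m (crossing (Suc m) (crossing m f)))"
proof -
  have "lift (sweep (Suc m)) (sweep (Suc m) f) = lift (sweep m) (crossing (Suc m) (sweep m (crossing m f)))"
    unfolding crossing_Suc by (rule config_ext) simp
  then show ?thesis by (simp add: sweep_far)
qed

text \<open>
  Both legs of a cup at the right end are carried to the left end in parallel; pairs of crossings
  \<open>\<sigma>\<^sub>i\<^sub>+\<^sub>1 \<sigma>\<^sub>i\<close> transport the cup one step each.
\<close>

lemma lift_sweep_sweep_cup: "lift (sweep m) (sweep m (q.cup m f)) = q.cup 0 f"
proof (induction m arbitrary: f)
  case 0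
  show ?case by (rule config_ext) simp
next
  case (Suc m)
  show ?case unfolding lift_sweep_sweep_Suc crossing_crossing_cup' by (rule Suc)
qed

lemma cap_lift_sweep_sweep: "q.cap 0 (lift (sweep m) (sweep m f)) = q.cap m f"
proof (induction m arbitrary: f)
  case 0
  have L: "lift (sweep 0) (sweep 0 f) = f" by (rule config_ext) simp
  show ?case by (simp only: L)
next
  case (Suc m)
  show ?case unfolding lift_sweep_sweep_Suc Suc by (rule cap_crossing_crossing)
qed

text \<open>
  Two factors \<open>\<delta>\<close> bring the cup from the right end back to the left end. Rewriting them as the parallel
  transport of both legs leaves \<open>\<sigma>\<^sup>2\<close> on the cup, that is, two kinks with the factor \<open>- A\<^sup>-\<^sup>3\<close> each.
\<close>

lemma sweep_sweep_cup: "sweep (Suc m) (sweep (Suc m) (q.cup m f)) = (\<lambda>s. A_pow (- 6) * q.cup 0 f s)"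
proof -
  have D: "sweep (Suc m) (q.cup m f) = (\<lambda>s. - A_pow (- 3) * sweep m (q.cup m f) s)"
    by (simp only: sweep.simps crossing_cup lin_scale[OF lin_sweep])
  have "sweep (Suc m) (sweep (Suc m) (q.cup m f)) = (\<lambda>s. - A_pow (- 3) * lift (sweep m) (sweep (Suc m) (q.cup m f)) s)"
    unfolding D lin_scale[OF lin_sweep] by (simp only: sweep_lift_sweep[OF order_refl] D)
  also have "\<dots> = (\<lambda>s. - A_pow (- 3) * (- A_pow (- 3) * q.cup 0 f s))"
    unfolding D by (simp only: lin_scale[OF lin_lift[OF lin_sweep]] lift_sweep_sweep_cup)
  finally show ?thesis by (simp add: A_pow_mult_left)
qed

lemma cap_sweep_sweep: "q.cap 0 (sweep (Suc m) (sweep (Suc m) f)) = (\<lambda>s. A_pow (- 6) * q.cap m f s)"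
proof -
  have "sweep (Suc m) (sweep (Suc m) f) = crossing 0 (lift (sweep m) (sweep (Suc m) f))" by (rule sweep_Suc')
  also have "\<dots> = crossing 0 (sweep (Suc m) (sweep m f))" by (simp only: sweep_lift_sweep[OF order_refl])
  also have "\<dots> = crossing 0 (crossing 0 (lift (sweep m) (sweep m f)))" by (simp only: sweep_Suc')
  finally show ?thesis
    by (simp only: cap_crossing lin_scale[OF q.lin_cap] cap_lift_sweep_sweep) (simp add: A_pow_mult_left)
qed

section \<open>The Kauffman bracket as a weighted trace\<close>

fun letter_op :: "braid_letter \<Rightarrow> lop" where
  "letter_op (Sig i) f = crossing (i - 1) f"
| "letter_op (Sig_inv i) f = (\<lambda>s. A_pow (- 1) * f s + A_pow 1 * q.e (i - 1) f s)"

fun word_op :: "braid_word \<Rightarrow> lop" where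
  "word_op [] f = f"
| "word_op (x # w) f = letter_op x (word_op w f)"

fun letter_index :: "braid_letter \<Rightarrow> nat" where
  "letter_index (Sig i) = i"
| "letter_index (Sig_inv i) = i"

lemma num_circles_pos:
  assumes "p \<ge> 1" shows "num_circles p fs \<ge> 1"
proof -
  let ?X = "{1..p} \<times> {0..length fs}" and ?E = "(closure_arcs p fs \<union> (closure_arcs p fs)\<inverse>)\<^sup>*"
  have "finite (?X // ?E)" by (simp add: quotient_def)
  moreover have "(1, 0) \<in> ?X" using assms by auto
  then have "?X // ?E \<noteq> {}" by (auto simp: quotient_def)
  ultimately show ?thesis unfolding num_circles_def by (simp add: Suc_le_eq card_gt_0_iff)
qed

text \<open>
  The recursion of the bracket is linearity of the trace in each crossing operator. The additional
  factor \<open>loop_value\<close> accounts for the normalisation of a single circle to \<open>1\<close>.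
\<close>

lemma bracket_from_wtrace:
  assumes "p \<ge> 1" "smoothings_ok p fs" "\<forall>x\<in>set w. 1 \<le> letter_index x \<and> letter_index x < p"
  shows "loop_value * bracket_from p fs w = q.wtrace p (\<lambda>f. q.e_word (cap_cup_indices fs) (word_op w f))"
  using assms
proof (induction p fs w rule: bracket_from.induct)
  case (1 p fs)
  have "loop_value * bracket_from p fs [] = loop_value ^ num_circles p fs"
    using power_minus_mult[of "num_circles p fs" loop_value] num_circles_pos[OF 1(1), of fs]
    by (simp add: loop_value_def mult.commute)
  then show ?case using q.wtrace_num_circles[OF 1(2) CHAR_laurent] by simp
next
  case (2 p fs i w)
  have ok: "smoothings_ok p (fs @ [Vertical])" "smoothings_ok p (fs @ [Cap_Cup i])"
    using 2 by (auto simp: smoothings_ok_def)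
  have "loop_value * bracket_from p fs (Sig i # w) = A_pow 1 * (loop_value * bracket_from p (fs @ [Vertical]) w) + A_pow (- 1) * (loop_value * bracket_from p (fs @ [Cap_Cup i]) w)"
    by (simp add: algebra_simps)
  also have "\<dots> = A_pow 1 * q.wtrace p (\<lambda>f. q.e_word (cap_cup_indices fs) (word_op w f)) + A_pow (- 1) * q.wtrace p (\<lambda>f. q.e_word (cap_cup_indices fs) (q.e (i - 1) (word_op w f)))"
    using 2 ok by (simp add: cap_cup_indices_append q.e_word_append)
  also have "\<dots> = q.wtrace p (\<lambda>f. q.e_word (cap_cup_indices fs) (word_op (Sig i # w) f))"
    by (simp add: crossing_def lin_add[OF q.lin_e_word] lin_scale[OF q.lin_e_word] q.wtrace_plus q.wtrace_scale)
  finally show ?case .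
next
  case (3 p fs i w)
  have ok: "smoothings_ok p (fs @ [Vertical])" "smoothings_ok p (fs @ [Cap_Cup i])"
    using 3 by (auto simp: smoothings_ok_def)
  have "loop_value * bracket_from p fs (Sig_inv i # w) = A_pow (- 1) * (loop_value * bracket_from p (fs @ [Vertical]) w) + A_pow 1 * (loop_value * bracket_from p (fs @ [Cap_Cup i]) w)"
    by (simp add: algebra_simps)
  also have "\<dots> = A_pow (- 1) * q.wtrace p (\<lambda>f. q.e_word (cap_cup_indices fs) (word_op w f)) + A_pow 1 * q.wtrace p (\<lambda>f. q.e_word (cap_cup_indices fs) (q.e (i - 1) (word_op w f)))"
    using 3 ok by (simp add: cap_cup_indices_append q.e_word_append)
  also have "\<dots> = q.wtrace p (\<lambda>f. q.e_word (cap_cup_indices fs) (word_op (Sig_inv i # w) f))"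
    by (simp add: lin_add[OF q.lin_e_word] lin_scale[OF q.lin_e_word] q.wtrace_plus q.wtrace_scale)
  finally show ?case .
qed

declare sweep.simps [simp del]

section \<open>Smoothing one twist of a torus braid\<close>

lemma strand_op_crossing: assumes "Suc i < p" shows "q.strand_op p p (crossing i)"
proof -
  have "crossing i = (\<lambda>f s. A_pow 1 * f s + A_pow (- 1) * q.e i f s)" by (simp add: fun_eq_iff crossing_def)
  then show ?thesis
    using q.strand_op_plus[OF q.strand_op_scale[OF q.strand_op_id] q.strand_op_scale[OF q.strand_op_e[OF assms]]] by simp
qed

lemma strand_op_sweep: "n < p \<Longrightarrow> q.strand_op p p (sweep n)"
proof (induction n)
  case 0
  have "sweep 0 = (\<lambda>f. f)" by (simp add: fun_eq_iff sweep.simps)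
  then show ?case using q.strand_op_id by simp
next
  case (Suc n)
  have "sweep (Suc n) = (\<lambda>f. sweep n (crossing n f))" by (simp add: fun_eq_iff sweep.simps)
  then show ?case using Suc strand_op_crossing[of n p] q.strand_op_comp[of p p "sweep n" p "crossing n"] by simp
qed

lemma (in loop_model) strand_op_funpow: "strand_op p p X \<Longrightarrow> strand_op p p (X ^^ N)"
proof (induction N)
  case 0
  then show ?case using strand_op_id by (simp add: id_def)
next
  case (Suc N)
  have "X ^^ Suc N = (\<lambda>f. X ((X ^^ N) f))" by (simp add: fun_eq_iff)
  then show ?case using Suc strand_op_comp[OF Suc.prems, of p "X ^^ N"] by simp
qed

text \<open>
  On \<open>r + 2\<close> strands \<open>Q\<close> factors \<open>\<delta>\<close> move the cup from \<open>j\<close> to \<open>d = (j + Q) mod (r + 2)\<close>, going round \<open>w\<close>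
  times. Each round costs two factors \<open>\<delta>\<close> of the remaining torus braid. A cup joining the two outermost
  strands would be at position \<open>d = r + 1\<close>; there the second alternative keeps one factor \<open>\<delta>\<close> unresolved.
\<close>

lemma slide:
  assumes "j \<le> r" "j + Q = w * (r + 2) + d" "d \<le> r + 1"
  shows "(d \<le> r \<longrightarrow> 2 * w \<le> Q \<and>
      (sweep (Suc r) ^^ Q) (q.cup j f) = (\<lambda>s. A_pow (- 6 * int w) * q.cup d ((sweep (r - 1) ^^ (Q - 2 * w)) f) s))
    \<and> (d = r + 1 \<longrightarrow> 2 * w + 1 \<le> Q \<and>
      (sweep (Suc r) ^^ Q) (q.cup j f) = (\<lambda>s. A_pow (- 6 * int w) * sweep (Suc r) (q.cup r ((sweep (r - 1) ^^ (Q - 1 - 2 * w)) f)) s))"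
  using assms(2,3)
proof (induction Q arbitrary: w d)
  case 0
  then have "w = 0" using assms(1) by (cases w) auto
  then show ?case using 0 assms(1) by (simp add: A_pow_0)
next
  case (Suc Q)
  show ?case
  proof (cases d)
    case (Suc d')
    then have IH: "2 * w \<le> Q"
      "(sweep (Suc r) ^^ Q) (q.cup j f) = (\<lambda>s. A_pow (- 6 * int w) * q.cup d' ((sweep (r - 1) ^^ (Q - 2 * w)) f) s)"
      using Suc.IH[of w d'] Suc.prems by auto
    then have step: "(sweep (Suc r) ^^ Suc Q) (q.cup j f)
        = (\<lambda>s. A_pow (- 6 * int w) * sweep (Suc r) (q.cup d' ((sweep (r - 1) ^^ (Q - 2 * w)) f)) s)"
      by (simp only: funpow.simps o_apply lin_scale[OF lin_sweep])
    show ?thesis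
    proof (cases "d' = r")
      case True
      then show ?thesis using step IH(1) Suc by auto
    next
      case False
      then obtain t where t: "r = Suc (d' + t)" using Suc.prems Suc by (metis Suc_eq_plus1 Suc_le_mono le_neq_implies_less less_imp_Suc_add)
      have "sweep (Suc r) (q.cup d' g) = q.cup d (sweep (r - 1) g)" for g
        using sweep_cup[of d' t g] t Suc by simp
      moreover have "sweep (r - 1) ((sweep (r - 1) ^^ (Q - 2 * w)) f) = (sweep (r - 1) ^^ (Suc Q - 2 * w)) f"
        using IH(1) by (simp add: Suc_diff_le)
      ultimately show ?thesis using step IH(1) False Suc by auto
    qed
  next
    case 0
    obtain v where v: "w = Suc v" using Suc.prems 0 assms(1) by (cases w) auto
    then have "j + Q = v * (r + 2) + (r + 1)" using Suc.prems 0 by simp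
    then have IH: "2 * v + 1 \<le> Q"
      "(sweep (Suc r) ^^ Q) (q.cup j f) = (\<lambda>s. A_pow (- 6 * int v) * sweep (Suc r) (q.cup r ((sweep (r - 1) ^^ (Q - 1 - 2 * v)) f)) s)"
      using Suc.IH[of v "r + 1"] by auto
    then have "(sweep (Suc r) ^^ Suc Q) (q.cup j f)
        = (\<lambda>s. A_pow (- 6 * int v) * (A_pow (- 6) * q.cup 0 ((sweep (r - 1) ^^ (Q - 1 - 2 * v)) f) s))"
      by (simp only: funpow.simps o_apply lin_scale[OF lin_sweep] sweep_sweep_cup)
    also have "\<dots> = (\<lambda>s. A_pow (- 6 * int w) * q.cup 0 ((sweep (r - 1) ^^ (Suc Q - 2 * w)) f) s)"
    proof -
      have e: "- 6 * int w = - 6 * int v + - 6" "Suc Q - 2 * w = Q - 1 - 2 * v" using v by auto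
      show ?thesis unfolding e A_pow_mult_left ..
    qed
    finally show ?thesis using IH(1) v 0 by simp
  qed
qed

text \<open>
  The closure of \<open>\<delta>\<^sup>Q\<close> on \<open>r + 2\<close> strands with a cup at \<open>j\<close> on one side and a cap at \<open>0\<close> on the other.
\<close>

definition cup_trace :: "nat \<Rightarrow> nat \<Rightarrow> nat \<Rightarrow> A_laurent" where
  "cup_trace r Q j = q.wtrace r (\<lambda>f. q.cap 0 ((sweep (Suc r) ^^ Q) (q.cup j f)))"

text \<open>
  Once the cup is away from the cap, the two are moved past each other and the cyclicity of the trace
  turns the cup-cap pair around, now on \<open>r\<close> strands.
\<close>

lemma cup_trace_step:
  assumes "j \<le> r" "j + Q = w * (r + 2) + d" "2 \<le> d" "d \<le> r"
  shows "2 * w \<le> Q" "cup_trace r Q j = A_pow (- 6 * int w) * cup_trace (r - 2) (Q - 2 * w) (d - 2)"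
proof -
  have S: "2 * w \<le> Q" "(sweep (Suc r) ^^ Q) (q.cup j f) = (\<lambda>s. A_pow (- 6 * int w) * q.cup d ((sweep (r - 1) ^^ (Q - 2 * w)) f) s)" for f
    using slide[OF assms(1,2), of f] assms(4) by auto
  show "2 * w \<le> Q" by (rule S)
  obtain t where t: "r = Suc (Suc t)" using assms by (cases r; cases "r - 1") auto
  obtain c where c: "d = Suc (Suc c)" using assms by (cases d; cases "d - 1") auto
  let ?X = "sweep (Suc t) ^^ (Q - 2 * w)"
  have "cup_trace r Q j = q.wtrace r (\<lambda>f s. A_pow (- 6 * int w) * q.cap 0 (q.cup d (?X f)) s)"
    unfolding cup_trace_def S lin_scale[OF q.lin_cap] by (simp add: t)
  also have "\<dots> = A_pow (- 6 * int w) * q.wtrace r (\<lambda>f. q.cup c (q.cap 0 (?X f)))"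
    unfolding q.wtrace_scale c q.cap0_cup_far ..
  also have "q.wtrace r (\<lambda>f. q.cup c (q.cap 0 (?X f))) = q.wtrace t (\<lambda>f. q.cap 0 (?X (q.cup c f)))"
  proof (rule q.wtrace_comm)
    show "q.strand_op r t (q.cup c)" unfolding t by (rule q.strand_op_cup) (use assms t c in simp)
    show "q.strand_op t r (\<lambda>f. q.cap 0 (?X f))"
      using q.strand_op_comp[of t r "q.cap 0" r ?X] q.strand_op_cap[of 0 t] q.strand_op_funpow[OF strand_op_sweep[of "Suc t" r]] t by simp
  qed
  also have "\<dots> = cup_trace (r - 2) (Q - 2 * w) (d - 2)"
    by (simp add: cup_trace_def t c)
  finally show "cup_trace r Q j = A_pow (- 6 * int w) * cup_trace (r - 2) (Q - 2 * w) (d - 2)" .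
qed

lemma cup_trace_end_1:
  assumes "j \<le> r" "j + Q = w * (r + 2) + 1" "r \<ge> 1"
  shows "cup_trace r Q j = A_pow (- 6 * int w) * q.wtrace r (sweep (r - 1) ^^ (Q - 2 * w))"
proof -
  have S: "(sweep (Suc r) ^^ Q) (q.cup j f) = (\<lambda>s. A_pow (- 6 * int w) * q.cup (Suc 0) ((sweep (r - 1) ^^ (Q - 2 * w)) f) s)" for f
    using slide[OF assms(1,2), of f] assms(3) by auto
  show ?thesis
    unfolding cup_trace_def S lin_scale[OF q.lin_cap] q.cap_cup_Suc q.wtrace_scale ..
qed

text \<open>
  The situation at the last position: the cup and the cap are adjacent across the closure, so the
  framing factor appears together with the inverse of one factor \<open>\<delta>\<close>, cancelled here by
  \<open>sweep (r - 1)\<close>.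
\<close>

lemma cap_sweep_cup_sweep:
  assumes "r \<ge> 1" shows "q.cap 0 (sweep (Suc r) (q.cup r (sweep (r - 1) f))) = (\<lambda>s. A_pow (- 6) * f s)"
proof -
  obtain t where t: "r = Suc t" using assms by (cases r) auto
  have "q.cup r (sweep (r - 1) f) = sweep (Suc r) (q.cup t f)" using sweep_cup[of t 0 f] t by simp
  then show ?thesis by (simp only: cap_sweep_sweep t q.cap_Suc_cup)
qed

lemma cup_trace_end_2:
  assumes "j \<le> r" "j + Q = w * (r + 2) + (r + 1)" "r \<ge> 1" "2 * (w + 1) \<le> Q"
  shows "cup_trace r Q j = A_pow (- 6 * int (w + 1)) * q.wtrace r (sweep (r - 1) ^^ (Q - 2 * (w + 1)))"
proof -
  have S: "(sweep (Suc r) ^^ Q) (q.cup j f) = (\<lambda>s. A_pow (- 6 * int w) * sweep (Suc r) (q.cup r ((sweep (r - 1) ^^ (Q - 1 - 2 * w)) f)) s)" for f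
    using slide[OF assms(1,2), of f] by auto
  have "Q - 1 - 2 * w = Suc (Q - 2 * (w + 1))" using assms(4) by simp
  moreover have e: "- 6 * int (w + 1) = - 6 * int w + - 6" by simp
  ultimately have R: "(sweep (r - 1) ^^ (Q - 1 - 2 * w)) f = sweep (r - 1) ((sweep (r - 1) ^^ (Q - 2 * (w + 1))) f)" for f
    by simp
  show ?thesis
    unfolding cup_trace_def S lin_scale[OF q.lin_cap] q.wtrace_scale R cap_sweep_cup_sweep[OF assms(3)]
    unfolding q.wtrace_scale A_pow_mult_left e ..
qed

text \<open>
  The values \<open>M t\<close> and their successors are pairwise different elements of the interval from \<open>a\<close> to \<open>b\<close>.
\<close>

lemma card_spaced:
  fixes M :: "nat \<Rightarrow> nat"
  assumes "finite X" "\<And>t u. t \<in> X \<Longrightarrow> u \<in> X \<Longrightarrow> t \<noteq> u \<Longrightarrow> M t + 2 \<le> M u \<or> M u + 2 \<le> M t"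
    and "\<And>t. t \<in> X \<Longrightarrow> a \<le> M t \<and> M t + 2 \<le> b" and "a \<le> b"
  shows "a + 2 * card X \<le> b"
proof -
  have inj: "inj_on M X" "inj_on (\<lambda>t. Suc (M t)) X" using assms(2) by (fastforce intro: inj_onI)+
  have "M ` X \<inter> (\<lambda>t. Suc (M t)) ` X = {}"
  proof (rule ccontr)
    assume "\<not> ?thesis"
    then obtain t u where "t \<in> X" "u \<in> X" "M t = Suc (M u)" by auto
    then show False using assms(2)[of t u] by (cases "t = u") auto
  qed
  then have "card (M ` X \<union> (\<lambda>t. Suc (M t)) ` X) = 2 * card X"
    using assms(1) inj by (simp add: card_Un_disjoint card_image)
  moreover have "card (M ` X \<union> (\<lambda>t. Suc (M t)) ` X) \<le> card {a..<b}"
    by (rule card_mono) (use assms(3) in fastforce)+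
  ultimately show ?thesis using assms(4) by simp
qed

lemma close_residues:
  fixes a b c p :: nat
  assumes "c = a \<or> c = a + 1 \<or> a = c + 1" "c = (a + b) mod p" "a < p" "b < p"
  shows "b \<in> {0, 1, p - 1}"
proof (cases "a + b < p")
  case True
  then have "c = a + b" using assms(2) by simp
  then show ?thesis using assms(1) by auto
next
  case False
  then have "(a + b) mod p = (a + b - p) mod p" by (simp add: le_mod_geq)
  moreover have "a + b - p < p" using assms(3,4) by linarith
  ultimately have "c = a + b - p" using assms(2) by simp
  then have "b = p - 1 \<or> b = p - 0" using assms(1,4) False by linarith
  then show ?thesis using assms(4) by simp
qed

text \<open>
  The multiples of \<open>q\<close> before the \<open>k\<close>-th keep away from \<open>0\<close>, \<open>1\<close> and \<open>-1\<close> modulo \<open>p\<close>, and hence keep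
  distance two from each other.
\<close>

locale multiples =
  fixes p q k :: nat
  assumes p_pos: "p \<ge> 3" and k_pos: "k \<ge> 1" and k_small: "2 * k < p"
    and before_k: "\<And>t. 1 \<le> t \<Longrightarrow> t < k \<Longrightarrow> q * t mod p \<notin> {0, 1, p - 1}"
begin

abbreviation M where "M t \<equiv> q * t mod p"
abbreviation L where "L t \<equiv> q * t div p"

text \<open>
  After \<open>i\<close> steps \<open>i\<close> pairs of strands have disappeared, at the positions \<open>M t\<close> with \<open>t < i\<close>. The number
  of pairs below position \<open>M i\<close> converts positions on \<open>p\<close> strands into positions on the remaining strands.
\<close>

definition C :: "nat \<Rightarrow> nat" where
  "C i = card {t. t < i \<and> M t \<le> M i}"

text \<open>
  Since \<open>q i = q t + q (i - t)\<close>, the quotients by \<open>p\<close> are additive up to a carry of \<open>0\<close> or \<open>1\<close>, and there is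
  a carry exactly when \<open>M i < M t\<close>.
\<close>

lemma below_iff:
  assumes "t \<le> i" shows "(if M t \<le> M i then 1 else 0) = 1 - int (L i) + int (L t) + int (L (i - t))"
proof -
  have "q * i = q * t + q * (i - t)" using assms by (simp flip: add_mult_distrib2)
  then have "L i * p + M i = (L t * p + M t) + (L (i - t) * p + M (i - t))" by (metis div_mult_mod_eq)
  then have eq: "int (M i) = int (M t) + int (M (i - t)) - int p * (int (L i) - int (L t) - int (L (i - t)))"
    by (simp add: algebra_simps flip: of_nat_add of_nat_mult)
  define z where "z = int (L i) - int (L t) - int (L (i - t))"
  have M: "M t < p" "M (i - t) < p" "M i < p" using p_pos by auto
  \<comment> \<open>\<open>z\<close> is the carry\<close>
  have "int p * z < int p * 2" "int p * (-1) < int p * z" using eq M unfolding z_def[symmetric] by linarith+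
  moreover have "0 < int p" using p_pos by simp
  ultimately have "z < 2" "-1 < z" by (simp_all only: mult_less_cancel_left_pos)
  then have "z = 0 \<or> z = 1" by linarith
  then show ?thesis
  proof
    assume "z = 0"
    then have "M t \<le> M i" using eq unfolding z_def[symmetric] by simp
    then show ?thesis using \<open>z = 0\<close> z_def by simp
  next
    assume "z = 1"
    then have "\<not> M t \<le> M i" using eq M unfolding z_def[symmetric] by (simp only: mult_1_right)
    then show ?thesis using \<open>z = 1\<close> z_def by simp
  qed
qed

lemma C_formula: "int (C i) = int i - int i * int (L i) + 2 * (\<Sum>t<i. int (L t)) + int (L i)"
proof -
  have "int (C i) = (\<Sum>t<i. if M t \<le> M i then 1 else 0)"
    unfolding C_def by (simp add: sum.If_cases Int_def conj_commute)
  also have "\<dots> = (\<Sum>t<i. 1 - int (L i) + int (L t) + int (L (i - t)))"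
    by (intro sum.cong refl below_iff) auto
  also have "\<dots> = int i * (1 - int (L i)) + (\<Sum>t<i. int (L t)) + (\<Sum>t<i. int (L (i - t)))"
    by (simp add: sum.distrib)
  also have "(\<Sum>t<i. int (L (i - t))) = (\<Sum>t<i. int (L (Suc t)))"
    by (rule sum.reindex_bij_witness[of _ "\<lambda>t. i - Suc t" "\<lambda>t. i - Suc t"]) (auto simp: Suc_diff_Suc)
  also have "\<dots> = (\<Sum>t<Suc i. int (L t)) - int (L 0)"
    by (subst sum.lessThan_Suc_shift) simp
  finally show ?thesis by (simp add: algebra_simps)
qed

text \<open>
  The closed form of \<open>C\<close> shows that the count changes by an amount that depends only on the quotients
  \<open>L\<close>. This is what makes the bookkeeping of \<open>reduction_invariant\<close> close up.
\<close>

lemma C_Suc: "int (C (Suc i)) = int (C i) + int (L i) + 1 - int i * (int (L (Suc i)) - int (L i))"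
  unfolding C_formula by (simp add: algebra_simps)

text \<open>
  Division with remainder on \<open>p - 2 i\<close> strands, derived from division by \<open>p\<close>.
\<close>

lemma step_equation:
  assumes "2 * C i \<le> M i" "2 * L i \<le> q" "2 * i \<le> p" "2 * C (Suc i) \<le> M (Suc i) + 2"
  shows "(M i - 2 * C i) + (q - 2 * L i) = (L (Suc i) - L i) * (p - 2 * i) + (M (Suc i) + 2 - 2 * C (Suc i))"
proof -
  have "L i \<le> L (Suc i)" by (simp add: div_le_mono)
  moreover have "int q * int i = int p * int (L i) + int (M i)"
    "int q * int (Suc i) = int p * int (L (Suc i)) + int (M (Suc i))"
    by (metis mult_div_mod_eq of_nat_add of_nat_mult)+
  moreover have "int (M i - 2 * C i) = int (M i) - 2 * int (C i)" "int (q - 2 * L i) = int q - 2 * int (L i)"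
    "int (M (Suc i) + 2 - 2 * C (Suc i)) = int (M (Suc i)) + 2 - 2 * int (C (Suc i))"
    using assms by linarith+
  moreover have "int ((L (Suc i) - L i) * (p - 2 * i)) = (int (L (Suc i)) - int (L i)) * (int p - 2 * int i)"
    using calculation(1) assms(3) by (simp add: of_nat_diff)
  ultimately have "int ((M i - 2 * C i) + (q - 2 * L i)) = int ((L (Suc i) - L i) * (p - 2 * i) + (M (Suc i) + 2 - 2 * C (Suc i)))"
    using C_Suc[of i] of_nat_Suc[of i, where 'a = int] unfolding of_nat_add by algebra
  then show ?thesis by (rule of_nat_eq_iff[THEN iffD1])
qed

lemma M_spaced:
  assumes "t < u" "u < k" shows "M t + 2 \<le> M u \<or> M u + 2 \<le> M t"
proof (rule ccontr)
  assume "\<not> ?thesis"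
  then have "M u = M t \<or> M u = M t + 1 \<or> M t = M u + 1" by linarith
  moreover have "M u = (M t + M (u - t)) mod p"
    using assms(1) by (simp add: mod_add_eq flip: add_mult_distrib2)
  moreover have "M t < p" "M (u - t) < p" using p_pos by auto
  ultimately have close: "M (u - t) \<in> {0, 1, p - 1}"
    by (rule close_residues)
  have "1 \<le> u - t" "u - t < k" using assms by linarith+
  from before_k[OF this] close show False by contradiction
qed

lemma M_less: "t < k \<Longrightarrow> M t + 2 \<le> p"
proof -
  assume t: "t < k"
  have "M t < p" using p_pos by auto
  moreover have "M t \<noteq> p - 1" using before_k[of t] t p_pos by (cases "t = 0") auto
  ultimately show "M t + 2 \<le> p" by linarith
qed

lemma C_lower: assumes "i < k" shows "2 * C i \<le> M i"
proof -
  have "0 + 2 * card {t. t < i \<and> M t \<le> M i} \<le> M i"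
  proof (rule card_spaced[where M = M])
    fix t u assume "t \<in> {t. t < i \<and> M t \<le> M i}" "u \<in> {t. t < i \<and> M t \<le> M i}" "t \<noteq> u"
    then show "M t + 2 \<le> M u \<or> M u + 2 \<le> M t" using M_spaced[of t u] M_spaced[of u t] assms
      by (cases "t < u") auto
  next
    fix t assume "t \<in> {t. t < i \<and> M t \<le> M i}"
    then show "0 \<le> M t \<and> M t + 2 \<le> M i" using M_spaced[of t i] assms by auto
  qed auto
  then show ?thesis by (simp add: C_def)
qed

lemma C_upper: assumes "i < k" shows "M i + 2 * (i - C i) + 2 \<le> p" and "C i \<le> i"
proof -
  let ?X = "{t. t < i \<and> M i < M t}"
  have "{..<i} = {t. t < i \<and> M t \<le> M i} \<union> ?X" by auto
  then have "i = card ({t. t < i \<and> M t \<le> M i} \<union> ?X)" by (metis card_lessThan)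
  also have "\<dots> = C i + card ?X" unfolding C_def by (rule card_Un_disjoint) auto
  finally have i: "i = C i + card ?X" .
  then show "C i \<le> i" by simp
  have "M i + 2 * card (insert i ?X) \<le> p"
  proof (rule card_spaced[where M = M])
    fix t u assume "t \<in> insert i ?X" "u \<in> insert i ?X" "t \<noteq> u"
    then show "M t + 2 \<le> M u \<or> M u + 2 \<le> M t" using M_spaced[of t u] M_spaced[of u t] assms
      by (cases "t < u") auto
  next
    fix t assume "t \<in> insert i ?X"
    then show "M i \<le> M t \<and> M t + 2 \<le> p" using M_less[of t] assms by auto
  qed (use p_pos in \<open>auto intro: less_imp_le\<close>)
  then show "M i + 2 * (i - C i) + 2 \<le> p" using i by simp
qed

text \<open>
  After \<open>i\<close> steps there are \<open>p - 2 i\<close> strands, \<open>q - 2 L i\<close> factors \<open>\<delta>\<close> and the cup is at \<open>M i - 2 C i\<close>. The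
  spacing of the multiples guarantees that before step \<open>k\<close> the cup is never next to the cap.
\<close>

lemma reduction_invariant:
  assumes "i < k"
  shows "2 * L i \<le> q \<and> cup_trace (p - 2) q 0 = A_pow (- 6 * int (L i)) * cup_trace (p - 2 * i - 2) (q - 2 * L i) (M i - 2 * C i)"
  using assms
proof (induction i)
  case 0
  then show ?case by (simp add: A_pow_0)
next
  case (Suc i)
  then have i: "i < k" by simp
  let ?r = "p - 2 * i - 2" and ?w = "L (Suc i) - L i" and ?d = "M (Suc i) + 2 - 2 * C (Suc i)"
  have IH: "2 * L i \<le> q" "cup_trace (p - 2) q 0 = A_pow (- 6 * int (L i)) * cup_trace ?r (q - 2 * L i) (M i - 2 * C i)"
    using Suc.IH[OF i] by auto
  have r2: "?r + 2 = p - 2 * i" using k_small Suc.prems by simp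
  have LL: "L i \<le> L (Suc i)" by (simp add: div_le_mono)
  have eq: "(M i - 2 * C i) + (q - 2 * L i) = ?w * (?r + 2) + ?d"
    unfolding r2 by (rule step_equation) (use IH C_lower[OF i] C_lower[OF Suc.prems] k_small i in auto)
  have bounds: "M i - 2 * C i \<le> ?r" "2 \<le> ?d" "?d \<le> ?r"
    using C_lower[OF i] C_lower[OF Suc.prems] C_upper[OF i] C_upper[OF Suc.prems] by linarith+
  note S = cup_trace_step[OF bounds(1) eq bounds(2,3)]
  have "2 * L (Suc i) \<le> q" using S(1) IH(1) LL by linarith
  moreover have "q - 2 * L i - 2 * ?w = q - 2 * L (Suc i)" "?r - 2 = p - 2 * Suc i - 2" "?d - 2 = M (Suc i) - 2 * C (Suc i)"
    using LL by auto
  moreover have "int (L i) + int ?w = int (L (Suc i))" using LL by simp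
  ultimately show ?case
    unfolding IH(2) S(2) A_pow_mult_left by (simp add: algebra_simps)
qed

text \<open>
  At step \<open>k\<close> the multiple is \<open>1\<close> or \<open>-1\<close>, so the cup arrives next to the cap from one side or the other.
  In the second case it is still in transit, and completing the round accounts for the additional
  \<open>1\<close> in \<open>l\<close>.
\<close>

lemma wtrace_twist_smoothing:
  assumes "(M k = 1 \<and> l = L k) \<or> (M k = p - 1 \<and> l = L k + 1)" "2 * l \<le> q"
  shows "q.wtrace p (\<lambda>f. (sweep (p - 1) ^^ q) (q.e 0 f)) = A_pow (- 6 * int l) * q.wtrace (p - 2 * k) (sweep (p - 2 * k - 1) ^^ (q - 2 * l))"
proof -
  obtain i where i: "k = Suc i" using k_pos by (cases k) auto
  have ik: "i < k" using i by simp
  let ?r = "p - 2 * i - 2" and ?w = "L (Suc i) - L i"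
  have r: "?r = p - 2 * k" "?r \<ge> 1" "?r + 2 = p - 2 * i" using k_small i by auto
  have LL: "L i \<le> L (Suc i)" by (simp add: div_le_mono)
  obtain p' where p': "p = Suc (Suc p')" "Suc p' = p - 1" "p' = p - 2"
    using p_pos by (cases p; cases "p - 1") auto
  have "q.wtrace p (\<lambda>f. (sweep (p - 1) ^^ q) (q.e 0 f)) = q.wtrace p (\<lambda>f. (sweep (p - 1) ^^ q) (q.cup 0 (q.cap 0 f)))"
    by (simp only: q.e_def)
  also have "\<dots> = q.wtrace p' (\<lambda>f. q.cap 0 ((sweep (p - 1) ^^ q) (q.cup 0 f)))"
  proof (rule q.wtrace_comm[where X = "\<lambda>f. (sweep (p - 1) ^^ q) (q.cup 0 f)"])
    have "q.strand_op p p' (q.cup 0)" unfolding p'(1) by (rule q.strand_op_cup) simp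
    then show "q.strand_op p p' (\<lambda>f. (sweep (p - 1) ^^ q) (q.cup 0 f))"
      by (rule q.strand_op_comp[rotated]) (use p_pos in \<open>auto intro!: q.strand_op_funpow strand_op_sweep\<close>)
    show "q.strand_op p' p (q.cap 0)" unfolding p'(1) by (rule q.strand_op_cap) simp
  qed
  also have "\<dots> = cup_trace (p - 2) q 0" unfolding cup_trace_def p'(2) p'(3)[symmetric] ..
  also have "\<dots> = A_pow (- 6 * int (L i)) * cup_trace ?r (q - 2 * L i) (M i - 2 * C i)"
    using reduction_invariant[OF ik] by simp
  also have "cup_trace ?r (q - 2 * L i) (M i - 2 * C i)
      = A_pow (- 6 * (int l - int (L i))) * q.wtrace ?r (sweep (?r - 1) ^^ (q - 2 * l))"
    using assms(1)
  proof (elim disjE conjE)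
    assume Mk: "M k = 1" and l: "l = L k"
    have "{t. t < k \<and> M t \<le> M k} = {0}"
    proof -
      have "t = 0" if "t < k" "M t \<le> 1" for t
      proof (rule ccontr)
        assume "t \<noteq> 0"
        then have "M t \<notin> {0, 1}" using before_k[of t] that(1) by auto
        then show False using that(2) by auto
      qed
      then show ?thesis unfolding Mk using k_pos by auto
    qed
    then have Ck: "C k = 1" unfolding C_def by simp
    have "(M i - 2 * C i) + (q - 2 * L i) = ?w * (?r + 2) + 1"
      unfolding r(3) using step_equation[of i] reduction_invariant[OF ik] C_lower[OF ik] Ck Mk k_small i by simp
    from cup_trace_end_1[OF _ this r(2)] have "cup_trace ?r (q - 2 * L i) (M i - 2 * C i)
        = A_pow (- 6 * int ?w) * q.wtrace ?r (sweep (?r - 1) ^^ (q - 2 * L i - 2 * ?w))"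
      using C_upper[OF ik] C_lower[OF ik] by simp
    moreover have "q - 2 * L i - 2 * ?w = q - 2 * l" "int ?w = int l - int (L i)" using LL l i by auto
    ultimately show ?thesis by simp
  next
    assume Mk: "M k = p - 1" and l: "l = L k + 1"
    have "M t \<le> M k" for t
    proof -
      have "M t < p" using p_pos by auto
      then show ?thesis unfolding Mk by simp
    qed
    then have Ck: "C k = k" unfolding C_def by simp
    have "M k + 2 - 2 * C k = ?r + 1" unfolding Ck Mk using i k_small by simp
    moreover have "2 * C k \<le> M k + 2" unfolding Ck Mk using k_small by simp
    ultimately have eq: "(M i - 2 * C i) + (q - 2 * L i) = ?w * (?r + 2) + (?r + 1)"
      unfolding r(3) using step_equation[of i] reduction_invariant[OF ik] C_lower[OF ik] k_small i by simp
    have ww: "q - 2 * L i - 2 * (?w + 1) = q - 2 * l" "int (?w + 1) = int l - int (L i)" "2 * (?w + 1) \<le> q - 2 * L i"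
      using LL l i assms(2) by auto
    from cup_trace_end_2[OF _ eq r(2) ww(3)] show ?thesis
      unfolding ww using C_upper[OF ik] C_lower[OF ik] by simp
  qed
  finally show ?thesis unfolding A_pow_mult_left r(1) by simp
qed

end

section \<open>Weights and quantum sl2\<close>

lemma A_pow_eq_iff [simp]: "A_pow a = A_pow b \<longleftrightarrow> a = b"
  unfolding A_pow_def by (metis lookup_single_eq lookup_single_not_eq zero_neq_one)

definition wt :: "nat \<Rightarrow> config \<Rightarrow> int" where
  "wt p s = (\<Sum>i<p. if s i then - 1 else 1)"

lemma wt_0 [simp]: "wt 0 s = 0"
  and wt_Suc [simp]: "wt (Suc p) (x ## s) = (if x then - 1 else 1) + wt p s"
  unfolding wt_def by (simp_all add: sum.lessThan_Suc_shift del: sum.lessThan_Suc)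

definition wspace :: "nat \<Rightarrow> int \<Rightarrow> config set" where
  "wspace p n = {s \<in> configs p. wt p s = n}"

lemma scons_in_wspace [simp]: "x ## s \<in> wspace (Suc p) n \<longleftrightarrow> s \<in> wspace p (if x then n + 1 else n - 1)"
  by (auto simp: wspace_def)

lemma finite_wspace: "finite (wspace p n)"
  unfolding wspace_def using finite_configs by simp

lemma abs_wt_le: "\<bar>wt p s\<bar> \<le> int p"
  unfolding wt_def by (rule order_trans[OF sum_abs]) (auto intro: order_trans[OF sum_mono[of _ _ "\<lambda>_. 1"]])

lemma wspace_empty: "int p < \<bar>n\<bar> \<Longrightarrow> wspace p n = {}"
proof (rule ccontr)
  assume "int p < \<bar>n\<bar>" "wspace p n \<noteq> {}"
  then obtain s where "wt p s = n" by (auto simp: wspace_def)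
  then show False using abs_wt_le[of p s] \<open>int p < \<bar>n\<bar>\<close> by simp
qed

text \<open>
  \<open>X f\<close> in weight \<open>n\<close> depends only on \<open>f\<close> in weight \<open>n + r\<close>; as an operator on functions, \<open>X\<close> lowers
  weights by \<open>r\<close>.
\<close>

definition graded :: "int \<Rightarrow> nat \<Rightarrow> nat \<Rightarrow> lop \<Rightarrow> bool" where
  "graded r p q X \<longleftrightarrow> (\<forall>n. depends (wspace p n) (wspace q (n + r)) X)"

lemma gradedD: "graded r p q X \<Longrightarrow> (\<And>t. t \<in> wspace q (n + r) \<Longrightarrow> f t = g t) \<Longrightarrow> s \<in> wspace p n \<Longrightarrow> X f s = X g s"
  unfolding graded_def using dependsD by blast

lemma graded_depends: "graded 0 p q X \<Longrightarrow> depends (wspace p n) (wspace q n) X"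
  unfolding graded_def using add_0_right by metis

lemma graded_id: "graded 0 p p (\<lambda>f. f)"
  by (simp add: graded_def depends_id)

lemma graded_comp: "graded r p q X \<Longrightarrow> graded r' q q' Y \<Longrightarrow> graded (r + r') p q' (\<lambda>f. X (Y f))"
  unfolding graded_def
proof
  fix n assume "\<forall>n. depends (wspace p n) (wspace q (n + r)) X" "\<forall>n. depends (wspace q n) (wspace q' (n + r')) Y"
  then have "depends (wspace p n) (wspace q (n + r)) X" "depends (wspace q (n + r)) (wspace q' (n + r + r')) Y" by blast+
  then show "depends (wspace p n) (wspace q' (n + (r + r'))) (\<lambda>f. X (Y f))"
    unfolding add.assoc by (rule depends_comp)
qed

lemma graded_comp0: "graded 0 p q X \<Longrightarrow> graded 0 q q' Y \<Longrightarrow> graded 0 p q' (\<lambda>f. X (Y f))"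
  using graded_comp[of 0 p q X 0 q' Y] by simp

lemma graded_plus: "graded r p q X \<Longrightarrow> graded r p q Y \<Longrightarrow> graded r p q (\<lambda>f s. X f s + Y f s)"
  unfolding graded_def using q.depends_plus by blast

lemma graded_mult: "graded r p q X \<Longrightarrow> graded r p q (\<lambda>f s. c s * X f s)"
  unfolding graded_def using q.depends_mult by blast

lemma graded_lift:
  assumes "graded r p q X" shows "graded r (Suc p) (Suc q) (lift X)"
  unfolding graded_def depends_def
proof (intro allI impI ballI)
  fix n and f g :: "config \<Rightarrow> A_laurent" and s assume H: "\<forall>t\<in>wspace (Suc q) (n + r). f t = g t" and s: "s \<in> wspace (Suc p) n"
  obtain x u where u: "s = x ## u" by (rule scons_cases)
  have "X (\<lambda>t. f (x ## t)) u = X (\<lambda>t. g (x ## t)) u"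
  proof (rule gradedD[OF assms])
    show "u \<in> wspace p (if x then n + 1 else n - 1)" using s u by simp
    fix t assume "t \<in> wspace q ((if x then n + 1 else n - 1) + r)"
    then have "x ## t \<in> wspace (Suc q) (n + r)" by (simp add: algebra_simps split: if_splits)
    then show "f (x ## t) = g (x ## t)" using H by blast
  qed
  then show "lift X f s = lift X g s" using u by simp
qed

lemma graded_cup0: "graded 0 (Suc (Suc p)) p q.cup0"
  unfolding graded_def depends_def
proof (intro allI impI ballI)
  fix n and f g :: "config \<Rightarrow> A_laurent" and s assume H: "\<forall>t\<in>wspace p (n + 0). f t = g t" and s: "s \<in> wspace (Suc (Suc p)) n"
  obtain x y u where u: "s = x ## y ## u" by (metis scons_cases)
  show "q.cup0 f s = q.cup0 g s"
    using H s by (cases x; cases y) (simp_all add: u quantum_cup_def)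
qed

lemma graded_cap0: "graded 0 p (Suc (Suc p)) q.cap0"
  unfolding graded_def depends_def
proof (intro allI impI ballI)
  fix n and f g :: "config \<Rightarrow> A_laurent" and s assume H: "\<forall>t\<in>wspace (Suc (Suc p)) (n + 0). f t = g t" and s: "s \<in> wspace p n"
  then show "q.cap0 f s = q.cap0 g s" by (simp add: q.cap0_def bool_sum_def quantum_cap_def)
qed

lemma graded_cup: "i \<le> p \<Longrightarrow> graded 0 (Suc (Suc p)) p (q.cup i)"
proof (induction i arbitrary: p)
  case (Suc i)
  then show ?case by (cases p) (auto intro: graded_lift)
qed (simp add: graded_cup0)

lemma graded_cap: "i \<le> p \<Longrightarrow> graded 0 p (Suc (Suc p)) (q.cap i)"
proof (induction i arbitrary: p)
  case (Suc i)
  then show ?case by (cases p) (auto intro: graded_lift)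
qed (simp add: graded_cap0)

lemma graded_e: assumes "Suc i < p" shows "graded 0 p p (q.e i)"
proof -
  obtain r where r: "p = Suc (Suc r)" "i \<le> r"
    using assms by (cases p; cases "p - 1") auto
  have "q.e i = (\<lambda>f. q.cup i (q.cap i f))" by (simp add: fun_eq_iff q.e_def)
  then show ?thesis using graded_comp0[OF graded_cup[OF r(2)] graded_cap[OF r(2)]] r(1) by simp
qed

lemma graded_crossing: assumes "Suc i < p" shows "graded 0 p p (crossing i)"
proof -
  have "crossing i = (\<lambda>f s. A_pow 1 * f s + A_pow (- 1) * q.e i f s)" by (simp add: fun_eq_iff crossing_def)
  then show ?thesis
    using graded_plus[OF graded_mult[OF graded_id] graded_mult[OF graded_e[OF assms]]] by simp
qed

lemma graded_sweep: "n < p \<Longrightarrow> graded 0 p p (sweep n)"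
proof (induction n)
  case 0
  have "sweep 0 = (\<lambda>f. f)" by (simp add: fun_eq_iff sweep.simps)
  then show ?case using graded_id by simp
next
  case (Suc n)
  have "sweep (Suc n) = (\<lambda>f. sweep n (crossing n f))" by (simp add: fun_eq_iff sweep.simps)
  then show ?case using Suc graded_crossing[of n p] graded_comp0[of p p "sweep n" p "crossing n"] by simp
qed

lemma graded_funpow: "graded 0 p p X \<Longrightarrow> graded 0 p p (X ^^ N)"
proof (induction N)
  case 0
  then show ?case using graded_id by (simp add: id_def)
next
  case (Suc N)
  have "X ^^ Suc N = (\<lambda>f. X ((X ^^ N) f))" by (simp add: fun_eq_iff)
  then show ?case using Suc graded_comp0[OF Suc.prems, of p "X ^^ N"] by simp
qed

text \<open>
  The quantum integer \<open>(v\<^sup>n - v\<^sup>-\<^sup>n) / (v - v\<^sup>-\<^sup>1)\<close> at \<open>v = A\<^sup>2\<close>, as a Laurent polynomial.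
\<close>

definition qint :: "int \<Rightarrow> A_laurent" where
  "qint n = (if n \<ge> 0 then \<Sum>i<nat n. A_pow (2 * (n - 1 - 2 * int i)) else - (\<Sum>i<nat (- n). A_pow (2 * (- n - 1 - 2 * int i))))"

lemma A_pow_diff_neq_0: "A_pow 2 - A_pow (- 2) \<noteq> 0"
proof
  assume "A_pow 2 - A_pow (- 2) = 0"
  then have "Poly_Mapping.lookup (A_pow 2) 2 = Poly_Mapping.lookup (A_pow (- 2)) 2" by simp
  then show False by (simp add: A_pow_def lookup_single)
qed

lemma qint_aux: "(A_pow 2 - A_pow (- 2)) * (\<Sum>i<k. A_pow (2 * (int k - 1 - 2 * int i))) = A_pow (2 * int k) - A_pow (- 2 * int k)"
proof -
  have "(A_pow 2 - A_pow (- 2)) * (\<Sum>i<k. A_pow (2 * (int k - 1 - 2 * int i)))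
     = (\<Sum>i<k. A_pow (2 * int k - 4 * int i) - A_pow (2 * int k - 4 * int (Suc i)))"
    unfolding sum_distrib_left by (intro sum.cong HOL.refl) (simp add: left_diff_distrib A_pow_mult algebra_simps)
  also have "\<dots> = A_pow (2 * int k - 4 * int 0) - A_pow (2 * int k - 4 * int k)"
    by (rule sum_lessThan_telescope')
  finally show ?thesis by simp
qed

lemma qint: "(A_pow 2 - A_pow (- 2)) * qint n = A_pow (2 * n) - A_pow (- 2 * n)"
proof (cases "n \<ge> 0")
  case True
  then show ?thesis using qint_aux[of "nat n"] by (simp add: qint_def)
next
  case False
  then show ?thesis using qint_aux[of "nat (- n)"] by (simp add: qint_def)
qed

lemma at_one_qint: "n \<ge> 0 \<Longrightarrow> at_one (qint n) = n"
  by (simp add: qint_def)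

lemma qint_unique: "(A_pow 2 - A_pow (- 2)) * x = A_pow (2 * n) - A_pow (- 2 * n) \<Longrightarrow> x = qint n"
  using qint[of n] A_pow_diff_neq_0 by (metis mult_left_cancel)

text \<open>
  The two generators of quantum \<open>sl\<^sub>2\<close> at \<open>v = A\<^sup>2\<close>, acting through the coproducts
  \<open>E \<otimes> 1 + K\<^sup>-\<^sup>1 \<otimes> E\<close> and \<open>F \<otimes> K + 1 \<otimes> F\<close>, where \<open>K\<close> multiplies a configuration of weight \<open>w\<close> by \<open>v\<^sup>w\<close>.
  On functions, \<open>raise\<close> maps weight \<open>n\<close> to weight \<open>n + 2\<close> and \<open>lower\<close> goes back.
\<close>

fun raise :: "nat \<Rightarrow> lop" where
  "raise 0 f s = 0"
| "raise (Suc p) f s = (if s 0 then 0 else f (True ## stl s)) + A_pow (if s 0 then 2 else - 2) * lift (raise p) f s"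

fun lower :: "nat \<Rightarrow> lop" where
  "lower 0 f s = 0"
| "lower (Suc p) f s = (if s 0 then A_pow (2 * wt p (stl s)) * f (False ## stl s) else 0) + lift (lower p) f s"

lemma lin_raise: "lin (raise p)"
proof (induction p)
  case (Suc p)
  from lin_lift[OF this] show ?case
    by (simp add: lin_def fun_eq_iff algebra_simps)
qed (simp add: lin_def)

lemma lin_lower: "lin (lower p)"
proof (induction p)
  case (Suc p)
  from lin_lift[OF this] show ?case
    by (simp add: lin_def fun_eq_iff algebra_simps)
qed (simp add: lin_def)

lemma graded_raise: "graded (- 2) p p (raise p)"
proof (induction p)
  case 0
  then show ?case by (simp add: graded_def depends_def)
next
  case (Suc p)
  note L = graded_lift[OF this]
  show ?case unfolding graded_def depends_def
  proof (intro allI impI ballI)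
    fix n and f g :: "config \<Rightarrow> A_laurent" and s assume H: "\<forall>t\<in>wspace (Suc p) (n + - 2). f t = g t" and s: "s \<in> wspace (Suc p) n"
    have "lift (raise p) f s = lift (raise p) g s" by (rule gradedD[OF L _ s]) (use H in blast)
    moreover obtain x t where u: "s = x ## t" by (rule scons_cases)
    moreover have "f (True ## t) = g (True ## t)" if "\<not> x"
      using H s that u by simp
    ultimately show "raise (Suc p) f s = raise (Suc p) g s" by simp
  qed
qed

lemma graded_lower: "graded 2 p p (lower p)"
proof (induction p)
  case 0
  then show ?case by (simp add: graded_def depends_def)
next
  case (Suc p)
  note L = graded_lift[OF this]
  show ?case unfolding graded_def depends_def
  proof (intro allI impI ballI)
    fix n and f g :: "config \<Rightarrow> A_laurent" and s assume H: "\<forall>t\<in>wspace (Suc p) (n + 2). f t = g t" and s: "s \<in> wspace (Suc p) n"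
    have "lift (lower p) f s = lift (lower p) g s" by (rule gradedD[OF L _ s]) (use H in blast)
    moreover obtain x t where u: "s = x ## t" by (rule scons_cases)
    moreover have "f (False ## t) = g (False ## t)" if "x"
      using H s that u by (simp add: algebra_simps)
    ultimately show "lower (Suc p) f s = lower (Suc p) g s" by simp
  qed
qed

lemma raise_scale_wt: "raise p (\<lambda>t. A_pow (2 * wt p t) * f t) s = A_pow (2 * wt p s - 4) * raise p f s"
proof (induction p arbitrary: f s)
  case (Suc p)
  obtain x t where s: "s = x ## t" by (rule scons_cases)
  have "raise p (\<lambda>u. A_pow (2 * wt (Suc p) (x ## u)) * f (x ## u)) t
      = A_pow (if x then - 2 else 2) * (A_pow (2 * wt p t - 4) * raise p (\<lambda>u. f (x ## u)) t)"
  proof -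
    have "(\<lambda>u. A_pow (2 * wt (Suc p) (x ## u)) * f (x ## u))
        = (\<lambda>u. A_pow (if x then - 2 else 2) * (A_pow (2 * wt p u) * f (x ## u)))"
      by (simp add: A_pow_mult_left distrib_left)
    then show ?thesis by (simp only: lin_scale[OF lin_raise] Suc.IH)
  qed
  then show ?case unfolding s
    by (cases x) (simp_all add: distrib_left A_pow_mult_left)
qed simp

text \<open>
  The commutator is the quantum integer of the weight. Adding a site, the mixed terms cancel because
  moving \<open>E\<close> past \<open>K\<close> costs \<open>v\<^sup>-\<^sup>2\<close>, and the diagonal terms satisfy the recursion of the quantum integers.
\<close>

lemma raise_lower: "raise p (lower p f) s = lower p (raise p f) s + qint (wt p s) * f s"
proof (induction p arbitrary: f s)
  case 0
  then show ?case by (simp add: qint_def)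
next
  case (Suc p)
  obtain x t where s: "s = x ## t" by (rule scons_cases)
  let ?f = "\<lambda>y u. f (y ## u)" and ?w = "wt p t"
  have lF: "lower p (\<lambda>u. a * g u + b * h u) t = a * lower p g t + b * lower p h t" for a b g h
    by (simp add: lin_add[OF lin_lower] lin_scale[OF lin_lower])
  have lE: "raise p (\<lambda>u. g u + h u) t = raise p g t + raise p h t" for g h
    by (simp add: lin_add[OF lin_raise])
  show ?case
  proof (cases x)
    case False
    have q: "A_pow (2 * ?w) + A_pow (- 2) * qint ?w = qint (1 + ?w)"
    proof (rule qint_unique)
      have "(A_pow 2 - A_pow (- 2)) * (A_pow (2 * ?w) + A_pow (- 2) * qint ?w)
         = (A_pow 2 - A_pow (- 2)) * A_pow (2 * ?w) + A_pow (- 2) * ((A_pow 2 - A_pow (- 2)) * qint ?w)"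
        by (simp add: algebra_simps)
      then show "(A_pow 2 - A_pow (- 2)) * (A_pow (2 * ?w) + A_pow (- 2) * qint ?w) = A_pow (2 * (1 + ?w)) - A_pow (- 2 * (1 + ?w))"
        unfolding qint by (simp add: left_diff_distrib right_diff_distrib A_pow_mult algebra_simps)
    qed
    have "raise (Suc p) (lower (Suc p) f) s = A_pow (2 * ?w) * f (False ## t) + lower p (?f True) t + A_pow (- 2) * raise p (lower p (?f False)) t"
      by (simp add: s False)
    moreover have "lower (Suc p) (raise (Suc p) f) s = lower p (?f True) t + A_pow (- 2) * lower p (raise p (?f False)) t"
      using lF[of 1 "?f True" "A_pow (- 2)" "raise p (?f False)"] by (simp add: s False)
    moreover have "qint (wt (Suc p) s) * f s = (A_pow (2 * ?w) + A_pow (- 2) * qint ?w) * f (False ## t)"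
      unfolding q by (simp add: s False)
    ultimately show ?thesis by (simp only: Suc.IH ring_distribs ac_simps)
  next
    case True
    have q: "- A_pow (2 * ?w) + A_pow 2 * qint ?w = qint (- 1 + ?w)"
    proof (rule qint_unique)
      have "(A_pow 2 - A_pow (- 2)) * (- A_pow (2 * ?w) + A_pow 2 * qint ?w)
         = - (A_pow 2 - A_pow (- 2)) * A_pow (2 * ?w) + A_pow 2 * ((A_pow 2 - A_pow (- 2)) * qint ?w)"
        by (simp add: algebra_simps)
      then show "(A_pow 2 - A_pow (- 2)) * (- A_pow (2 * ?w) + A_pow 2 * qint ?w) = A_pow (2 * (- 1 + ?w)) - A_pow (- 2 * (- 1 + ?w))"
        unfolding qint by (simp add: left_diff_distrib right_diff_distrib A_pow_mult algebra_simps)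
    qed
    have "raise (Suc p) (lower (Suc p) f) s = A_pow 2 * (A_pow (2 * ?w - 4) * raise p (?f False) t + raise p (lower p (?f True)) t)"
      by (simp add: s True lE raise_scale_wt)
    moreover have "lower (Suc p) (raise (Suc p) f) s = A_pow (2 * ?w) * (f (True ## t) + A_pow (- 2) * raise p (?f False) t) + A_pow 2 * lower p (raise p (?f True)) t"
      using lF[of 0 "?f True" "A_pow 2" "raise p (?f True)"] by (simp add: s True)
    moreover have "qint (wt (Suc p) s) * f s = (- A_pow (2 * ?w) + A_pow 2 * qint ?w) * f (True ## t)"
      unfolding q by (simp add: s True)
    moreover have "A_pow 2 * A_pow (2 * ?w - 4) = A_pow (2 * ?w) * A_pow (- 2)" by (simp add: A_pow_mult)
    moreover have "k * h = w * k' \<Longrightarrow> k * (h * u + (v + c * g)) = w * (g + k' * u) + k * v + (- w + k * c) * g"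
      for k h w k' u v c g :: A_laurent by algebra
    ultimately show ?thesis by (simp only: Suc.IH)
  qed
qed

lemma raise_cup0: "raise (Suc (Suc p)) (q.cup0 f) = q.cup0 (raise p f)"
proof (rule config_ext)
  fix x t
  obtain y u where t: "t = y ## u" by (rule scons_cases)
  show "raise (Suc (Suc p)) (q.cup0 f) (x ## t) = q.cup0 (raise p f) (x ## t)"
    unfolding t using lin_zero[OF lin_raise[of p]]
    by (cases x; cases y) (simp_all add: quantum_cup_def A_pow_mult A_pow_0 A_pow_mult_left lin_uminus[OF lin_raise] lin_scale[OF lin_raise] distrib_left)
qed

lemma lower_cup0: "lower (Suc (Suc p)) (q.cup0 f) = q.cup0 (lower p f)"
proof (rule config_ext)
  fix x t
  obtain y u where t: "t = y ## u" by (rule scons_cases)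
  show "lower (Suc (Suc p)) (q.cup0 f) (x ## t) = q.cup0 (lower p f) (x ## t)"
    unfolding t using lin_zero[OF lin_lower[of p]]
    by (cases x; cases y) (simp_all add: quantum_cup_def A_pow_mult A_pow_0 A_pow_mult_left lin_uminus[OF lin_lower] lin_scale[OF lin_lower] distrib_left)
qed

lemma qcap0: "q.cap0 f = (\<lambda>s. f (False ## True ## s) - A_pow (- 2) * f (True ## False ## s))"
  by (simp add: q.cap0_def bool_sum_def quantum_cap_def fun_eq_iff)

lemma raise_cap0: "q.cap0 (raise (Suc (Suc p)) f) = raise p (q.cap0 f)"
proof (rule ext)
  fix s
  have "raise p (q.cap0 f) s = raise p (\<lambda>s. f (False ## True ## s)) s - A_pow (- 2) * raise p (\<lambda>s. f (True ## False ## s)) s"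
    by (simp only: qcap0 lin_diff[OF lin_raise] lin_scale[OF lin_raise])
  then show "q.cap0 (raise (Suc (Suc p)) f) s = raise p (q.cap0 f) s"
    unfolding qcap0[of "raise (Suc (Suc p)) f"]
    by (simp add: A_pow_mult A_pow_0 A_pow_mult_left distrib_left)
qed

lemma lower_cap0: "q.cap0 (lower (Suc (Suc p)) f) = lower p (q.cap0 f)"
proof (rule ext)
  fix s
  have "lower p (q.cap0 f) s = lower p (\<lambda>s. f (False ## True ## s)) s - A_pow (- 2) * lower p (\<lambda>s. f (True ## False ## s)) s"
    by (simp only: qcap0 lin_diff[OF lin_lower] lin_scale[OF lin_lower])
  then show "q.cap0 (lower (Suc (Suc p)) f) s = lower p (q.cap0 f) s"
    unfolding qcap0[of "lower (Suc (Suc p)) f"]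
    by (simp add: A_pow_mult A_pow_0 A_pow_mult_left distrib_left)
qed

text \<open>
  The last condition says that weights are preserved, in a form that holds for functions of infinite
  sequences.
\<close>

definition equivariant :: "nat \<Rightarrow> nat \<Rightarrow> lop \<Rightarrow> bool" where
  "equivariant p q X \<longleftrightarrow> lin X \<and> (\<forall>f. raise p (X f) = X (raise q f)) \<and> (\<forall>f. lower p (X f) = X (lower q f))
    \<and> (\<forall>c f s. X (\<lambda>t. A_pow (c * wt q t) * f t) s = A_pow (c * wt p s) * X f s)"

lemma equivariantD:
  assumes "equivariant p q X"
  shows "lin X" "raise p (X f) = X (raise q f)" "lower p (X f) = X (lower q f)"
    "X (\<lambda>t. A_pow (c * wt q t) * f t) s = A_pow (c * wt p s) * X f s"
  using assms unfolding equivariant_def by blast+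

lemma equivariantI:
  assumes "lin X" "\<And>f. raise p (X f) = X (raise q f)" "\<And>f. lower p (X f) = X (lower q f)"
    "\<And>c f s. X (\<lambda>t. A_pow (c * wt q t) * f t) s = A_pow (c * wt p s) * X f s"
  shows "equivariant p q X"
  using assms unfolding equivariant_def by blast

lemma equivariant_lift:
  assumes "equivariant p q X" shows "equivariant (Suc p) (Suc q) (lift X)"
proof (rule equivariantI)
  note X = equivariantD[OF assms]
  show "lin (lift X)" by (rule lin_lift[OF X(1)])
  fix c :: int and f s
  show "raise (Suc p) (lift X f) = lift X (raise (Suc q) f)"
  proof (rule config_ext)
    fix x t
    show "raise (Suc p) (lift X f) (x ## t) = lift X (raise (Suc q) f) (x ## t)"
      by (cases x) (simp_all add: lin_add[OF X(1)] lin_scale[OF X(1)] X(2))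
  qed
  show "lower (Suc p) (lift X f) = lift X (lower (Suc q) f)"
  proof (rule config_ext)
    fix x t
    show "lower (Suc p) (lift X f) (x ## t) = lift X (lower (Suc q) f) (x ## t)"
      by (cases x) (simp_all add: lin_add[OF X(1)] X(3) X(4))
  qed
  obtain x t where s: "s = x ## t" by (rule scons_cases)
  have "X (\<lambda>u. A_pow (c * wt (Suc q) (x ## u)) * f (x ## u)) t
      = X (\<lambda>u. A_pow (c * (if x then - 1 else 1)) * (A_pow (c * wt q u) * f (x ## u))) t"
    by (simp add: A_pow_mult_left distrib_left)
  also have "\<dots> = A_pow (c * (if x then - 1 else 1)) * (A_pow (c * wt p t) * X (\<lambda>u. f (x ## u)) t)"
    by (simp only: lin_scale[OF X(1)] X(4))
  finally show "lift X (\<lambda>t. A_pow (c * wt (Suc q) t) * f t) s = A_pow (c * wt (Suc p) s) * lift X f s"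
    by (simp add: s A_pow_mult_left distrib_left)
qed

lemma equivariant_cup0: "equivariant (Suc (Suc p)) p q.cup0"
proof (rule equivariantI[OF q.lin_cup0 raise_cup0 lower_cup0])
  fix c :: int and f s
  obtain x y t where s: "s = x ## y ## t" by (metis scons_cases)
  show "q.cup0 (\<lambda>t. A_pow (c * wt p t) * f t) s = A_pow (c * wt (Suc (Suc p)) s) * q.cup0 f s"
    by (cases x; cases y) (simp_all add: s quantum_cup_def)
qed

lemma equivariant_cap0: "equivariant p (Suc (Suc p)) q.cap0"
proof (rule equivariantI[OF q.lin_cap0 raise_cap0[symmetric] lower_cap0[symmetric]])
  fix c :: int and f s
  show "q.cap0 (\<lambda>t. A_pow (c * wt (Suc (Suc p)) t) * f t) s = A_pow (c * wt p s) * q.cap0 f s"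
    by (simp add: qcap0 algebra_simps)
qed

lemma equivariant_cup: "i \<le> p \<Longrightarrow> equivariant (Suc (Suc p)) p (q.cup i)"
proof (induction i arbitrary: p)
  case (Suc i)
  then show ?case by (cases p) (auto intro: equivariant_lift)
qed (simp add: equivariant_cup0)

lemma equivariant_cap: "i \<le> p \<Longrightarrow> equivariant p (Suc (Suc p)) (q.cap i)"
proof (induction i arbitrary: p)
  case (Suc i)
  then show ?case by (cases p) (auto intro: equivariant_lift)
qed (simp add: equivariant_cap0)

lemma equivariant_id: "equivariant p p (\<lambda>f. f)"
  by (simp add: equivariant_def lin_id)

lemma equivariant_comp:
  assumes "equivariant p q X" "equivariant q r Y" shows "equivariant p r (\<lambda>f. X (Y f))"
proof (rule equivariantI)
  note X = equivariantD[OF assms(1)] and Y = equivariantD[OF assms(2)]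
  show "lin (\<lambda>f. X (Y f))" by (rule lin_comp[OF X(1) Y(1)])
  fix c :: int and f s
  show "raise p (X (Y f)) = X (Y (raise r f))" "lower p (X (Y f)) = X (Y (lower r f))"
    by (simp_all only: X(2,3) Y(2,3))
  have "Y (\<lambda>t. A_pow (c * wt r t) * f t) = (\<lambda>t. A_pow (c * wt q t) * Y f t)"
    by (rule ext) (rule Y(4))
  then show "X (Y (\<lambda>t. A_pow (c * wt r t) * f t)) s = A_pow (c * wt p s) * X (Y f) s"
    by (simp only: X(4))
qed

lemma equivariant_combine:
  assumes "equivariant p q X" "equivariant p q Y" shows "equivariant p q (\<lambda>f s. a * X f s + b * Y f s)"
proof (rule equivariantI)
  note X = equivariantD[OF assms(1)] and Y = equivariantD[OF assms(2)]
  show "lin (\<lambda>f s. a * X f s + b * Y f s)" by (intro lin_plus lin_mult X(1) Y(1))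
  fix c :: int and f s
  show "raise p (\<lambda>s. a * X f s + b * Y f s) = (\<lambda>s. a * X (raise q f) s + b * Y (raise q f) s)"
    by (simp only: lin_add[OF lin_raise] lin_scale[OF lin_raise] X(2) Y(2))
  show "lower p (\<lambda>s. a * X f s + b * Y f s) = (\<lambda>s. a * X (lower q f) s + b * Y (lower q f) s)"
    by (simp only: lin_add[OF lin_lower] lin_scale[OF lin_lower] X(3) Y(3))
  show "a * X (\<lambda>t. A_pow (c * wt q t) * f t) s + b * Y (\<lambda>t. A_pow (c * wt q t) * f t) s
      = A_pow (c * wt p s) * (a * X f s + b * Y f s)"
    unfolding X(4) Y(4) by (simp add: algebra_simps)
qed

lemma equivariant_crossing: assumes "Suc i < p" shows "equivariant p p (crossing i)"
proof -
  obtain r where r: "p = Suc (Suc r)" "i \<le> r"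
    using assms by (cases p; cases "p - 1") auto
  have "q.e i = (\<lambda>f. q.cup i (q.cap i f))" by (simp add: fun_eq_iff q.e_def)
  then have "equivariant p p (q.e i)"
    using equivariant_comp[OF equivariant_cup[OF r(2)] equivariant_cap[OF r(2)]] r(1) by simp
  moreover have "crossing i = (\<lambda>f s. A_pow 1 * f s + A_pow (- 1) * q.e i f s)" by (simp add: fun_eq_iff crossing_def)
  ultimately show ?thesis using equivariant_combine[OF equivariant_id] by simp
qed

lemma equivariant_sweep: "n < p \<Longrightarrow> equivariant p p (sweep n)"
proof (induction n)
  case 0
  have "sweep 0 = (\<lambda>f. f)" by (simp add: fun_eq_iff sweep.simps)
  then show ?case using equivariant_id by simp
next
  case (Suc n)
  have "sweep (Suc n) = (\<lambda>f. sweep n (crossing n f))" by (simp add: fun_eq_iff sweep.simps)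
  then show ?case using Suc equivariant_crossing[of n p] equivariant_comp[of p p "sweep n" p "crossing n"] by simp
qed

lemma equivariant_funpow: "equivariant p p X \<Longrightarrow> equivariant p p (X ^^ N)"
proof (induction N)
  case 0
  then show ?case using equivariant_id by (simp add: id_def)
next
  case (Suc N)
  have "X ^^ Suc N = (\<lambda>f. X ((X ^^ N) f))" by (simp add: fun_eq_iff)
  then show ?case using Suc equivariant_comp[OF Suc.prems, of p "X ^^ N"] by simp
qed

section \<open>Projecting to highest weight vectors\<close>

text \<open>
  For \<open>c\<close> with positive value at \<open>A = 1\<close>, \<open>resolvent j n c\<close> inverts \<open>c + F E\<close> on weight \<open>n\<close> up to the scalar
  \<open>resolvent_scale j n c\<close>. The recursion is \<open>(c + F E)\<^sup>-\<^sup>1 = c\<^sup>-\<^sup>1 (1 - F (c + E F)\<^sup>-\<^sup>1 E)\<close>, where \<open>E F\<close> is replaced by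
  \<open>F E\<close> plus a quantum integer in weight \<open>n + 2\<close>; it ends after \<open>j\<close> steps, beyond the top weight.
  Clearing denominators keeps everything inside the Laurent polynomials, where there is a derivation
  and an evaluation at \<open>A = 1\<close>.
\<close>

fun resolvent_scale :: "nat \<Rightarrow> int \<Rightarrow> A_laurent \<Rightarrow> A_laurent" where
  "resolvent_scale 0 n c = c"
| "resolvent_scale (Suc j) n c = c * resolvent_scale j (n + 2) (c + qint (n + 2))"

fun resolvent :: "nat \<Rightarrow> int \<Rightarrow> A_laurent \<Rightarrow> nat \<Rightarrow> lop" where
  "resolvent 0 n c p f s = f s"
| "resolvent (Suc j) n c p f s = resolvent_scale j (n + 2) (c + qint (n + 2)) * f s - lower p (resolvent j (n + 2) (c + qint (n + 2)) p (raise p f)) s"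

lemma resolvent_scale_neq_0: "n \<ge> - 2 \<Longrightarrow> at_one c > 0 \<Longrightarrow> resolvent_scale j n c \<noteq> 0"
proof (induction j arbitrary: n c)
  case (Suc j)
  then have "resolvent_scale j (n + 2) (c + qint (n + 2)) \<noteq> 0" by (simp add: at_one_qint)
  with Suc.prems show ?case by auto
qed auto

lemma lin_resolvent: "lin (resolvent j n c p)"
proof (induction j arbitrary: n c)
  case 0
  then show ?case by (simp add: lin_def fun_eq_iff)
next
  case (Suc j)
  let ?Q = "resolvent j (n + 2) (c + qint (n + 2)) p" and ?k = "resolvent_scale j (n + 2) (c + qint (n + 2))"
  have "lin (\<lambda>f s. ?k * f s + (- 1) * lower p (?Q (raise p f)) s)"
    by (intro lin_plus lin_mult lin_id lin_comp[OF lin_lower lin_comp[OF Suc lin_raise]])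
  moreover have "resolvent (Suc j) n c p = (\<lambda>f s. ?k * f s + (- 1) * lower p (?Q (raise p f)) s)"
    by (simp add: fun_eq_iff)
  ultimately show ?case by simp
qed

lemma graded_resolvent: "graded 0 p p (resolvent j n c p)"
proof (induction j arbitrary: n c)
  case 0
  then show ?case by (simp add: graded_def depends_def)
next
  case (Suc j)
  let ?Q = "resolvent j (n + 2) (c + qint (n + 2)) p" and ?k = "resolvent_scale j (n + 2) (c + qint (n + 2))"
  have "graded 0 p p (\<lambda>f. lower p (?Q (raise p f)))"
    using graded_comp[OF graded_lower graded_comp[OF Suc graded_raise]] by simp
  then have "graded 0 p p (\<lambda>f s. ?k * f s + (- 1) * lower p (?Q (raise p f)) s)"
    by (intro graded_plus graded_mult graded_id)
  moreover have "resolvent (Suc j) n c p = (\<lambda>f s. ?k * f s + (- 1) * lower p (?Q (raise p f)) s)"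
    by (simp add: fun_eq_iff)
  ultimately show ?case by simp
qed

lemma resolvent_equivariant:
  assumes "equivariant p q X" shows "resolvent j n c p (X f) = X (resolvent j n c q f)"
proof (induction j arbitrary: n c f)
  case 0
  have "resolvent 0 n c p = (\<lambda>f. f)" for p by (simp add: fun_eq_iff)
  then show ?case by simp
next
  case (Suc j)
  note X = equivariantD[OF assms]
  let ?Q = "resolvent j (n + 2) (c + qint (n + 2))" and ?k = "resolvent_scale j (n + 2) (c + qint (n + 2))"
  have Q: "resolvent (Suc j) n c p f = (\<lambda>s. ?k * f s - lower p (?Q p (raise p f)) s)" for p f
    by (simp add: fun_eq_iff)
  show ?case
    unfolding Q by (simp only: X(2) X(3) Suc lin_diff[OF X(1)] lin_scale[OF X(1)])
qed

lemma lower_top: "int p \<le> n \<Longrightarrow> s \<in> wspace p n \<Longrightarrow> lower p f s = 0"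
proof -
  assume "int p \<le> n" and s: "s \<in> wspace p n"
  then have "wspace p (n + 2) = {}" by (intro wspace_empty) simp
  then have "lower p f s = lower p (\<lambda>_. 0) s" by (intro gradedD[OF graded_lower _ s]) simp
  then show ?thesis by (simp add: lin_zero[OF lin_lower])
qed

lemma resolvent_inverse:
  "int p \<le> n + 2 * int j \<Longrightarrow> s \<in> wspace p n \<Longrightarrow>
    c * resolvent j n c p f s + lower p (raise p (resolvent j n c p f)) s = resolvent_scale j n c * f s"
proof (induction j arbitrary: n c f s)
  case 0
  then show ?case by (simp add: lower_top)
next
  case (Suc j)
  define c' where "c' = c + qint (n + 2)"
  define k' where "k' = resolvent_scale j (n + 2) c'"
  define g where "g = resolvent j (n + 2) c' p (raise p f)"
  have Q: "resolvent (Suc j) n c p f = (\<lambda>s. k' * f s - lower p g s)"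
    by (simp add: fun_eq_iff k'_def g_def c'_def)
  have IH: "c * g t + raise p (lower p g) t = k' * raise p f t" if "t \<in> wspace p (n + 2)" for t
  proof -
    have "wt p t = n + 2" using that by (simp add: wspace_def)
    then show ?thesis
      using Suc.IH[of "n + 2" t c' "raise p f"] Suc.prems(1) that
      unfolding g_def[symmetric] k'_def[symmetric] by (simp add: raise_lower c'_def algebra_simps)
  qed
  have "lower p (\<lambda>t. c * g t + raise p (lower p g) t) s = lower p (\<lambda>t. k' * raise p f t) s"
    by (rule gradedD[OF graded_lower IH Suc.prems(2)])
  then have F: "c * lower p g s + lower p (raise p (lower p g)) s = k' * lower p (raise p f) s"
    by (simp add: lin_add[OF lin_lower] lin_scale[OF lin_lower])
  have "lower p (raise p (\<lambda>s. k' * f s - lower p g s)) s = k' * lower p (raise p f) s - lower p (raise p (lower p g)) s"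
    by (simp add: lin_diff[OF lin_raise] lin_diff[OF lin_lower] lin_scale[OF lin_raise] lin_scale[OF lin_lower])
  also have "\<dots> = c * lower p g s" unfolding F[symmetric] by simp
  finally show ?case
    unfolding Q resolvent_scale.simps c'_def[symmetric] k'_def[symmetric] by (simp add: algebra_simps)
qed

definition ker_scale :: "nat \<Rightarrow> int \<Rightarrow> A_laurent" where
  "ker_scale j n = resolvent_scale j (n + 2) (qint (n + 2))"

text \<open>
  A right inverse of \<open>raise\<close> on functions of weight \<open>n + 2\<close>, up to the scalar \<open>ker_scale j n\<close>. The parameter
  \<open>j\<close> is the depth of the recursion and not tied to \<open>p\<close>, so that the operators for \<open>p\<close> and \<open>p - 2\<close> strands
  correspond to each other under cups.
\<close>

definition section_op :: "nat \<Rightarrow> int \<Rightarrow> nat \<Rightarrow> lop" where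
  "section_op j n p f = lower p (resolvent j (n + 2) (qint (n + 2)) p f)"

text \<open>
  \<open>ker_scale j n\<close> times the projection onto the kernel of \<open>raise\<close> in weight \<open>n\<close>.
\<close>

definition ker_proj :: "nat \<Rightarrow> int \<Rightarrow> nat \<Rightarrow> lop" where
  "ker_proj j n p f = (\<lambda>s. ker_scale j n * f s - section_op j n p (raise p f) s)"

lemma ker_scale_neq_0: "n \<ge> 0 \<Longrightarrow> ker_scale j n \<noteq> 0"
  unfolding ker_scale_def by (rule resolvent_scale_neq_0) (simp_all add: at_one_qint)

lemma raise_section_op:
  assumes "int p \<le> n + 2 + 2 * int j" "s \<in> wspace p (n + 2)"
  shows "raise p (section_op j n p f) s = ker_scale j n * f s"
proof -
  have "wt p s = n + 2" using assms(2) by (simp add: wspace_def)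
  then show ?thesis
    using resolvent_inverse[OF assms, of "qint (n + 2)" f] by (simp add: section_op_def ker_scale_def raise_lower algebra_simps)
qed

lemma lin_section_op: "lin (section_op j n p)"
  using lin_comp[OF lin_lower[of p] lin_resolvent[of j "n + 2" "qint (n + 2)" p]] by (simp add: section_op_def[abs_def])

lemma graded_section_op: "graded 2 p p (section_op j n p)"
  using graded_comp[OF graded_lower[of p] graded_resolvent[of p j "n + 2" "qint (n + 2)"]] by (simp add: section_op_def[abs_def])

lemma section_op_equivariant: "equivariant p q X \<Longrightarrow> section_op j n p (X f) = X (section_op j n q f)"
  unfolding section_op_def by (simp only: resolvent_equivariant equivariantD(3))

lemma lin_ker_proj: "lin (ker_proj j n p)"
proof -
  have "lin (\<lambda>f s. ker_scale j n * f s + (- 1) * section_op j n p (raise p f) s)"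
    by (intro lin_plus lin_mult lin_id lin_comp[OF lin_section_op lin_raise])
  then show ?thesis by (simp add: ker_proj_def[abs_def])
qed

lemma graded_ker_proj: "graded 0 p p (ker_proj j n p)"
proof -
  have "graded 0 p p (\<lambda>f. section_op j n p (raise p f))"
    using graded_comp[OF graded_section_op graded_raise] by simp
  then have "graded 0 p p (\<lambda>f s. ker_scale j n * f s + (- 1) * section_op j n p (raise p f) s)"
    by (intro graded_plus graded_mult graded_id)
  then show ?thesis by (simp add: ker_proj_def[abs_def])
qed

lemma ker_proj_equivariant:
  assumes "equivariant p q X" shows "ker_proj j n p (X f) = X (ker_proj j n q f)"
  unfolding ker_proj_def equivariantD(2)[OF assms] section_op_equivariant[OF assms]
    lin_diff[OF equivariantD(1)[OF assms]] lin_scale[OF equivariantD(1)[OF assms]] ..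

lemma raise_ker_proj:
  assumes "int p \<le> n + 2 + 2 * int j" "s \<in> wspace p (n + 2)"
  shows "raise p (ker_proj j n p f) s = 0"
  unfolding ker_proj_def lin_diff[OF lin_raise] lin_scale[OF lin_raise] raise_section_op[OF assms] by simp

lemma ker_proj_kernel:
  assumes "\<And>t. t \<in> wspace p (n + 2) \<Longrightarrow> raise p g t = 0" "s \<in> wspace p n"
  shows "ker_proj j n p g s = ker_scale j n * g s"
proof -
  have "section_op j n p (raise p g) s = section_op j n p (\<lambda>_. 0) s"
    by (rule gradedD[OF graded_section_op _ assms(2)]) (rule assms(1))
  then show ?thesis by (simp add: ker_proj_def lin_zero[OF lin_section_op])
qed

lemma wspace_top: "s \<in> wspace p (int p) \<Longrightarrow> s = (\<lambda>_. False)"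
proof (induction p arbitrary: s)
  case 0
  then show ?case by (simp add: wspace_def configs_0)
next
  case (Suc p)
  obtain x t where s: "s = x ## t" by (rule scons_cases)
  have "wspace p (int p + 2) = {}" by (rule wspace_empty) simp
  with Suc.prems have x: "\<not> x" by (auto simp: s add.commute)
  then have "t = (\<lambda>_. False)" using Suc.prems by (intro Suc.IH) (simp add: s)
  then show ?case using x by (auto simp: s scons_def fun_eq_iff split: nat.split)
qed

lemma ind_scons': "ind (x ## s) (y ## t) = (if x = y then ind s t else 0)"
  by (simp add: ind_def)

section \<open>Highest weight vectors are combinations of cups\<close>

definition ones :: "nat \<Rightarrow> config" where
  "ones j = (\<lambda>i. i < j)"

lemma ones_0: "ones 0 = (\<lambda>_. False)"
  and ones_Suc: "ones (Suc j) = True ## ones j"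
  by (auto simp: ones_def fun_eq_iff scons_def split: nat.split)

lemma ones_in_wspace: "j \<le> p \<Longrightarrow> ones j \<in> wspace p (int p - 2 * int j)"
proof (induction j arbitrary: p)
  case 0
  then show ?case by (simp add: ones_0 wspace_def configs_def wt_def)
next
  case (Suc j)
  then obtain r where "p = Suc r" "j \<le> r" by (cases p) auto
  then show ?case using Suc.IH[of r] by (simp add: ones_Suc algebra_simps)
qed

text \<open>
  Modulo cups, adjacent bits \<open>10\<close> and \<open>01\<close> differ by a unit, so every configuration is a multiple of the
  one that has all its ones on the left.
\<close>

lemma cup_decomposition:
  "\<exists>m y. \<forall>u\<in>wspace p (int p - 2 * int j). f u = m * ind (ones j) u + (\<Sum>i<p - 1. q.cup i (y i) u)"
proof (induction p arbitrary: j f)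
  case 0
  have "u = ones j" if "u \<in> wspace 0 (int 0 - 2 * int j)" for u
    using that by (auto simp: wspace_def configs_0 ones_0)
  then show ?case by (intro exI[of _ "f (ones j)"]) (auto simp: ind_def)
next
  case (Suc p)
  show ?case
  proof (cases j)
    case 0
    have "u = ones 0" if "u \<in> wspace (Suc p) (int (Suc p))" for u
      using wspace_top[OF that] by (simp add: ones_0)
    then show ?thesis unfolding 0
      by (intro exI[of _ "f (ones 0)"] exI[of _ "\<lambda>_ _. 0"]) (auto simp: ind_def lin_zero[OF q.lin_cup])
  next
    case (Suc i)
    have wT: "True ## t \<in> wspace (Suc p) (int (Suc p) - 2 * int j) \<longleftrightarrow> t \<in> wspace p (int p - 2 * int i)"
      and wF: "False ## t \<in> wspace (Suc p) (int (Suc p) - 2 * int j) \<longleftrightarrow> t \<in> wspace p (int p - 2 * int j)" for t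
      by (simp_all add: Suc algebra_simps)
    from Suc.IH[of i "\<lambda>t. f (True ## t)"] obtain m1 y1 where
      1: "\<And>t. t \<in> wspace p (int p - 2 * int i) \<Longrightarrow> f (True ## t) = m1 * ind (ones i) t + (\<Sum>l<p - 1. q.cup l (y1 l) t)"
      by blast
    from Suc.IH[of j "\<lambda>t. f (False ## t)"] obtain m2 y2 where
      2: "\<And>t. t \<in> wspace p (int p - 2 * int j) \<Longrightarrow> f (False ## t) = m2 * ind (ones j) t + (\<Sum>l<p - 1. q.cup l (y2 l) t)"
      by blast
    from Suc.IH[of i "ind (False ## ones i)"] obtain m3 y3 where
      3: "\<And>t. t \<in> wspace p (int p - 2 * int i) \<Longrightarrow> ind (False ## ones i) t = m3 * ind (ones i) t + (\<Sum>l<p - 1. q.cup l (y3 l) t)"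
      by blast
    show ?thesis
    proof (cases p)
      case 0
      then have no: "wspace p (int p - 2 * int j) = {}" using Suc by (intro wspace_empty) simp
      have "f u = m1 * ind (ones j) u" if u: "u \<in> wspace (Suc p) (int (Suc p) - 2 * int j)" for u
      proof -
        obtain x t where x: "u = x ## t" by (rule scons_cases)
        show ?thesis
        proof (cases x)
          case True
          then show ?thesis using u 1[of t] x wT 0 by (simp add: Suc ones_Suc ind_scons')
        next
          case False
          then show ?thesis using u x wF no by simp
        qed
      qed
      then show ?thesis using 0 by (intro exI[of _ m1]) simp
    next
      case (Suc p')
      \<comment> \<open>\<open>01\<dots>\<close> is replaced by \<open>A\<^sup>-\<^sup>2\<close> times \<open>10\<dots>\<close> at the cost of a cup at position \<open>0\<close>, and the tail of
        the new configuration is reduced once more\<close>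
      define b where "b = m2 * A_pow (- 2)"
      define y where "y = (\<lambda>l. case l of 0 \<Rightarrow> (\<lambda>t. - b * ind (ones i) t)
        | Suc l \<Rightarrow> (\<lambda>u. if u 0 then y1 l (stl u) + b * y3 l (stl u) else y2 l (stl u)))"
      have yT: "q.cup (Suc l) (y (Suc l)) (True ## t) = q.cup l (y1 l) t + b * q.cup l (y3 l) t"
        and yF: "q.cup (Suc l) (y (Suc l)) (False ## t) = q.cup l (y2 l) t" for l t
        by (simp_all add: y_def lin_add[OF q.lin_cup] lin_scale[OF q.lin_cup])
      have y0T: "q.cup 0 (y 0) (True ## t) = - b * ind (False ## ones i) t"
        and y0F: "q.cup 0 (y 0) (False ## t) = m2 * ind (True ## ones i) t" for t
        by (cases t rule: scons_cases; simp add: y_def quantum_cup_def ind_scons' b_def A_pow_mult A_pow_0 mult.left_commute)+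
      have "f u = (m1 + b * m3) * ind (ones j) u + (\<Sum>l<Suc p - 1. q.cup l (y l) u)"
        if u: "u \<in> wspace (Suc p) (int (Suc p) - 2 * int j)" for u
      proof -
        obtain x t where x: "u = x ## t" by (rule scons_cases)
        have S: "(\<Sum>l<Suc p - 1. q.cup l (y l) u) = q.cup 0 (y 0) u + (\<Sum>l<p - 1. q.cup (Suc l) (y (Suc l)) u)" for u
          unfolding Suc diff_Suc_1 by (rule sum.lessThan_Suc_shift)
        show ?thesis
        proof (cases x)
          case True
          then have t: "t \<in> wspace p (int p - 2 * int i)" using u x wT by simp
          have xT: "x = True" using True by simp
          show ?thesis
            unfolding S x xT yT y0T 1[OF t] 3[OF t] \<open>j = Suc i\<close> ones_Suc ind_scons' sum.distrib sum_distrib_left[symmetric]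
            by (simp add: algebra_simps)
        next
          case False
          then have t: "t \<in> wspace p (int p - 2 * int j)" using u x wF by simp
          have xF: "x = False" using False by simp
          show ?thesis
            unfolding S x xF yF y0F 2[OF t] \<open>j = Suc i\<close> ones_Suc ind_scons' by simp
        qed
      qed
      then show ?thesis by blast
    qed
  qed
qed

text \<open>
  The coefficients of a linear functional that annihilates all cups (\<open>cup_dual_cup\<close>): replacing adjacent
  bits \<open>01\<close> by \<open>10\<close> multiplies the coefficient by \<open>A\<^sup>2\<close>, so that the two terms of a cup cancel.
\<close>

fun cup_dual :: "nat \<Rightarrow> config \<Rightarrow> A_laurent" where
  "cup_dual 0 s = 1"
| "cup_dual (Suc p) s = A_pow (wt p (stl s)) * cup_dual p (stl s)"

lemma at_one_cup_dual: "at_one (cup_dual p s * x) = at_one x"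
  by (induction p arbitrary: s) (simp_all add: mult.assoc)

lemma sum_wspace_Suc:
  "(\<Sum>s\<in>wspace (Suc p) n. f s) = (\<Sum>s\<in>wspace p (n - 1). f (False ## s)) + (\<Sum>s\<in>wspace p (n + 1). f (True ## s))"
proof -
  have "wspace (Suc p) n = (\<lambda>s. False ## s) ` wspace p (n - 1) \<union> (\<lambda>s. True ## s) ` wspace p (n + 1)"
  proof (intro set_eqI iffI)
    fix s assume "s \<in> wspace (Suc p) n"
    then show "s \<in> (\<lambda>s. False ## s) ` wspace p (n - 1) \<union> (\<lambda>s. True ## s) ` wspace p (n + 1)"
      by (cases s rule: scons_cases; cases "s 0") auto
  qed auto
  then show ?thesis
    by (simp only:, subst sum.union_disjoint) (auto simp: finite_wspace sum.reindex inj_on_def)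
qed

lemma cup_dual_cup: "Suc i < p \<Longrightarrow> (\<Sum>s\<in>wspace p n. cup_dual p s * q.cup i y s) = 0"
proof (induction i arbitrary: p n y)
  case 0
  then obtain r where r: "p = Suc (Suc r)" by (cases p; cases "p - 1") auto
  have w: "wt r s = n" if "s \<in> wspace r n" for s using that by (simp add: wspace_def)
  have "(\<Sum>s\<in>wspace p n. cup_dual p s * q.cup 0 y s)
      = (\<Sum>s\<in>wspace r n. cup_dual (Suc (Suc r)) (False ## True ## s) * (- A_pow 2 * y s) + cup_dual (Suc (Suc r)) (True ## False ## s) * y s)"
    unfolding r sum_wspace_Suc by (simp add: quantum_cup_def sum.distrib sum_negf sum_subtractf)
  also have "\<dots> = 0"
  proof (rule sum.neutral, rule ballI)
    fix s assume "s \<in> wspace r n"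
    show "cup_dual (Suc (Suc r)) (False ## True ## s) * (- A_pow 2 * y s) + cup_dual (Suc (Suc r)) (True ## False ## s) * y s = 0"
    proof -
      have "A_pow (wt r s - 1) * A_pow 2 = A_pow (1 + wt r s)" by (simp add: A_pow_mult)
      moreover have "cup_dual (Suc (Suc r)) (False ## True ## s) = A_pow (wt r s - 1) * cup_dual (Suc r) (False ## s)"
        and "cup_dual (Suc (Suc r)) (True ## False ## s) = A_pow (1 + wt r s) * cup_dual (Suc r) (False ## s)"
        by simp_all
      moreover have "(a * w) * (- b * v) + (c * w) * v = 0" if "a * b = c" for a b c w v :: A_laurent
        unfolding that[symmetric] by (simp add: algebra_simps)
      ultimately show ?thesis by (simp only:)
    qed
  qed
  finally show ?case .
next
  case (Suc i)
  then obtain r where r: "p = Suc r" "Suc i < r" by (cases p) auto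
  have w: "wt r s = n" if "s \<in> wspace r n" for s n using that by (simp add: wspace_def)
  have "(\<Sum>s\<in>wspace p n. cup_dual p s * q.cup (Suc i) y s)
     = A_pow (n - 1) * (\<Sum>s\<in>wspace r (n - 1). cup_dual r s * q.cup i (\<lambda>t. y (False ## t)) s)
     + A_pow (n + 1) * (\<Sum>s\<in>wspace r (n + 1). cup_dual r s * q.cup i (\<lambda>t. y (True ## t)) s)"
    unfolding r(1) sum_wspace_Suc sum_distrib_left by (simp add: w mult.assoc cong: sum.cong)
  then show ?case using Suc.IH[OF r(2)] by simp
qed

lemma at_one_raise_nonneg: "(\<And>t. at_one (f t) \<ge> 0) \<Longrightarrow> at_one (raise p f s) \<ge> 0"
proof (induction p arbitrary: f s)
  case (Suc p)
  obtain x t where s: "s = x ## t" by (rule scons_cases)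
  have "0 \<le> at_one (raise p (\<lambda>u. f (x ## u)) t)" by (rule Suc.IH) (rule Suc.prems)
  then show ?case using Suc.prems[of "True ## t"] by (simp add: s)
qed simp

lemma cup_dual_raise_ones:
  assumes "j \<ge> 1" "j \<le> p"
  shows "(\<Sum>s\<in>wspace p (int p - 2 * int j + 2). cup_dual p s * raise p (ind (ones j)) s) \<noteq> 0"
proof -
  obtain i where i: "j = Suc i" using assms by (cases j) auto
  obtain r where r: "p = Suc r" using assms by (cases p) auto
  let ?t = "False ## ones i"
  have nn: "at_one (raise p (ind (ones j)) s) \<ge> 0" for s
    by (rule at_one_raise_nonneg) (simp add: ind_def flip: A_pow_0)
  have "0 \<le> at_one (raise r (\<lambda>u. ind (ones j) (False ## u)) (ones i))"
    by (rule at_one_raise_nonneg) (simp add: ind_def flip: A_pow_0)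
  then have "at_one (raise p (ind (ones j)) ?t) \<ge> 1"
    by (simp add: r i ones_Suc ind_def flip: A_pow_0)
  moreover have "?t \<in> wspace p (int p - 2 * int j + 2)"
    using ones_in_wspace[of i r] assms by (simp add: i r algebra_simps)
  ultimately have "0 < (\<Sum>s\<in>wspace p (int p - 2 * int j + 2). at_one (raise p (ind (ones j)) s))"
    by (intro sum_pos2[OF finite_wspace, of ?t]) (use nn in auto)
  then have "at_one (\<Sum>s\<in>wspace p (int p - 2 * int j + 2). cup_dual p s * raise p (ind (ones j)) s) \<noteq> 0"
    by (simp add: at_one_cup_dual)
  then show ?thesis by (metis at_one_0)
qed

text \<open>
  Decompose \<open>g = m \<cdot> ind (ones j) + cups\<close>. As \<open>raise\<close> commutes with cups, applying the functional to
  \<open>raise p g = 0\<close> leaves \<open>m\<close> times the functional at \<open>raise p (ind (ones j))\<close>, which is a sum of powers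
  of \<open>A\<close> with positive coefficients and therefore not zero. So \<open>m = 0\<close>.
\<close>

lemma raise_kernel_in_cups:
  assumes "j \<ge> 1" "j \<le> p" "\<And>t. t \<in> wspace p (int p - 2 * int j + 2) \<Longrightarrow> raise p g t = 0"
  shows "\<exists>y. \<forall>u\<in>wspace p (int p - 2 * int j). g u = (\<Sum>i<p - 1. q.cup i (y i) u)"
proof -
  from cup_decomposition[of p j g] obtain m y where
    y: "\<forall>u\<in>wspace p (int p - 2 * int j). g u = m * ind (ones j) u + (\<Sum>i<p - 1. q.cup i (y i) u)" by blast
  let ?n = "int p - 2 * int j + 2"
  have cup: "raise p (q.cup i (y i)) = q.cup i (raise (p - 2) (y i))" if ip: "i < p - 1" for i
  proof -
    obtain r where r: "p = Suc (Suc r)" using ip by (cases p; cases "p - 1") auto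
    then have "i \<le> r" using ip by simp
    from equivariantD(2)[OF equivariant_cup[OF this]] show ?thesis by (simp add: r)
  qed
  have E: "m * raise p (ind (ones j)) t + (\<Sum>i<p - 1. q.cup i (raise (p - 2) (y i)) t) = 0" if t: "t \<in> wspace p ?n" for t
  proof -
    have "raise p g t = raise p (\<lambda>u. m * ind (ones j) u + (\<Sum>i<p - 1. q.cup i (y i) u)) t"
      by (rule gradedD[OF graded_raise _ t]) (use y in simp)
    then show ?thesis
      unfolding assms(3)[OF t] using cup by (simp add: lin_add[OF lin_raise] lin_scale[OF lin_raise] lin_sum[OF lin_raise])
  qed
  have "0 = (\<Sum>t\<in>wspace p ?n. cup_dual p t * (m * raise p (ind (ones j)) t + (\<Sum>i<p - 1. q.cup i (raise (p - 2) (y i)) t)))"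
    by (rule sum.neutral[symmetric]) (use E in simp)
  also have "\<dots> = m * (\<Sum>t\<in>wspace p ?n. cup_dual p t * raise p (ind (ones j)) t)
      + (\<Sum>i<p - 1. \<Sum>t\<in>wspace p ?n. cup_dual p t * q.cup i (raise (p - 2) (y i)) t)"
    by (subst sum.swap) (simp add: distrib_left sum.distrib sum_distrib_left mult.left_commute)
  also have "(\<Sum>i<p - 1. \<Sum>t\<in>wspace p ?n. cup_dual p t * q.cup i (raise (p - 2) (y i)) t) = 0"
    by (rule sum.neutral) (auto intro!: cup_dual_cup)
  finally have "m = 0" using cup_dual_raise_ones[OF assms(1,2)] by simp
  then show ?thesis using y by auto
qed

section \<open>The full twist on highest weight vectors\<close>

definition full_twist :: "nat \<Rightarrow> lop" where
  "full_twist p = sweep (p - 1) ^^ p"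

lemma full_twist_cup: "i \<le> r \<Longrightarrow> full_twist (Suc (Suc r)) (q.cup i f) = (\<lambda>s. A_pow (- 6) * q.cup i (full_twist r f) s)"
  using slide[of i r "Suc (Suc r)" 1 i f] by (simp add: full_twist_def)

lemma sweep_zero: "sweep n f (\<lambda>_. False) = A_pow (int n) * f (\<lambda>_. False)"
proof (induction n arbitrary: f)
  case 0
  then show ?case by (simp add: sweep.simps A_pow_0)
next
  case (Suc n)
  have cup: "q.cup i g (\<lambda>_. False) = 0" for i g
  proof (induction i arbitrary: g)
    case 0
    show ?case unfolding q.cup.simps q.cup0_def by (simp add: quantum_cup_def)
  next
    case (Suc i)
    show ?case by (simp add: lift_def stl_def Suc)
  qed
  then show ?case by (simp add: sweep.simps Suc crossing_def q.e_def A_pow_mult_left algebra_simps)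
qed

lemma full_twist_zero: "full_twist p f (\<lambda>_. False) = A_pow (int p * (int p - 1)) * f (\<lambda>_. False)"
proof (cases p)
  case (Suc r)
  have "(sweep r ^^ N) f (\<lambda>_. False) = A_pow (int N * int r) * f (\<lambda>_. False)" for N
    by (induction N) (simp_all add: sweep_zero A_pow_0 A_pow_mult_left distrib_right)
  from this[of "Suc r"] show ?thesis
    unfolding full_twist_def Suc diff_Suc_1 by (simp del: funpow.simps)
qed (simp add: full_twist_def A_pow_0)

text \<open>
  The full twist acts by \<open>A\<close> to this power on the kernel of \<open>raise\<close> in weight \<open>n\<close>.
\<close>

definition twist_exp :: "nat \<Rightarrow> int \<Rightarrow> int" where
  "twist_exp p n = (n + 1)^2 - 1 - 3 * int p"

lemma graded_full_twist: "p \<ge> 1 \<Longrightarrow> graded 0 p p (full_twist p)"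
  unfolding full_twist_def by (intro graded_funpow graded_sweep) simp

lemma lin_full_twist: "lin (full_twist p)"
  unfolding full_twist_def by (intro lin_funpow lin_sweep)

text \<open>
  A vector in the kernel of \<open>raise\<close> is a sum of cups. Applying the projection once more, which commutes
  with cups, the cups may be assumed to be attached to vectors in the kernel on \<open>p - 2\<close> strands, and
  pulling a cup through the full twist costs \<open>A\<^sup>-\<^sup>6\<close>. The induction ends with the configuration without
  ones, on which every crossing is multiplication by \<open>A\<close>.
\<close>

theorem full_twist_on_kernel:
  assumes "n \<ge> 0" "int p \<le> n + 2 + 2 * int j" "s \<in> wspace p n"
  shows "full_twist p (ker_proj j n p f) s = A_pow (twist_exp p n) * ker_proj j n p f s"
  using assms
proof (induction p arbitrary: f s rule: less_induct)
  case (less p)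
  show ?case
  proof (cases "n \<ge> int p")
    case True
    moreover have "\<not> int p < \<bar>n\<bar>" using wspace_empty less.prems(3) by blast
    ultimately have n: "n = int p" by simp
    then have "s = (\<lambda>_. False)" using wspace_top less.prems(3) by simp
    then show ?thesis by (simp add: full_twist_zero twist_exp_def n power2_eq_square algebra_simps)
  next
    case False
    have par: "even (int p - wt p s)" for s
      unfolding wt_def by (induction p) auto
    have "wt p s = n" using less.prems(3) by (simp add: wspace_def)
    then have "even (int p - n)" using par[of s] by (simp only:)
    then obtain i where i: "int p - n = 2 * i" by (rule evenE)
    define l where "l = nat i"
    have n: "n = int p - 2 * int l" and l: "l \<ge> 1" "l \<le> p" using i False less.prems(1) by (auto simp: l_def)
    define g where "g = ker_proj j n p f"
    have Eg: "raise p g t = 0" if "t \<in> wspace p (n + 2)" for t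
      unfolding g_def by (rule raise_ker_proj[OF less.prems(2) that])
    from raise_kernel_in_cups[OF l, of g] Eg obtain y where
      y: "\<forall>u\<in>wspace p n. g u = (\<Sum>i<p - 1. q.cup i (y i) u)" unfolding n by auto
    obtain r where r: "p = Suc (Suc r)" using l n less.prems(1) by (cases p; cases "p - 1") auto
    have Pcup: "ker_proj j n p (q.cup i z) = q.cup i (ker_proj j n r z)" if "i < p - 1" for i z
      unfolding r by (rule ker_proj_equivariant[OF equivariant_cup]) (use that r in simp)
    \<comment> \<open>replace the cups by cups on kernel vectors, using that the projection is idempotent up to scaling\<close>
    have kg: "ker_scale j n * g u = (\<Sum>i<p - 1. q.cup i (ker_proj j n r (y i)) u)" if u: "u \<in> wspace p n" for u
    proof -
      have "ker_scale j n * g u = ker_proj j n p g u" by (rule ker_proj_kernel[OF Eg u, symmetric])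
      also have "\<dots> = ker_proj j n p (\<lambda>u. \<Sum>i<p - 1. q.cup i (y i) u) u"
        by (rule gradedD[OF graded_ker_proj _ u]) (use y in simp)
      also have "\<dots> = (\<Sum>i<p - 1. q.cup i (ker_proj j n r (y i)) u)"
        unfolding lin_sum[OF lin_ker_proj] by (intro sum.cong HOL.refl) (simp add: Pcup)
      finally show ?thesis .
    qed
    have T: "full_twist p (q.cup i (ker_proj j n r (y i))) s = A_pow (twist_exp p n) * q.cup i (ker_proj j n r (y i)) s" if "i < p - 1" for i
    proof -
      have ir: "i \<le> r" using that r by simp
      have "q.cup i (full_twist r (ker_proj j n r (y i))) s = q.cup i (\<lambda>t. A_pow (twist_exp r n) * ker_proj j n r (y i) t) s"
      proof (rule gradedD[OF graded_cup[OF ir]])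
        show "s \<in> wspace (Suc (Suc r)) n" using less.prems(3) r by simp
        fix t assume "t \<in> wspace r (n + 0)"
        then show "full_twist r (ker_proj j n r (y i)) t = A_pow (twist_exp r n) * ker_proj j n r (y i) t"
          using less.IH[of r t "y i"] less.prems r by simp
      qed
      then show ?thesis
        unfolding r full_twist_cup[OF ir] lin_scale[OF q.lin_cup] by (simp add: A_pow_mult_left twist_exp_def)
    qed
    have "ker_scale j n * full_twist p g s = full_twist p (\<lambda>u. ker_scale j n * g u) s"
      by (simp add: lin_scale[OF lin_full_twist])
    also have "\<dots> = full_twist p (\<lambda>u. \<Sum>i<p - 1. q.cup i (ker_proj j n r (y i)) u) s"
      by (rule gradedD[OF graded_full_twist _ less.prems(3)]) (use kg r in simp_all)
    also have "\<dots> = (\<Sum>i<p - 1. A_pow (twist_exp p n) * q.cup i (ker_proj j n r (y i)) s)"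
      unfolding lin_sum[OF lin_full_twist] by (intro sum.cong HOL.refl T) simp
    also have "\<dots> = ker_scale j n * (A_pow (twist_exp p n) * g s)"
      using kg[OF less.prems(3)] by (simp add: mult.left_commute flip: sum_distrib_left)
    finally show ?thesis using ker_scale_neq_0[OF less.prems(1)] by (simp add: g_def)
  qed
qed

section \<open>A differential equation for differences of traces\<close>

text \<open>
  The commutator of the derivation with \<open>X\<close>: the derivative of the matrix of \<open>X\<close>. Being a commutator it
  satisfies the product rule without further work.
\<close>

definition op_deriv :: "lop \<Rightarrow> lop" where
  "op_deriv X h s = deriv_A (X h s) - X (\<lambda>t. deriv_A (h t)) s"

lemma lin_op_deriv: assumes "lin X" shows "lin (op_deriv X)"
  unfolding lin_def
proof (intro conjI allI ext)
  fix f g and c :: A_laurent and s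
  show "op_deriv X (\<lambda>s. f s + g s) s = op_deriv X f s + op_deriv X g s"
    unfolding op_deriv_def deriv_A_add lin_add[OF assms] by simp
  show "op_deriv X (\<lambda>s. c * f s) s = c * op_deriv X f s"
    unfolding op_deriv_def deriv_A_mult lin_add[OF assms] lin_scale[OF assms] by (simp add: algebra_simps)
qed

lemma depends_op_deriv: "depends I J X \<Longrightarrow> depends I J (op_deriv X)"
  unfolding depends_def[of I J "op_deriv X"]
proof (intro allI impI ballI)
  fix f g :: "config \<Rightarrow> A_laurent" and s
  assume X: "depends I J X" and H: "\<forall>t\<in>J. f t = g t" and s: "s \<in> I"
  have "X f s = X g s" "X (\<lambda>t. deriv_A (f t)) s = X (\<lambda>t. deriv_A (g t)) s"
    by (rule dependsD[OF X _ s]; use H in simp)+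
  then show "op_deriv X f s = op_deriv X g s" by (simp add: op_deriv_def)
qed

lemma op_deriv_comp:
  assumes "lin X" shows "op_deriv (\<lambda>f. X (Y f)) h s = op_deriv X (Y h) s + X (op_deriv Y h) s"
proof -
  have "X (op_deriv Y h) s = X (\<lambda>t. deriv_A (Y h t)) s - X (Y (\<lambda>t. deriv_A (h t))) s"
    unfolding op_deriv_def[abs_def] lin_diff[OF assms] ..
  then show ?thesis by (simp add: op_deriv_def)
qed

lemma deriv_tr: assumes "lin X" shows "deriv_A (tr I X) = tr I (op_deriv X)"
proof -
  have "deriv_A (ind s t) = 0" for s t
    using deriv_A_monomial[of 0] by (simp add: ind_def deriv_A_0 A_pow_0)
  then show ?thesis by (simp add: tr_def deriv_A_sum op_deriv_def lin_zero[OF assms])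
qed

lemma tr_add: "tr I (\<lambda>f s. X f s + Y f s) = tr I X + tr I Y"
  and tr_diff: "tr I (\<lambda>f s. X f s - Y f s) = tr I X - tr I Y"
  and tr_scale: "tr I (\<lambda>f s. c * X f s) = c * tr I X"
  by (simp_all add: tr_def sum.distrib sum_subtractf sum_distrib_left)

text \<open>
  All the terms of the derivative of \<open>X\<^sup>m\<^sup>+\<^sup>1\<close> have the same trace by cyclicity, even after
  multiplication by another power of \<open>X\<close>.
\<close>

lemma tr_deriv_power:
  assumes "finite I" "lin X" "depends I I X"
  shows "tr I (\<lambda>h. (X ^^ q) (op_deriv (X ^^ Suc m) h)) = of_nat (Suc m) * tr I (\<lambda>h. (X ^^ (q + m)) (op_deriv X h))"
proof (induction m arbitrary: q)
  case 0
  have "X ^^ Suc 0 = X" by (simp add: fun_eq_iff)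
  then show ?case by (simp only:) simp
next
  case (Suc m)
  have lq: "lin (X ^^ q)" for q by (rule lin_funpow[OF assms(2)])
  have dq: "depends I I (X ^^ q)" for q by (rule depends_funpow[OF assms(3)])
  have X2: "X ^^ Suc (Suc m) = (\<lambda>f. X ((X ^^ Suc m) f))" by (simp add: fun_eq_iff)
  have "op_deriv (X ^^ Suc (Suc m)) h = (\<lambda>s. op_deriv X ((X ^^ Suc m) h) s + X (op_deriv (X ^^ Suc m) h) s)" for h
    unfolding X2 by (rule ext) (rule op_deriv_comp[OF assms(2)])
  then have "tr I (\<lambda>h. (X ^^ q) (op_deriv (X ^^ Suc (Suc m)) h))
      = tr I (\<lambda>h. (X ^^ q) (op_deriv X ((X ^^ Suc m) h))) + tr I (\<lambda>h. (X ^^ q) (X (op_deriv (X ^^ Suc m) h)))"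
    by (simp only: lin_add[OF lq] tr_add)
  also have "tr I (\<lambda>h. (X ^^ q) (op_deriv X ((X ^^ Suc m) h))) = tr I (\<lambda>h. (X ^^ Suc m) ((X ^^ q) (op_deriv X h)))"
    by (rule tr_comm[OF assms(1,1) lin_comp[OF lq lin_op_deriv[OF assms(2)]] lq depends_comp[OF dq depends_op_deriv[OF assms(3)]] dq])
  also have "\<dots> = tr I (\<lambda>h. (X ^^ (q + Suc m)) (op_deriv X h))"
    by (simp only: funpow_add o_apply add.commute[of q "Suc m"])
  also have "(\<lambda>h. (X ^^ q) (X (op_deriv (X ^^ Suc m) h))) = (\<lambda>h. (X ^^ Suc q) (op_deriv (X ^^ Suc m) h))"
    by (simp add: fun_eq_iff funpow_swap1)
  also have "tr I \<dots> = of_nat (Suc m) * tr I (\<lambda>h. (X ^^ (q + Suc m)) (op_deriv X h))"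
    using Suc[of "Suc q"] by (simp only: add_Suc add_Suc_right)
  finally show ?case by (simp add: distrib_right)
qed

lemma tr_affine:
  assumes I: "finite I" and X: "lin X" "depends I I X" and D: "lin D" "depends I I D"
    and H: "\<And>h s. s \<in> I \<Longrightarrow> c * X h s = a * h s + Y h s"
  shows "c * tr I (\<lambda>h. D (X h)) = a * tr I D + tr I (\<lambda>h. D (Y h))"
proof -
  have "c * D (X h) s = a * D h s + D (Y h) s" if "s \<in> I" for h s
  proof -
    have "c * D (X h) s = D (\<lambda>s. c * X h s) s" by (simp add: lin_scale[OF D(1)])
    also have "\<dots> = D (\<lambda>s. a * h s + Y h s) s" by (rule dependsD[OF D(2) _ that]) (rule H)
    finally show ?thesis by (simp add: lin_add[OF D(1)] lin_scale[OF D(1)])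
  qed
  then have "tr I (\<lambda>h s. c * D (X h) s) = tr I (\<lambda>h s. a * D h s + D (Y h) s)" by (intro tr_cong)
  then show ?thesis by (simp only: tr_scale tr_add)
qed

lemma op_deriv_affine:
  assumes B: "lin B" and H: "\<And>h s. s \<in> I \<Longrightarrow> c * X h s = a * h s + B (C h) s" and s: "s \<in> I"
  shows "c * op_deriv X h s = deriv_A a * h s + ((op_deriv B (C h) s + B (op_deriv C h) s) - deriv_A c * X h s)"
proof -
  have "deriv_A (c * X h s) = deriv_A (a * h s + B (C h) s)" using H[OF s] by simp
  moreover have "c * X (\<lambda>t. deriv_A (h t)) s = a * deriv_A (h s) + B (C (\<lambda>t. deriv_A (h t))) s" by (rule H[OF s])
  moreover have "op_deriv (\<lambda>h. B (C h)) h s = op_deriv B (C h) s + B (op_deriv C h) s" by (rule op_deriv_comp[OF B])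
  ultimately show ?thesis by (simp add: op_deriv_def deriv_A_mult deriv_A_add algebra_simps)
qed

text \<open>
  \<open>E\<close> maps functions on \<open>I\<close> onto functions on \<open>J\<close> up to denominators, so the difference of the traces of \<open>X\<^sup>q\<close> is its trace on
  the kernel of \<open>E\<close>, where \<open>X\<^sup>p\<close> is the scalar \<open>A\<^sup>b\<close>. The hypotheses on \<open>G\<close> express this without mentioning the
  kernel: \<open>c (X\<^sup>p - A\<^sup>b)\<close> is \<open>G E\<close> on \<open>I\<close> and \<open>E G\<close> on \<open>J\<close>. In the difference of the two traces all terms with
  \<open>E\<close> and \<open>G\<close>, including those with their derivatives, cancel by cyclicity. What remains is the
  derivative of the scalar \<open>A\<^sup>b\<close>, to be compared with \<open>p\<close> copies of the derivative of \<open>X\<close>.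
\<close>

theorem trace_difference_ode:
  fixes X E G :: lop
  assumes fin: "finite I" "finite J" and X: "lin X" "depends I I X" "depends J J X"
    and E: "lin E" "depends J I E" "\<And>h. E (X h) = X (E h)"
    and G: "lin G" "depends I J G" "\<And>h. G (X h) = X (G h)"
    and HI: "\<And>h s. s \<in> I \<Longrightarrow> c * (X ^^ p) h s = c * A_pow b * h s + G (E h) s"
    and HJ: "\<And>h s. s \<in> J \<Longrightarrow> c * (X ^^ p) h s = c * A_pow b * h s + E (G h) s"
    and c: "c \<noteq> 0" and p: "p \<ge> 1"
  shows "of_nat p * deriv_A (tr I (X ^^ q) - tr J (X ^^ q)) = of_nat q * of_int b * (tr I (X ^^ q) - tr J (X ^^ q))"
proof -
  let ?D = "X ^^ q" and ?l = "A_pow b"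
  have lq: "lin (X ^^ m)" for m by (rule lin_funpow[OF X(1)])
  have dI: "depends I I (X ^^ m)" and dJ: "depends J J (X ^^ m)" for m
    by (rule depends_funpow, rule X)+
  have ED: "E ((X ^^ m) h) = (X ^^ m) (E h)" and GD: "G ((X ^^ m) h) = (X ^^ m) (G h)" for m h
    by (induction m) (simp_all add: E(3) G(3))
  have add: "(\<lambda>h. ?D ((X ^^ p) h)) = X ^^ (q + p)" by (simp add: fun_eq_iff funpow_add)
  define f where "f = tr I ?D - tr J ?D"
  define f' where "f' = tr I (X ^^ (q + p)) - tr J (X ^^ (q + p))"
  have I1: "c * tr I (X ^^ (q + p)) = c * ?l * tr I ?D + tr I (\<lambda>h. ?D (G (E h)))"
    using tr_affine[OF fin(1) lq dI lq dI HI, of q] unfolding add by simp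
  have J1: "c * tr J (X ^^ (q + p)) = c * ?l * tr J ?D + tr J (\<lambda>h. ?D (E (G h)))"
    using tr_affine[OF fin(2) lq dJ lq dJ HJ, of q] unfolding add by simp
  have IJ1: "tr I (\<lambda>h. ?D (G (E h))) = tr J (\<lambda>h. ?D (E (G h)))"
    using tr_comm[OF fin lin_comp[OF lq G(1)] E(1) depends_comp[OF dI G(2)] E(2), of q] unfolding ED by simp
  \<comment> \<open>\<open>X\<^sup>p\<close> acts as the scalar on the difference of the traces\<close>
  have "c * f' = c * (?l * f)"
    using I1 J1 IJ1 by (simp add: f_def f'_def algebra_simps)
  then have f': "f' = ?l * f" using c by simp
  define gI where "gI = tr I (\<lambda>h. ?D (op_deriv (X ^^ p) h))"
  define gJ where "gJ = tr J (\<lambda>h. ?D (op_deriv (X ^^ p) h))"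
  have split: "tr K (\<lambda>h. ?D (\<lambda>s. (Y h s + Z h s) - deriv_A c * (X ^^ p) h s))
      = tr K (\<lambda>h. ?D (Y h)) + tr K (\<lambda>h. ?D (Z h)) - deriv_A c * tr K (X ^^ (q + p))" for K Y Z
  proof -
    have "?D (\<lambda>s. (Y h s + Z h s) - deriv_A c * (X ^^ p) h s) = (\<lambda>s. (?D (Y h) s + ?D (Z h) s) - deriv_A c * (X ^^ (q + p)) h s)" for h
      unfolding lin_diff[OF lq] lin_add[OF lq] lin_scale[OF lq] by (simp add: funpow_add)
    then show ?thesis by (simp only: tr_add tr_diff tr_scale)
  qed
  have I2: "c * gI = deriv_A (c * ?l) * tr I ?D
      + (tr I (\<lambda>h. ?D (op_deriv G (E h))) + tr I (\<lambda>h. ?D (G (op_deriv E h))) - deriv_A c * tr I (X ^^ (q + p)))"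
    unfolding gI_def split[symmetric]
    by (rule tr_affine[OF fin(1) lin_op_deriv[OF lq] depends_op_deriv[OF dI] lq dI])
      (rule op_deriv_affine[OF G(1) HI])
  have J2: "c * gJ = deriv_A (c * ?l) * tr J ?D
      + (tr J (\<lambda>h. ?D (op_deriv E (G h))) + tr J (\<lambda>h. ?D (E (op_deriv G h))) - deriv_A c * tr J (X ^^ (q + p)))"
    unfolding gJ_def split[symmetric]
    by (rule tr_affine[OF fin(2) lin_op_deriv[OF lq] depends_op_deriv[OF dJ] lq dJ])
      (rule op_deriv_affine[OF E(1) HJ])
  have "tr I (\<lambda>h. ?D (op_deriv G (E h))) = tr J (\<lambda>h. E (?D (op_deriv G h)))"
    by (rule tr_comm[OF fin lin_comp[OF lq lin_op_deriv[OF G(1)]] E(1) depends_comp[OF dI depends_op_deriv[OF G(2)]] E(2)])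
  then have IJ2: "tr I (\<lambda>h. ?D (op_deriv G (E h))) = tr J (\<lambda>h. ?D (E (op_deriv G h)))"
    unfolding ED .
  have "tr I (\<lambda>h. ?D (G (op_deriv E h))) = tr J (\<lambda>h. op_deriv E (?D (G h)))"
    by (rule tr_comm[OF fin lin_comp[OF lq G(1)] lin_op_deriv[OF E(1)] depends_comp[OF dI G(2)] depends_op_deriv[OF E(2)]])
  also have "\<dots> = tr J (\<lambda>h. op_deriv E (G (?D h)))" unfolding GD ..
  also have "\<dots> = tr J (\<lambda>h. ?D (op_deriv E (G h)))"
    by (rule tr_comm[OF fin(2,2) lin_comp[OF lin_op_deriv[OF E(1)] G(1)] lq depends_comp[OF depends_op_deriv[OF E(2)] G(2)] dJ])
  finally have IJ3: "tr I (\<lambda>h. ?D (G (op_deriv E h))) = tr J (\<lambda>h. ?D (op_deriv E (G h)))" .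
  have "c * (gI - gJ) = deriv_A (c * ?l) * f - deriv_A c * f'"
    unfolding right_diff_distrib I2 J2 IJ2 IJ3 by (simp add: f_def f'_def algebra_simps)
  also have "\<dots> = c * (of_int b * ?l * f)"
    unfolding f' by (simp add: deriv_A_mult deriv_A_monomial algebra_simps)
  finally have g: "gI - gJ = of_int b * ?l * f" using c by simp
  obtain p' where p': "p = Suc p'" using p by (cases p) auto
  have deriv: "of_nat p * deriv_A (tr K (X ^^ (q + p))) = of_nat (q + p) * tr K (\<lambda>h. ?D (op_deriv (X ^^ p) h))"
    if K: "finite K" "depends K K X" for K
  proof -
    have "deriv_A (tr K (X ^^ (q + p))) = tr K (\<lambda>h. (X ^^ 0) (op_deriv (X ^^ Suc (q + p')) h))"
      by (simp add: deriv_tr[OF lq] p' del: funpow.simps(2))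
    also have "\<dots> = of_nat (q + p) * tr K (\<lambda>h. (X ^^ (q + p')) (op_deriv X h))"
      unfolding tr_deriv_power[OF K(1) X(1) K(2)] by (simp add: p')
    finally have "deriv_A (tr K (X ^^ (q + p))) = of_nat (q + p) * tr K (\<lambda>h. (X ^^ (q + p')) (op_deriv X h))" .
    moreover have "tr K (\<lambda>h. ?D (op_deriv (X ^^ p) h)) = of_nat p * tr K (\<lambda>h. (X ^^ (q + p')) (op_deriv X h))"
      unfolding p' by (rule tr_deriv_power[OF K(1) X(1) K(2)])
    ultimately show ?thesis by (simp only: mult.left_commute)
  qed
  have "of_nat p * deriv_A f' = of_nat (q + p) * (gI - gJ)"
    unfolding f'_def gI_def gJ_def deriv_A_diff right_diff_distrib
    using deriv[OF fin(1) X(2)] deriv[OF fin(2) X(3)] by simp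
  then have "of_nat p * (of_int b * ?l * f + ?l * deriv_A f) = of_nat (q + p) * (of_int b * ?l * f)"
    unfolding f' g by (simp add: deriv_A_mult deriv_A_monomial)
  then have "?l * (of_nat p * deriv_A f) = ?l * (of_nat q * of_int b * f)"
    by (simp add: algebra_simps)
  then show ?thesis unfolding f_def using A_pow_neq_0[of b] by simp
qed

lemma lookup_of_int_mult: "Poly_Mapping.lookup (of_int a * f) m = a * Poly_Mapping.lookup (f :: A_laurent) m"
proof -
  have nat: "Poly_Mapping.lookup (of_nat k * f) m = int k * Poly_Mapping.lookup f m" for k
    by (induction k) (simp_all add: distrib_right lookup_add)
  show ?thesis
  proof (cases "a \<ge> 0")
    case True
    then show ?thesis using nat[of "nat a"] by simp
  next
    case False
    then have "of_int a * f = - (of_nat (nat (- a)) * f)" by simp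
    then show ?thesis using nat[of "nat (- a)"] False by simp
  qed
qed

text \<open>
  The equation multiplies the coefficient of \<open>A\<^sup>m\<close> by \<open>p m - b\<close>, so at most one coefficient survives.
\<close>

lemma monomial_solution:
  assumes "p \<ge> 1" "of_nat p * deriv_A f = of_int b * f" "f \<noteq> 0"
  obtains m where "int p * m = b" "f = of_int (at_one f) * A_pow m" "at_one f \<noteq> 0"
proof -
  have eq: "int p * m = b" if "m \<in> Poly_Mapping.keys f" for m
  proof -
    have "Poly_Mapping.lookup (of_int (int p) * deriv_A f) m = Poly_Mapping.lookup (of_int b * f) m"
      using assms(2) by simp
    then have "(int p * m) * Poly_Mapping.lookup f m = b * Poly_Mapping.lookup f m"
      unfolding lookup_of_int_mult lookup_deriv_A by simp
    then show ?thesis using that by (simp add: in_keys_iff)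
  qed
  obtain m where m: "m \<in> Poly_Mapping.keys f" using assms(3) by (metis all_not_in_conv keys_eq_empty)
  have "Poly_Mapping.keys f = {m}"
  proof -
    have "m' = m" if "m' \<in> Poly_Mapping.keys f" for m'
    proof -
      have "int p * m' = int p * m" using eq[OF that] eq[OF m] by simp
      then show ?thesis using assms(1) by simp
    qed
    then show ?thesis using m by blast
  qed
  then have one: "at_one f = Poly_Mapping.lookup f m" by (simp add: at_one_def)
  have "f = of_int (at_one f) * A_pow m"
  proof (rule poly_mapping_eqI)
    fix i show "Poly_Mapping.lookup f i = Poly_Mapping.lookup (of_int (at_one f) * A_pow m) i"
    proof (cases "i = m")
      case False
      then have "i \<notin> Poly_Mapping.keys f" using \<open>Poly_Mapping.keys f = {m}\<close> by simp
      then show ?thesis using False unfolding lookup_of_int_mult A_pow_def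
        by (simp add: lookup_single in_keys_iff)
    qed (simp add: lookup_of_int_mult one A_pow_def)
  qed
  moreover have "at_one f \<noteq> 0" using one m by (simp add: in_keys_iff)
  ultimately show ?thesis using that eq[OF m] by blast
qed

text \<open>
  The trace of \<open>\<delta>\<^sup>q\<close> on the weight space \<open>n\<close>.
\<close>

definition weight_trace :: "nat \<Rightarrow> nat \<Rightarrow> int \<Rightarrow> A_laurent" where
  "weight_trace p q n = tr (wspace p n) (sweep (p - 1) ^^ q)"

lemma weight_trace_difference_ode:
  assumes "n \<ge> 0" "p \<ge> 1"
  shows "of_nat p * deriv_A (weight_trace p q n - weight_trace p q (n + 2)) = of_int (int q * twist_exp p n) * (weight_trace p q n - weight_trace p q (n + 2))"
proof -
  \<comment> \<open>any depth large enough to exceed the top weight will do\<close>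
  define j where "j = p"
  have j: "int p \<le> n + 2 + 2 * int j" using assms by (simp add: j_def)
  let ?X = "sweep (p - 1)"
  define G where "G = (\<lambda>h s. full_twist p (section_op j n p h) s - A_pow (twist_exp p n) * section_op j n p h s)"
  have eqX: "equivariant p p ?X" using assms by (intro equivariant_sweep) simp
  have eqT: "equivariant p p (full_twist p)" unfolding full_twist_def by (rule equivariant_funpow[OF eqX])
  have gX: "graded 0 p p ?X" using assms by (intro graded_sweep) simp
  note lT = lin_full_twist[of p]
  have XT: "full_twist p (?X h) = ?X (full_twist p h)" for h
    unfolding full_twist_def by (simp add: funpow_swap1)
  have lG: "lin G"
  proof -
    have "lin (\<lambda>h s. full_twist p (section_op j n p h) s + - A_pow (twist_exp p n) * section_op j n p h s)"
      by (intro lin_plus lin_mult lin_section_op lin_comp[OF lT lin_section_op])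
    then show ?thesis by (simp add: G_def)
  qed
  have gG: "graded 2 p p G"
  proof -
    have "graded 2 p p (\<lambda>h. full_twist p (section_op j n p h))"
      using graded_comp[OF graded_full_twist[OF assms(2)] graded_section_op] by simp
    then have "graded 2 p p (\<lambda>h s. full_twist p (section_op j n p h) s + - A_pow (twist_exp p n) * section_op j n p h s)"
      by (intro graded_plus graded_mult graded_section_op)
    then show ?thesis by (simp add: G_def)
  qed
  have EX: "raise p (?X h) = ?X (raise p h)" for h by (rule equivariantD(2)[OF eqX])
  have GX: "G (?X h) = ?X (G h)" for h
    unfolding G_def section_op_equivariant[OF eqX] XT lin_diff[OF lin_sweep] lin_scale[OF lin_sweep] ..
  have HI: "ker_scale j n * full_twist p h s = ker_scale j n * A_pow (twist_exp p n) * h s + G (raise p h) s" if "s \<in> wspace p n" for h s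
  proof -
    have "full_twist p (ker_proj j n p h) s = A_pow (twist_exp p n) * ker_proj j n p h s"
      by (rule full_twist_on_kernel[OF assms(1) j that])
    then show ?thesis
      unfolding ker_proj_def lin_diff[OF lT] lin_scale[OF lT] G_def by (simp add: algebra_simps)
  qed
  have HJ: "ker_scale j n * full_twist p h s = ker_scale j n * A_pow (twist_exp p n) * h s + raise p (G h) s" if s: "s \<in> wspace p (n + 2)" for h s
  proof -
    have E: "raise p (section_op j n p h) t = ker_scale j n * h t" if "t \<in> wspace p (n + 2)" for t
      by (rule raise_section_op[OF j that])
    have "full_twist p (raise p (section_op j n p h)) s = full_twist p (\<lambda>t. ker_scale j n * h t) s"
      by (rule gradedD[OF graded_full_twist[OF assms(2)] _ s]) (simp add: E)
    then have "full_twist p (raise p (section_op j n p h)) s = ker_scale j n * full_twist p h s"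
      unfolding lin_scale[OF lT] .
    moreover have "raise p (G h) s = full_twist p (raise p (section_op j n p h)) s - A_pow (twist_exp p n) * raise p (section_op j n p h) s"
      unfolding G_def lin_diff[OF lin_raise] lin_scale[OF lin_raise] equivariantD(2)[OF eqT] ..
    ultimately show ?thesis using E[OF s] by (simp add: algebra_simps)
  qed
  have dE: "depends (wspace p (n + 2)) (wspace p n) (raise p)"
    using graded_raise[of p] unfolding graded_def by (metis add_diff_cancel_right' diff_conv_add_uminus)
  have dG: "depends (wspace p n) (wspace p (n + 2)) G" using gG unfolding graded_def by blast
  show ?thesis
    using trace_difference_ode[OF finite_wspace finite_wspace lin_sweep graded_depends[OF gX] graded_depends[OF gX]
        lin_raise dE EX lG dG GX HI[unfolded full_twist_def] HJ[unfolded full_twist_def] ker_scale_neq_0[OF assms(1)] assms(2), of q]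
    by (simp add: weight_trace_def)
qed

section \<open>Weight traces of torus braids\<close>

lemma at_one_1 [simp]: "at_one 1 = 1"
  using at_one_A_pow[of 0] by (simp only: A_pow_0)

definition swap_at :: "nat \<Rightarrow> config \<Rightarrow> config" where
  "swap_at i s = s(i := s (Suc i), Suc i := s i)"

lemma swap_at_0: "swap_at 0 (x ## y ## t) = y ## x ## t"
  and swap_at_Suc: "swap_at (Suc i) (x ## t) = x ## swap_at i t"
  by (auto simp: swap_at_def scons_def fun_eq_iff split: nat.split)

lemma crossing_formula:
  "crossing i f s = (if s i = s (Suc i) then A_pow 1 * f s
    else (if s i then A_pow 1 - A_pow (- 3) else 0) * f s + A_pow (- 1) * f (swap_at i s))"
proof (induction i arbitrary: f s)
  case 0
  obtain x y t where s: "s = x ## y ## t" by (metis scons_cases)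
  show ?case
    unfolding s crossing_def q.e_def q.cup.simps q.cap.simps qcap0 q.cup0_scons swap_at_0
    by (cases x; cases y) (simp_all add: quantum_cup_def algebra_simps A_pow_mult A_pow_mult_left A_pow_0)
next
  case (Suc i)
  obtain x t where s: "s = x ## t" by (rule scons_cases)
  show ?case unfolding s crossing_Suc lift_scons Suc swap_at_Suc by simp
qed

fun rotate_sites :: "nat \<Rightarrow> config \<Rightarrow> config" where
  "rotate_sites 0 s = s"
| "rotate_sites (Suc n) s = swap_at n (rotate_sites n s)"

lemma rotate_sites_apply: "rotate_sites n s i = (if i < n then s (Suc i) else if i = n then s 0 else s i)"
  by (induction n arbitrary: i) (auto simp: swap_at_def less_Suc_eq)

text \<open>
  At \<open>A = 1\<close> a crossing exchanges the two bits, and \<open>\<delta>\<close> becomes a cyclic rotation.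
\<close>

lemma at_one_crossing: "at_one (crossing i f s) = at_one (f (swap_at i s))"
proof -
  have "swap_at i s = s" if "s i = s (Suc i)" using that by (auto simp: swap_at_def fun_eq_iff)
  then show ?thesis by (simp add: crossing_formula left_diff_distrib)
qed

lemma at_one_sweep: "at_one (sweep n f s) = at_one (f (rotate_sites n s))"
  by (induction n arbitrary: f) (simp_all add: sweep.simps at_one_crossing)

lemma at_one_sweep_power: "at_one ((sweep n ^^ q) f s) = at_one (f ((rotate_sites n ^^ q) s))"
proof (induction q arbitrary: s)
  case (Suc q)
  have "at_one ((sweep n ^^ Suc q) f s) = at_one ((sweep n ^^ q) f (rotate_sites n s))" by (simp add: at_one_sweep)
  then show ?case by (simp add: Suc funpow_swap1)
qed simp

lemma rotate_sites_power_apply: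
  assumes "i < p" shows "(rotate_sites (p - 1) ^^ q) s i = s ((i + q) mod p)"
proof (induction q arbitrary: s)
  case 0
  then show ?case using assms by simp
next
  case (Suc q)
  have "(rotate_sites (p - 1) ^^ Suc q) s i = rotate_sites (p - 1) s ((i + q) mod p)"
    unfolding funpow_Suc_right o_apply by (rule Suc)
  also have "\<dots> = s (Suc ((i + q) mod p) mod p)"
  proof -
    have "rotate_sites (p - 1) s j = s (Suc j mod p)" if "j < p" for j
      using that by (cases "j = p - 1") (auto simp: rotate_sites_apply)
    then show ?thesis using assms by simp
  qed
  finally show ?case by (simp add: mod_Suc_eq)
qed

lemma rotate_sites_fixed:
  assumes "coprime p q" "p \<ge> 1" "(rotate_sites (p - 1) ^^ q) s = s" "i < p"
  shows "s i = s 0"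
proof -
  have step: "s ((j + q) mod p) = s j" if "j < p" for j
    using rotate_sites_power_apply[OF that, of q s] assms(3) by simp
  have iter: "s ((a * q) mod p) = s 0" for a
  proof (induction a)
    case (Suc a)
    have "((a * q) mod p + q) mod p = (Suc a * q) mod p" by (simp add: mod_add_left_eq) (simp add: add.commute)
    then show ?case using step[of "(a * q) mod p"] Suc assms(2) by simp
  qed simp
  obtain a where "[q * a = 1] (mod p)"
    using cong_solve_coprime_nat[of q p] assms(1) by (auto simp: coprime_commute)
  then have "[q * a * i = 1 * i] (mod p)" by (rule cong_scalar_right)
  then have "(a * i * q) mod p = i" using assms(4) by (simp add: cong_def mult.commute mult.left_commute)
  then show ?thesis using iter[of "a * i"] by simp
qed

lemma wspace_top_eq: "wspace p (int p) = {\<lambda>_. False}"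
proof
  show "wspace p (int p) \<subseteq> {\<lambda>_. False}" by (intro subsetI) (simp only: singleton_iff wspace_top)
  show "{\<lambda>_. False} \<subseteq> wspace p (int p)" using ones_in_wspace[of 0 p] by (simp add: ones_0)
qed

lemma at_one_weight_trace:
  assumes "coprime p q" "p \<ge> 1"
  shows "\<bar>n\<bar> < int p \<Longrightarrow> at_one (weight_trace p q n) = 0" and "at_one (weight_trace p q (int p)) = 1"
proof -
  have "at_one (ind s t) = (if t = s then 1 else 0)" for s t by (simp add: ind_def)
  then have eq: "at_one (weight_trace p q n) = (\<Sum>s\<in>wspace p n. if (rotate_sites (p - 1) ^^ q) s = s then 1 else 0)" for n
    unfolding weight_trace_def tr_def by (simp add: at_one_sweep_power)
  show "at_one (weight_trace p q n) = 0" if n: "\<bar>n\<bar> < int p"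
    unfolding eq
  proof (rule sum.neutral, rule ballI)
    fix s assume s: "s \<in> wspace p n"
    have "\<not> (rotate_sites (p - 1) ^^ q) s = s"
    proof
      assume "(rotate_sites (p - 1) ^^ q) s = s"
      then have c: "s i = s 0" if "i < p" for i by (rule rotate_sites_fixed[OF assms _ that])
      have "wt p s = (\<Sum>i<p. if s 0 then - 1 else 1)"
        unfolding wt_def
      proof (rule sum.cong)
        fix i assume "i \<in> {..<p}"
        then have "s i = s 0" by (intro c) simp
        then show "(if s i then - 1 else 1) = (if s 0 then - 1 else (1::int))" by (simp only:)
      qed simp
      then have "\<bar>wt p s\<bar> = int p" by simp
      then show False using s n by (simp add: wspace_def)
    qed
    then show "(if (rotate_sites (p - 1) ^^ q) s = s then 1 else (0::int)) = 0" by simp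
  qed
  note wspace_top_eq[of p]
  moreover have "(rotate_sites (p - 1) ^^ q) (\<lambda>_. False) = (\<lambda>_. False)"
  proof -
    have "rotate_sites n (\<lambda>_. False) = (\<lambda>_. False)" for n by (simp add: fun_eq_iff rotate_sites_apply)
    then show ?thesis by (induction q) simp_all
  qed
  ultimately show "at_one (weight_trace p q (int p)) = 1" unfolding eq by simp
qed

lemma weight_trace_top: "weight_trace p q (int p) = A_pow (int q * int (p - 1))"
proof -
  note w = wspace_top_eq[of p]
  have "(sweep n ^^ q) f (\<lambda>_. False) = A_pow (int q * int n) * f (\<lambda>_. False)" for n f
    by (induction q) (simp_all add: sweep_zero A_pow_0 A_pow_mult_left distrib_right)
  then show ?thesis unfolding weight_trace_def tr_def w by (simp add: ind_def)
qed

text \<open>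
  At \<open>A = 1\<close> both traces vanish because no configuration of these weights is constant; a monomial that
  vanishes at \<open>1\<close> is zero.
\<close>

lemma weight_trace_step:
  assumes "coprime p q" "p \<ge> 1" "n \<ge> 0" "n + 2 < int p"
  shows "weight_trace p q n = weight_trace p q (n + 2)"
proof (rule ccontr)
  assume "weight_trace p q n \<noteq> weight_trace p q (n + 2)"
  then have "weight_trace p q n - weight_trace p q (n + 2) \<noteq> 0" by simp
  from monomial_solution[OF assms(2) weight_trace_difference_ode[OF assms(3,2)] this]
  have "at_one (weight_trace p q n - weight_trace p q (n + 2)) \<noteq> 0" by blast
  then show False using at_one_weight_trace(1)[OF assms(1,2), of n] at_one_weight_trace(1)[OF assms(1,2), of "n + 2"] assms by simp
qed

text \<open>
  Here the configuration without ones contributes \<open>1\<close> at \<open>A = 1\<close>, so the monomial has coefficient \<open>-1\<close>, and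
  its exponent is \<open>q c / p\<close> with \<open>c = p (p - 5)\<close>.
\<close>

lemma weight_trace_below_top:
  assumes "coprime p q" "p \<ge> 2"
  shows "weight_trace p q (int p - 2) = A_pow (int q * (int p - 1)) - A_pow (int q * (int p - 5))"
proof -
  define f where "f = weight_trace p q (int p - 2) - weight_trace p q (int p)"
  have one: "at_one f = - 1"
    unfolding f_def using at_one_weight_trace(1)[OF assms(1), of "int p - 2"] at_one_weight_trace(2)[OF assms(1)] assms(2) by simp
  then have "f \<noteq> 0" by auto
  moreover have "of_nat p * deriv_A f = of_int (int q * twist_exp p (int p - 2)) * f"
    unfolding f_def using weight_trace_difference_ode[of "int p - 2" p q] assms(2) by simp
  ultimately obtain m where m: "int p * m = int q * twist_exp p (int p - 2)" "f = of_int (at_one f) * A_pow m"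
    using monomial_solution[of p f] assms(2) by (metis (no_types, lifting) le_trans one_le_numeral)
  have "twist_exp p (int p - 2) = int p * (int p - 5)" by (simp add: twist_exp_def power2_eq_square algebra_simps)
  then have "int p * m = int p * (int q * (int p - 5))" using m(1) by simp
  then have "m = int q * (int p - 5)" using assms(2) by simp
  then have "f = - A_pow (int q * (int p - 5))" using m(2) one by simp
  then show ?thesis using weight_trace_top[of p q] assms(2) unfolding f_def by (simp add: of_nat_diff algebra_simps)
qed

text \<open>
  Reversing the order of the strands and exchanging the two bits. This conjugates \<open>\<sigma>\<^sub>i\<close> into
  \<open>\<sigma>\<^sub>p\<^sub>-\<^sub>i\<close>, hence \<open>\<delta>\<close> into the product of the crossings in the opposite order.
\<close>

definition rev_flip :: "nat \<Rightarrow> config \<Rightarrow> config" where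
  "rev_flip p s = (\<lambda>i. i < p \<and> \<not> s (p - 1 - i))"

lemma rev_flip_configs: "rev_flip p s \<in> configs p"
  by (auto simp: rev_flip_def configs_def)

lemma rev_flip_rev_flip: "s \<in> configs p \<Longrightarrow> rev_flip p (rev_flip p s) = s"
proof (rule ext)
  fix i assume s: "s \<in> configs p"
  show "rev_flip p (rev_flip p s) i = s i"
  proof (cases "i < p")
    case True
    then have "p - 1 - (p - 1 - i) = i" "p - 1 - i < p" by auto
    then show ?thesis using True unfolding rev_flip_def by simp
  next
    case False
    then show ?thesis using s by (auto simp: rev_flip_def configs_def)
  qed
qed

lemma wt_rev_flip: "wt p (rev_flip p s) = - wt p s"
proof -
  have "wt p (rev_flip p s) = (\<Sum>i<p. - (if s (p - Suc i) then - 1 else 1))"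
    unfolding wt_def by (intro sum.cong) (auto simp: rev_flip_def)
  also have "\<dots> = - wt p s"
    unfolding sum_negf wt_def using sum.nat_diff_reindex[of "\<lambda>i. if s i then - 1 else (1::int)" p] by simp
  finally show ?thesis .
qed

lemma swap_at_rev_flip:
  assumes "Suc i < p"
  shows "swap_at i (rev_flip p s) = rev_flip p (swap_at (p - 2 - i) s)"
proof (rule ext)
  fix l
  have "Suc (p - 2 - i) = p - 1 - i" "p - 2 - i = p - 1 - Suc i" using assms by auto
  then show "swap_at i (rev_flip p s) l = rev_flip p (swap_at (p - 2 - i) s) l"
    using assms by (auto simp: swap_at_def rev_flip_def)
qed

lemma crossing_rev_flip:
  assumes "Suc i < p"
  shows "crossing i (\<lambda>s. f (rev_flip p s)) s = crossing (p - 2 - i) f (rev_flip p s)"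
proof -
  have j: "Suc (p - 2 - i) = p - 1 - i" "p - 2 - i < p" "p - 1 - i < p" "p - 1 - (p - 2 - i) = Suc i" "p - 1 - (p - 1 - i) = i" "p - 2 - (p - 2 - i) = i"
    using assms by auto
  have "swap_at (p - 2 - i) (rev_flip p s) = rev_flip p (swap_at i s)"
    using swap_at_rev_flip[of "p - 2 - i" p s] j assms by simp
  then show ?thesis
    unfolding crossing_formula[of i] crossing_formula[of "p - 2 - i"] using j by (simp add: rev_flip_def)
qed

fun sweep_back :: "nat \<Rightarrow> lop" where
  "sweep_back 0 f = f"
| "sweep_back (Suc n) f = crossing n (sweep_back n f)"

lemma sweep_rev_flip:
  assumes "n < p"
  shows "sweep n (\<lambda>s. sweep_back (p - 1 - n) f (rev_flip p s)) = (\<lambda>s. sweep_back (p - 1) f (rev_flip p s))"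
  using assms
proof (induction n)
  case 0
  then show ?case by (simp add: sweep.simps)
next
  case (Suc n)
  have "crossing n (\<lambda>s. sweep_back (p - 1 - Suc n) f (rev_flip p s)) = (\<lambda>s. crossing (p - 2 - n) (sweep_back (p - 1 - Suc n) f) (rev_flip p s))"
    by (rule ext) (rule crossing_rev_flip[OF Suc.prems])
  also have "p - 1 - Suc n = p - 2 - n" by simp
  also have "crossing (p - 2 - n) (sweep_back (p - 2 - n) f) = sweep_back (p - 1 - n) f"
    using Suc.prems by (simp flip: sweep_back.simps(2)) (simp add: Suc_diff_Suc numeral_2_eq_2)
  finally show ?case using Suc by (simp add: sweep.simps)
qed

lemma sweep_power_rev_flip:
  assumes "p \<ge> 1"
  shows "(sweep (p - 1) ^^ q) (\<lambda>s. f (rev_flip p s)) = (\<lambda>s. (sweep_back (p - 1) ^^ q) f (rev_flip p s))"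
proof (induction q)
  case (Suc q)
  have "sweep (p - 1) (\<lambda>s. g (rev_flip p s)) = (\<lambda>s. sweep_back (p - 1) g (rev_flip p s))" for g
    using sweep_rev_flip[of "p - 1" p g] assms by simp
  then show ?case by (simp only: funpow.simps o_apply Suc)
qed simp

lemma crossing_symmetric: "crossing i (ind s) t = crossing i (ind t) s"
proof -
  have invol: "swap_at i (swap_at i u) = u" for u by (simp add: swap_at_def fun_eq_iff)
  show ?thesis
  proof (cases "s = t")
    case neq: False
    show ?thesis
    proof (cases "swap_at i s = t")
      case True
      then have "swap_at i t = s" using invol[of s] by simp
      moreover have "t i = s (Suc i)" "t (Suc i) = s i" using True by (auto simp: swap_at_def)
      ultimately show ?thesis using neq True by (simp add: crossing_formula ind_def)
    next
      case False
      then have "swap_at i t \<noteq> s" using invol[of t] by metis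
      then show ?thesis using neq False by (simp add: crossing_formula ind_def)
    qed
  qed simp
qed

lemma transpose_comp:
  assumes "finite I" "lin X" "lin Y" "depends I I X" "depends I I Y" "lin X'" "lin Y'" "depends I I X'" "depends I I Y'"
    and "\<And>s t. s \<in> I \<Longrightarrow> t \<in> I \<Longrightarrow> X (ind s) t = X' (ind t) s" "\<And>s t. s \<in> I \<Longrightarrow> t \<in> I \<Longrightarrow> Y (ind s) t = Y' (ind t) s"
    and "s \<in> I" "t \<in> I"
  shows "X (Y (ind s)) t = Y' (X' (ind t)) s"
proof -
  have "X (Y (ind s)) t = (\<Sum>u\<in>I. Y (ind s) u * X (ind u) t)"
    by (rule expand) (use assms in auto)
  also have "\<dots> = (\<Sum>u\<in>I. X' (ind t) u * Y' (ind u) s)"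
    using assms by (intro sum.cong) (simp_all add: mult.commute)
  also have "\<dots> = Y' (X' (ind t)) s"
    by (rule expand[symmetric]) (use assms in auto)
  finally show ?thesis .
qed

lemma lin_sweep_back: "lin (sweep_back n)"
proof (induction n)
  case 0
  then show ?case by (simp add: lin_def)
next
  case (Suc n)
  have "sweep_back (Suc n) = (\<lambda>f. crossing n (sweep_back n f))" by (simp add: fun_eq_iff)
  then show ?case using lin_comp[OF lin_crossing[of n] Suc] by simp
qed

lemma depends_crossing: "Suc i < p \<Longrightarrow> depends (wspace p n) (wspace p n) (crossing i)"
  by (rule graded_depends[OF graded_crossing])

lemma depends_sweep: "m < p \<Longrightarrow> depends (wspace p n) (wspace p n) (sweep m)"
  by (rule graded_depends[OF graded_sweep])

lemma depends_sweep_back: "m < p \<Longrightarrow> depends (wspace p n) (wspace p n) (sweep_back m)"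
proof (induction m)
  case 0
  have "sweep_back 0 = (\<lambda>f. f)" by (simp add: fun_eq_iff)
  then show ?case by (simp add: depends_id)
next
  case (Suc m)
  have "sweep_back (Suc m) = (\<lambda>f. crossing m (sweep_back m f))" by (simp add: fun_eq_iff)
  then show ?case using depends_comp[OF depends_crossing[OF Suc.prems], of n "wspace p n" "sweep_back m"] Suc by simp
qed

lemma sweep_transpose:
  "m < p \<Longrightarrow> s \<in> wspace p n \<Longrightarrow> t \<in> wspace p n \<Longrightarrow> sweep m (ind s) t = sweep_back m (ind t) s"
proof (induction m arbitrary: s t)
  case 0
  then show ?case by (simp add: sweep.simps ind_def)
next
  case (Suc m)
  have "sweep m (crossing m (ind s)) t = crossing m (sweep_back m (ind t)) s"
    by (rule transpose_comp[OF finite_wspace lin_sweep lin_crossing depends_sweep depends_crossing lin_sweep_back lin_crossing depends_sweep_back depends_crossing])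
      (use Suc in \<open>auto intro: crossing_symmetric\<close>)
  then show ?case by (simp add: sweep.simps)
qed

lemma sweep_power_transpose:
  assumes "p \<ge> 1"
  shows "s \<in> wspace p n \<Longrightarrow> t \<in> wspace p n \<Longrightarrow> (sweep (p - 1) ^^ q) (ind s) t = (sweep_back (p - 1) ^^ q) (ind t) s"
proof (induction q arbitrary: s t)
  case 0
  then show ?case by (simp add: ind_def)
next
  case (Suc q)
  have p: "p - 1 < p" using assms by simp
  have "sweep (p - 1) ((sweep (p - 1) ^^ q) (ind s)) t = (sweep_back (p - 1) ^^ q) (sweep_back (p - 1) (ind t)) s"
    by (rule transpose_comp[OF finite_wspace lin_sweep lin_funpow[OF lin_sweep] depends_sweep[OF p] depends_funpow[OF depends_sweep[OF p]]
        lin_sweep_back lin_funpow[OF lin_sweep_back] depends_sweep_back[OF p] depends_funpow[OF depends_sweep_back[OF p]]])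
      (use Suc p in \<open>auto intro: sweep_transpose\<close>)
  then show ?case by (simp add: funpow_swap1)
qed

text \<open>
  Reversing and flipping negates the weight and replaces \<open>\<delta>\<close> by the product of the crossings in the
  opposite order, which is the transpose of \<open>\<delta>\<close> because the crossing matrices are symmetric.
\<close>

lemma weight_trace_symmetric:
  assumes "p \<ge> 1" shows "weight_trace p q (- n) = weight_trace p q n"
proof -
  have mem: "rev_flip p s \<in> wspace p n" if "s \<in> wspace p (- n)" for s n
    using that by (simp add: wspace_def rev_flip_configs wt_rev_flip)
  have inv: "rev_flip p (rev_flip p s) = s" if "s \<in> wspace p n" for s n
    using that by (simp add: wspace_def rev_flip_rev_flip)
  have "weight_trace p q n = (\<Sum>s\<in>wspace p n. (sweep_back (p - 1) ^^ q) (ind s) s)"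
    unfolding weight_trace_def tr_def by (intro sum.cong HOL.refl sweep_power_transpose[OF assms])
  also have "\<dots> = (\<Sum>s\<in>wspace p (- n). (sweep_back (p - 1) ^^ q) (ind (rev_flip p s)) (rev_flip p s))"
    by (rule sum.reindex_bij_witness[of _ "rev_flip p" "rev_flip p"])
      (use mem[of _ n] mem[of _ "- n"] inv in auto)
  also have "\<dots> = (\<Sum>s\<in>wspace p (- n). (sweep (p - 1) ^^ q) (ind s) s)"
  proof (intro sum.cong HOL.refl)
    fix s assume s: "s \<in> wspace p (- n)"
    have "(sweep_back (p - 1) ^^ q) (ind (rev_flip p s)) (rev_flip p s)
        = (sweep (p - 1) ^^ q) (\<lambda>t. ind (rev_flip p s) (rev_flip p t)) s"
      by (simp only: sweep_power_rev_flip[OF assms])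
    also have "\<dots> = (sweep (p - 1) ^^ q) (ind s) s"
    proof (rule dependsD[OF depends_funpow[OF depends_sweep] _ s])
      fix t assume t: "t \<in> wspace p (- n)"
      have "rev_flip p t = rev_flip p s \<longleftrightarrow> t = s" using inv[OF s] inv[OF t] by metis
      then show "ind (rev_flip p s) (rev_flip p t) = (ind s t :: A_laurent)" by (simp add: ind_def)
    qed (use assms in simp)
    finally show "(sweep_back (p - 1) ^^ q) (ind (rev_flip p s)) (rev_flip p s) = (sweep (p - 1) ^^ q) (ind s) s" .
  qed
  finally show ?thesis by (simp add: weight_trace_def tr_def)
qed

lemma weight_trace_middle:
  assumes "coprime p q" "p \<ge> 2" "1 \<le> i" "i < p"
  shows "weight_trace p q (int p - 2 * int i) = A_pow (int q * (int p - 1)) - A_pow (int q * (int p - 5))"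
proof -
  have *: "weight_trace p q (int p - 2 * int i) = A_pow (int q * (int p - 1)) - A_pow (int q * (int p - 5))"
    if "1 \<le> i" "2 * i \<le> p" for i
    using that
  proof (induction i rule: dec_induct)
    case base
    then show ?case using weight_trace_below_top[OF assms(1,2)] by simp
  next
    case (step i)
    have "weight_trace p q (int p - 2 * int (Suc i)) = weight_trace p q (int p - 2 * int (Suc i) + 2)"
      using assms step by (intro weight_trace_step) auto
    then show ?case using step by simp
  qed
  show ?thesis
  proof (cases "2 * i \<le> p")
    case True
    then show ?thesis using * assms by blast
  next
    case False
    have "weight_trace p q (int p - 2 * int i) = weight_trace p q (- (int p - 2 * int (p - i)))"
      using assms(4) by (simp add: of_nat_diff)
    also have "\<dots> = weight_trace p q (int p - 2 * int (p - i))" using assms(2) by (intro weight_trace_symmetric) simp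
    finally show ?thesis using *[of "p - i"] False assms by simp
  qed
qed

section \<open>The bracket of a torus knot\<close>

lemma closing_weight_eq: "q.closing_weight p s = (- 1) ^ p * A_pow (- 2 * wt p s)"
proof (induction p arbitrary: s)
  case 0
  then show ?case by (simp add: A_pow_0)
next
  case (Suc p)
  obtain x t where s: "s = x ## t" by (rule scons_cases)
  show ?case unfolding s q.closing_weight_Suc Suc by (cases x) (simp_all add: quantum_close_def A_pow_mult mult.left_commute)
qed

lemma wtrace_weights:
  "q.wtrace p (sweep (p - 1) ^^ q) = (- 1) ^ p * (\<Sum>i\<le>p. A_pow (- 2 * (int p - 2 * int i)) * weight_trace p q (int p - 2 * int i))"
proof -
  define c where "c s = card {i. i < p \<and> s i}" for s :: config
  have c: "c s \<le> p" "wt p s = int p - 2 * int (c s)" for s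
  proof -
    have "c s \<le> card {..<p}" unfolding c_def by (rule card_mono) auto
    then show "c s \<le> p" by simp
    have "wt p s = (\<Sum>i<p. 1 - 2 * (if s i then 1 else 0))" unfolding wt_def by (intro sum.cong) auto
    also have "\<dots> = int p - 2 * (\<Sum>i<p. if s i then 1 else 0)" by (simp add: sum_subtractf flip: sum_distrib_left)
    also have "(\<Sum>i<p. if s i then 1 else 0) = int (c s)" unfolding c_def by (simp add: sum.If_cases Int_def)
    finally show "wt p s = int p - 2 * int (c s)" .
  qed
  have fibre: "{s \<in> configs p. c s = i} = wspace p (int p - 2 * int i)" for i
    using c(2) by (auto simp: wspace_def)
  have "q.wtrace p (sweep (p - 1) ^^ q) = (\<Sum>s\<in>configs p. (- 1) ^ p * (A_pow (- 2 * wt p s) * (sweep (p - 1) ^^ q) (ind s) s))"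
    unfolding q.wtrace_def closing_weight_eq by (simp add: mult.assoc)
  also have "\<dots> = (- 1) ^ p * (\<Sum>i\<le>p. \<Sum>s | s \<in> configs p \<and> c s = i. A_pow (- 2 * wt p s) * (sweep (p - 1) ^^ q) (ind s) s)"
    unfolding sum_distrib_left[symmetric] by (subst sum.group[of "configs p" "{..p}" c]) (use finite_configs c(1) in auto)
  also have "(\<Sum>i\<le>p. \<Sum>s | s \<in> configs p \<and> c s = i. A_pow (- 2 * wt p s) * (sweep (p - 1) ^^ q) (ind s) s)
     = (\<Sum>i\<le>p. A_pow (- 2 * (int p - 2 * int i)) * weight_trace p q (int p - 2 * int i))"
    unfolding fibre weight_trace_def tr_def sum_distrib_left by (intro sum.cong HOL.refl) (simp add: wspace_def)
  finally show ?thesis .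
qed

text \<open>
  The traces on all weights of the parity of \<open>p\<close> strictly between \<open>- p\<close> and \<open>p\<close> agree, so the weighted sum is a combination of
  the two geometric sums of lengths \<open>p + 1\<close> and \<open>p - 1\<close>; the factor on the left telescopes them.
\<close>

theorem wtrace_torus:
  assumes "coprime p q" "p \<ge> 1"
  shows "(A_pow 2 - A_pow (- 2)) * q.wtrace p (sweep (p - 1) ^^ q) = (- 1) ^ p *
    (A_pow (int q * (int p - 1)) * (A_pow (2 * int p + 2) - A_pow (- 2 * int p - 2))
      - A_pow (int q * (int p - 5)) * (A_pow (2 * int p - 2) - A_pow (- 2 * int p + 2)))"
proof -
  define X where "X = A_pow (int q * (int p - 1))"
  define Y where "Y = A_pow (int q * (int p - 5))"
  define a where "a i = A_pow (- 2 * (int p - 2 * int i))" for i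
  define g where "g i = A_pow (- 2 * int p + 4 * int i - 2)" for i
  have ag: "(A_pow 2 - A_pow (- 2)) * a i = g (Suc i) - g i" for i
    unfolding a_def g_def by (simp add: left_diff_distrib A_pow_mult algebra_simps)
  have tel: "(A_pow 2 - A_pow (- 2)) * (\<Sum>i=m..<k. a i) = g k - g m" if "m \<le> k" for m k
    unfolding sum_distrib_left ag using that by (rule sum_Suc_diff')
  have top: "weight_trace p q (int p) = X" "weight_trace p q (- int p) = X"
    using weight_trace_top[of p q] weight_trace_symmetric[OF assms(2), of q "int p"] assms(2) by (simp_all add: X_def of_nat_diff)
  obtain r where r: "p = Suc r" using assms(2) by (cases p) auto
  have "(\<Sum>i\<le>p. a i * weight_trace p q (int p - 2 * int i)) = a 0 * X + (\<Sum>i=1..<p. a i * weight_trace p q (int p - 2 * int i)) + a p * X"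
  proof -
    have "(\<Sum>i\<le>p. h i) = h 0 + (\<Sum>i=1..<p. h i) + h p" for h :: "nat \<Rightarrow> A_laurent"
      unfolding r lessThan_Suc_atMost[symmetric] lessThan_atLeast0
      by (simp add: sum.atLeast_Suc_lessThan)
    from this[of "\<lambda>i. a i * weight_trace p q (int p - 2 * int i)"] show ?thesis using top by simp
  qed
  also have "(\<Sum>i=1..<p. a i * weight_trace p q (int p - 2 * int i)) = (\<Sum>i=1..<p. a i) * (X - Y)"
    unfolding sum_distrib_right by (intro sum.cong HOL.refl) (use weight_trace_middle[OF assms(1)] in \<open>auto simp: X_def Y_def\<close>)
  finally have S: "(\<Sum>i\<le>p. a i * weight_trace p q (int p - 2 * int i)) = (\<Sum>i=0..<Suc p. a i) * X - (\<Sum>i=1..<p. a i) * Y"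
    by (simp add: r sum.atLeast_Suc_lessThan algebra_simps)
  have "(A_pow 2 - A_pow (- 2)) * q.wtrace p (sweep (p - 1) ^^ q)
      = (- 1) ^ p * ((A_pow 2 - A_pow (- 2)) * (\<Sum>i\<le>p. a i * weight_trace p q (int p - 2 * int i)))"
    unfolding wtrace_weights a_def by (simp add: mult.left_commute)
  also have "(A_pow 2 - A_pow (- 2)) * (\<Sum>i\<le>p. a i * weight_trace p q (int p - 2 * int i))
      = ((A_pow 2 - A_pow (- 2)) * (\<Sum>i=0..<Suc p. a i)) * X - ((A_pow 2 - A_pow (- 2)) * (\<Sum>i=1..<p. a i)) * Y"
    unfolding S by (simp only: right_diff_distrib mult.assoc)
  also have "\<dots> = X * (g (Suc p) - g 0) - Y * (g p - g 1)"
    unfolding tel[OF le0] tel[OF assms(2)] by (simp only: mult.commute)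
  finally show ?thesis by (simp add: X_def Y_def g_def)
qed

section \<open>The bracket of a twisted torus knot\<close>

lemma word_op_append: "word_op (u @ v) f = word_op u (word_op v f)"
  by (induction u) auto

lemma word_op_generators: "word_op (map Sig [1..<Suc n]) f = sweep n f"
  by (induction n arbitrary: f) (simp_all add: sweep.simps word_op_append)

lemma word_op_twisted_torus:
  assumes "p \<ge> 1"
  shows "word_op (twisted_torus_braid p q s) f = (sweep (p - 1) ^^ q) ((crossing 0 ^^ s) f)"
proof -
  have "word_op (map Sig [1..<p]) g = sweep (p - 1) g" for g
    using word_op_generators[of "p - 1" g] assms by simp
  then have "word_op (concat (replicate q (map Sig [1..<p]))) g = (sweep (p - 1) ^^ q) g" for g
    by (induction q) (simp_all add: word_op_append)
  moreover have "word_op (replicate s (Sig 1)) g = (crossing 0 ^^ s) g" for g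
    by (induction s) simp_all
  ultimately show ?thesis by (simp add: twisted_torus_braid_def word_op_append)
qed

text \<open>
  On the image of \<open>e\<^sub>i\<close> a crossing is multiplication by \<open>- A\<^sup>-\<^sup>3\<close>.
\<close>

lemma crossing_power: "(crossing i ^^ s) f = (\<lambda>t. A_pow (int s) * f t + (\<Sum>j<s. (- 1) ^ j * A_pow (int s - 2 - 4 * int j)) * q.e i f t)"
proof (induction s)
  case 0
  then show ?case by (simp add: A_pow_0)
next
  case (Suc s)
  define c where "c = (\<Sum>j<s. (- 1) ^ j * A_pow (int s - 2 - 4 * int j))"
  have se: "crossing i (q.e i f) = (\<lambda>t. - A_pow (- 3) * q.e i f t)"
    unfolding q.e_def by (rule crossing_cup)
  have C: "(\<Sum>j<Suc s. (- 1) ^ j * A_pow (int (Suc s) - 2 - 4 * int j)) = A_pow (int s - 1) - A_pow (- 3) * c"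
    unfolding c_def sum.lessThan_Suc_shift sum_distrib_left
    by (simp add: sum_negf mult.left_commute A_pow_mult algebra_simps)
  have P: "(crossing i ^^ Suc s) f = (\<lambda>t. A_pow (int s) * crossing i f t + c * (- A_pow (- 3) * q.e i f t))"
    by (simp only: funpow.simps o_apply Suc c_def[symmetric] lin_add[OF lin_crossing] lin_scale[OF lin_crossing] se)
  show ?case
    unfolding P C by (rule ext) (simp add: crossing_def A_pow_mult A_pow_mult_left algebra_simps)
qed

lemma bracket_twisted_torus:
  assumes "p \<ge> 2"
  shows "loop_value * kauffman_bracket p (twisted_torus_braid p q s) =
    A_pow (int s) * q.wtrace p (sweep (p - 1) ^^ q)
    + (\<Sum>j<s. (- 1) ^ j * A_pow (int s - 2 - 4 * int j)) * q.wtrace p (\<lambda>f. (sweep (p - 1) ^^ q) (q.e 0 f))"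
proof -
  have "\<forall>x\<in>set (twisted_torus_braid p q s). 1 \<le> letter_index x \<and> letter_index x < p"
    using assms by (auto simp: twisted_torus_braid_def split: if_splits)
  moreover have "smoothings_ok p []" by (simp add: smoothings_ok_def)
  ultimately have "loop_value * kauffman_bracket p (twisted_torus_braid p q s) = q.wtrace p (\<lambda>f. q.e_word (cap_cup_indices []) (word_op (twisted_torus_braid p q s) f))"
    unfolding kauffman_bracket_def using assms by (intro bracket_from_wtrace) auto
  also have "\<dots> = q.wtrace p (\<lambda>f. (sweep (p - 1) ^^ q) ((crossing 0 ^^ s) f))"
    using word_op_twisted_torus[of p] assms by simp
  finally show ?thesis
    unfolding crossing_power lin_add[OF lin_funpow[OF lin_sweep]] lin_scale[OF lin_funpow[OF lin_sweep]] q.wtrace_plus q.wtrace_scale .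
qed

lemma writhe_twisted_torus: "writhe (twisted_torus_braid p q s) = int q * int (p - 1) + int s"
proof -
  have app: "writhe (u @ v) = writhe u + writhe v" for u v by (simp add: writhe_def)
  have "writhe (map Sig xs) = int (length xs)" for xs by (induction xs) (simp_all add: writhe_def)
  then have "writhe (concat (replicate q (map Sig [1..<p]))) = int q * int (p - 1)"
    by (induction q) (simp_all add: app distrib_right, simp add: writhe_def)
  moreover have "writhe (replicate s (Sig 1)) = int s"
    by (induction s) (simp_all add: writhe_def)
  ultimately show ?thesis by (simp add: twisted_torus_braid_def app)
qed

text \<open>
  \<open>torus_J\<close> before the substitution, that is, with \<open>A\<^sup>-\<^sup>4\<close> in place of \<open>t\<close>.
\<close>

definition torus_J_A :: "int \<Rightarrow> int \<Rightarrow> A_laurent" where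
  "torus_J_A a b = 1 - A_pow (- 4 * (a + 1)) - A_pow (- 4 * (b + 1)) + A_pow (- 4 * (a + b))"

lemma wtrace_torus_J:
  assumes "coprime p q" "p \<ge> 1"
  shows "(A_pow 2 - A_pow (- 2)) * q.wtrace p (sweep (p - 1) ^^ q)
    = (- 1) ^ p * (A_pow (int q * (int p - 1) + 2 * int p + 2) * torus_J_A (int p) (int q))"
  unfolding wtrace_torus[OF assms] torus_J_A_def
  by (simp add: A_pow_mult algebra_simps)

text \<open>
  The factor on the left is \<open>- (A\<^sup>2 - A\<^sup>-\<^sup>2)\<close> times the loop value; it clears both the normalisation of the
  bracket and the denominators of the two torus brackets. The signs \<open>(-1)\<^sup>p\<close> of these brackets cancel
  against the sign of the writhe factor, since \<open>p\<close> or \<open>q\<close> is odd and \<open>s\<close> is even.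
\<close>

lemma X_twisted_torus:
  assumes p: "p \<ge> 2" and cop: "coprime p q" and s: "even s"
    and e: "q.wtrace p (\<lambda>f. (sweep (p - 1) ^^ q) (q.e 0 f)) = A_pow (- 6 * int l) * q.wtrace (p - 2 * k) (sweep (p - 2 * k - 1) ^^ (q - 2 * l))"
    and cop': "coprime (p - 2 * k) (q - 2 * l)" and k: "2 * k < p"
  shows "(A_pow 4 - A_pow (- 4)) * X_polynomial p (twisted_torus_braid p q s) =
    A_pow (- 3 * (int q * (int p - 1) + int s)) *
     (A_pow (int s) * (A_pow (int q * (int p - 1) + 2 * int p + 2) * torus_J_A (int p) (int q))
      + (\<Sum>j<s. (- 1) ^ j * A_pow (int s - 2 - 4 * int j)) * (A_pow (- 6 * int l) *
        (A_pow (int (q - 2 * l) * (int (p - 2 * k) - 1) + 2 * int (p - 2 * k) + 2) * torus_J_A (int (p - 2 * k)) (int (q - 2 * l)))))"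
    (is "_ = ?B * (?S * ?N + ?c * (?l * ?N'))")
proof -
  let ?w = "int q * (int p - 1) + int s"
  have w: "writhe (twisted_torus_braid p q s) = ?w"
    using p by (simp add: writhe_twisted_torus of_nat_diff)
  have "odd q \<or> odd p" using cop by (metis coprime_common_divisor_nat dvd_def even_iff_mod_2_eq_zero coprime_def odd_one)
  then have par: "even ?w \<longleftrightarrow> odd p" using s by auto
  have m: "minus_A_pow (- 3 * ?w) = - ((- 1) ^ p * ?B)"
    unfolding minus_A_pow_def using par by (cases "even p") simp_all
  let ?br = "kauffman_bracket p (twisted_torus_braid p q s)"
  have sign: "(- 1) ^ (p - 2 * k) = ((- 1) ^ p :: A_laurent)"
    using k by (simp add: power_diff_conv_inverse minus_one_power_iff)
  have W': "(A_pow 2 - A_pow (- 2)) * q.wtrace (p - 2 * k) (sweep (p - 2 * k - 1) ^^ (q - 2 * l)) = (- 1) ^ p * ?N'"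
    using wtrace_torus_J[OF cop'] k unfolding sign by simp
  have W: "(A_pow 2 - A_pow (- 2)) * q.wtrace p (sweep (p - 1) ^^ q) = (- 1) ^ p * ?N"
    using wtrace_torus_J[OF cop] p by simp
  have "(A_pow 4 - A_pow (- 4)) * ?br = - ((A_pow 2 - A_pow (- 2)) * (loop_value * ?br))"
  proof -
    have "A_pow 4 - A_pow (- 4) = - ((A_pow 2 - A_pow (- 2)) * loop_value)"
      by (simp add: loop_value_def algebra_simps A_pow_mult)
    then show ?thesis by (simp add: mult.assoc)
  qed
  also have "(A_pow 2 - A_pow (- 2)) * (loop_value * ?br)
      = ?S * ((A_pow 2 - A_pow (- 2)) * q.wtrace p (sweep (p - 1) ^^ q))
       + ?c * (?l * ((A_pow 2 - A_pow (- 2)) * q.wtrace (p - 2 * k) (sweep (p - 2 * k - 1) ^^ (q - 2 * l))))"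
    unfolding bracket_twisted_torus[OF p] e by (simp only: distrib_left mult.left_commute)
  also have "\<dots> = (- 1) ^ p * (?S * ?N + ?c * (?l * ?N'))"
    unfolding W W' by (simp only: distrib_left mult.left_commute)
  finally have br: "(A_pow 4 - A_pow (- 4)) * ?br = - ((- 1) ^ p * (?S * ?N + ?c * (?l * ?N')))" .
  have "(A_pow 4 - A_pow (- 4)) * X_polynomial p (twisted_torus_braid p q s)
      = minus_A_pow (- 3 * ?w) * ((A_pow 4 - A_pow (- 4)) * ?br)"
    unfolding X_polynomial_def w by (rule mult.left_commute)
  also have "\<dots> = ((- 1) ^ p * (- 1) ^ p) * (?B * (?S * ?N + ?c * (?l * ?N')))"
    unfolding br m minus_mult_minus by (simp only: mult.assoc mult.left_commute)
  also have "(- 1) ^ p * (- 1) ^ p = (1 :: A_laurent)" by (simp flip: power_add)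
  finally show ?thesis by (simp only: mult_1_left)
qed

section \<open>Substitution and the arithmetic of the twist pair\<close>

text \<open>
  Coefficientwise description of the substitution, from which its additivity follows.
\<close>

lemma lookup_A_to_t: "Poly_Mapping.lookup (A_to_t f) (- of_int m / 4) = Poly_Mapping.lookup f m"
  and lookup_A_to_t': "(\<And>m. r \<noteq> - of_int m / 4) \<Longrightarrow> Poly_Mapping.lookup (A_to_t f) r = 0"
proof -
  have "Poly_Mapping.lookup (A_to_t f) (- of_int m / 4) = (\<Sum>i\<in>Poly_Mapping.keys f. if i = m then Poly_Mapping.lookup f i else 0)"
    unfolding A_to_t_def lookup_sum by (intro sum.cong HOL.refl) (simp add: lookup_single when_def)
  then show "Poly_Mapping.lookup (A_to_t f) (- of_int m / 4) = Poly_Mapping.lookup f m"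
    by (simp add: in_keys_iff)
  show "Poly_Mapping.lookup (A_to_t f) r = 0" if "\<And>m. r \<noteq> - of_int m / 4"
  proof -
    have "- of_int m / 4 \<noteq> r" for m using that[of m] by metis
    then show ?thesis unfolding A_to_t_def lookup_sum by (intro sum.neutral) (simp add: lookup_single)
  qed
qed

lemma A_to_t_additive:
  assumes "\<And>m. Poly_Mapping.lookup h m = Poly_Mapping.lookup f m + Poly_Mapping.lookup g m"
  shows "A_to_t h = A_to_t f + A_to_t g"
proof (rule poly_mapping_eqI)
  fix r
  show "Poly_Mapping.lookup (A_to_t h) r = Poly_Mapping.lookup (A_to_t f + A_to_t g) r"
  proof (cases "\<exists>m. r = - of_int m / 4")
    case True
    then obtain m where "r = - of_int m / 4" by blast
    then show ?thesis using assms[of m] by (simp only: lookup_add lookup_A_to_t)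
  next
    case False
    then have r: "\<And>m. r \<noteq> - of_int m / 4" by blast
    show ?thesis by (simp add: lookup_add lookup_A_to_t'[OF r])
  qed
qed

lemma A_to_t_add: "A_to_t (f + g) = A_to_t f + A_to_t g"
  by (rule A_to_t_additive) (simp add: lookup_add)

lemma A_to_t_diff: "A_to_t (f - g) = A_to_t f - A_to_t g"
  using A_to_t_add[of "f - g" g] by (simp add: algebra_simps)

lemma A_to_t_0: "A_to_t 0 = 0"
  by (simp add: A_to_t_def)

lemma A_to_t_uminus: "A_to_t (- f) = - A_to_t f"
  using A_to_t_diff[of 0 f] by (simp add: A_to_t_0)

lemma A_to_t_sum: "A_to_t (\<Sum>i\<in>I. f i) = (\<Sum>i\<in>I. A_to_t (f i))"
  by (induction I rule: infinite_finite_induct) (simp_all add: A_to_t_0 A_to_t_add)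

lemma A_to_t_A_pow: "A_to_t (A_pow m) = t_pow (- of_int m / 4)"
  by (simp add: A_to_t_def A_pow_def t_pow_def)

lemma t_pow_mult: "t_pow a * t_pow b = t_pow (a + b)"
  by (simp add: t_pow_def mult_single)

lemma t_pow_0: "t_pow 0 = 1"
  by (simp add: t_pow_def)

lemma A_to_t_mult: "A_to_t (A_pow m * f) = t_pow (- of_int m / 4) * A_to_t f"
proof (induction f rule: laurent_induct)
  case (monomial k)
  show ?case unfolding A_pow_mult A_to_t_A_pow t_pow_mult by (simp add: add_divide_distrib diff_divide_distrib)
qed (simp_all add: A_to_t_0 A_to_t_diff right_diff_distrib)

lemma A_to_t_sign: "A_to_t ((- 1) ^ j * f) = (- 1) ^ j * A_to_t f"
  by (cases "even j") (simp_all add: A_to_t_uminus)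

lemma A_to_t_torus_J: "A_to_t (torus_J_A a b) = torus_J a b"
proof -
  have "A_to_t 1 = 1" using A_to_t_A_pow[of 0] by (simp add: A_pow_0 t_pow_0)
  moreover have "A_to_t (A_pow (- 4 * x)) = t_pow (of_int x)" for x
    by (simp add: A_to_t_A_pow)
  ultimately show ?thesis
    unfolding torus_J_A_def torus_J_def A_to_t_add A_to_t_diff by (simp only:)
qed

text \<open>
  The residue \<open>1\<close> would mean that \<open>p\<close> divides \<open>q k\<close>, which is too late: the inverse \<open>x\<close> of \<open>q\<close> modulo \<open>p\<close> and
  \<open>p - x\<close> are admissible as well, so \<open>2 k < p\<close>. Hence \<open>k q - l p\<close> is \<open>1\<close> or \<open>-1\<close>, which also makes
  \<open>p - 2 k\<close> and \<open>q - 2 l\<close> coprime.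
\<close>

lemma twist_pair_arithmetic:
  fixes p q k l :: int
  assumes p: "p \<ge> 3" and q: "q \<ge> 1" and cop: "coprime p q" and tp: "is_twist_pair p q k l"
  obtains r where "r = 0 \<or> r = 2" "p * l + r - 1 = q * k" "k \<ge> 1" "2 * k < p" "l \<ge> 0" "2 * l \<le> q"
    "coprime (p - 2 * k) (q - 2 * l)"
    "\<And>t. 1 \<le> t \<Longrightarrow> t < k \<Longrightarrow> (q * t) mod p \<notin> {0, 1, p - 1}"
proof -
  obtain r where r: "hits_residue p q k r" and least: "\<And>k' r'. hits_residue p q k' r' \<Longrightarrow> k \<le> k'"
    and l: "p * l + r - 1 = q * k"
    using tp unfolding is_twist_pair_def by blast
  have hits: "hits_residue p q t r' \<longleftrightarrow> t > 0 \<and> r' \<in> {0, 1, 2} \<and> [1 + q * t = r'] (mod p)" for t r'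
  proof -
    have "[q mod p = q] (mod p)" by (simp add: cong_def)
    then have "[1 + (q mod p) * t = 1 + q * t] (mod p)" by (intro cong_add cong_mult cong_refl)
    then show ?thesis unfolding hits_residue_def cong_def by simp
  qed
  have k0: "k \<ge> 1" and r3: "r \<in> {0, 1, 2}" using r unfolding hits by auto
  have before: "(q * t) mod p \<notin> {0, 1, p - 1}" if t: "1 \<le> t" "t < k" for t
  proof
    assume "(q * t) mod p \<in> {0, 1, p - 1}"
    then have "\<exists>r'\<in>{0, 1, 2}. [1 + q * t = r'] (mod p)"
    proof (elim insertE emptyE)
      assume "(q * t) mod p = 0"
      then have "[1 + q * t = 1] (mod p)" by (simp add: cong_iff_dvd_diff dvd_eq_mod_eq_0)
      then show ?thesis by auto
    next
      assume "(q * t) mod p = 1"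
      then have "[q * t = 1] (mod p)" using p by (simp add: cong_def)
      then have "[1 + q * t = 1 + 1] (mod p)" by (rule cong_add[OF cong_refl])
      then show ?thesis by auto
    next
      assume "(q * t) mod p = p - 1"
      then have "[q * t = - 1] (mod p)" using p by (simp add: cong_def zmod_minus1)
      then have "[1 + q * t = 1 + - 1] (mod p)" by (rule cong_add[OF cong_refl])
      then show ?thesis by auto
    qed
    then obtain r' where r': "r' \<in> {0, 1, 2}" "[1 + q * t = r'] (mod p)" by blast
    have "hits_residue p q t r'" unfolding hits using r' t by simp
    then have "k \<le> t" by (rule least)
    then show False using t by simp
  qed
  obtain x0 where "[q * x0 = 1] (mod p)"
    using cong_solve_coprime_int[of q p] cop by (auto simp: coprime_commute)
  then have x: "[q * (x0 mod p) = 1] (mod p)" by (simp add: cong_def mod_mult_right_eq)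
  define x where "x = x0 mod p"
  have x1: "[q * x = 1] (mod p)" using x by (simp add: x_def)
  have "x \<noteq> 0" using x1 p by (auto simp: cong_def)
  moreover have "0 \<le> x" "x < p" using p by (simp_all add: x_def)
  ultimately have xb: "0 < x" "x < p" by simp_all
  have "[1 + q * x = 1 + 1] (mod p)" by (rule cong_add[OF cong_refl x1])
  then have kx: "k \<le> x" using least[of x 2] xb unfolding hits by simp
  have "[1 + q * (p - x) = 1 + (0 - 1)] (mod p)"
    unfolding right_diff_distrib by (intro cong_add cong_diff cong_refl x1) (simp add: cong_def)
  then have kpx: "k \<le> p - x" using least[of "p - x" 0] xb unfolding hits by simp
  have k2: "2 * k < p"
  proof (rule ccontr)
    assume "\<not> 2 * k < p"
    then have "q * p = q * x * 2" using kx kpx by simp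
    moreover have "[q * x * 2 = 1 * 2] (mod p)" by (rule cong_scalar_right[OF x1])
    ultimately have "[q * p = 1 * 2] (mod p)" by (simp only:)
    then have "2 mod p = 0" by (simp add: cong_def)
    then show False using p by simp
  qed
  have "r \<noteq> 1"
  proof
    assume "r = 1"
    then have "p dvd q * k" using l by (metis add_diff_cancel_right' dvd_triv_left)
    then have "p dvd k" using cop coprime_dvd_mult_right_iff by blast
    then show False using k0 k2 zdvd_imp_le[of p k] by simp
  qed
  then have r2: "r = 0 \<or> r = 2" using r3 by auto
  have quantum_close: "q * k \<ge> 1" using mult_mono[of 1 q 1 k] q k0 by simp
  have l0: "l \<ge> 0"
  proof (rule ccontr)
    assume "\<not> l \<ge> 0"
    then have "p * l \<le> p * (- 1)" using p by (intro mult_left_mono) auto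
    then show False using l quantum_close r2 p by auto
  qed
  have ql: "2 * l \<le> q"
  proof (rule ccontr)
    assume "\<not> 2 * l \<le> q"
    then have "p * (q + 1) \<le> p * (2 * l)" using p by (intro mult_left_mono) auto
    moreover have "q * (2 * k) \<le> q * (p - 1)" using q k2 by (intro mult_left_mono) auto
    ultimately show False using l r2 p q by (auto simp: algebra_simps)
  qed
  have "coprime (p - 2 * k) (q - 2 * l)"
  proof (rule coprimeI)
    fix c assume c: "c dvd p - 2 * k" "c dvd q - 2 * l"
    have "c dvd k * (q - 2 * l) - l * (p - 2 * k)" by (rule dvd_diff[OF dvd_mult[OF c(2)] dvd_mult[OF c(1)]])
    also have "k * (q - 2 * l) - l * (p - 2 * k) = r - 1" using l by (simp add: algebra_simps)
    finally show "is_unit c" using r2 by auto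
  qed
  then show thesis using that r2 l k0 k2 l0 ql before by blast
qed

theorem theorem3p13:
  fixes p q s n k l :: int
  assumes "p \<ge> 3" and "q \<ge> 1" and "coprime p q"
    and "n > 0" and "s = 2 * n"
    and "is_twist_pair p q k l"
  shows "to_fract (jones_polynomial (nat p) (twisted_torus_braid (nat p) (nat q) (nat s))) =
    to_fract (t_pow (of_int ((p - 1) * (q - 1) + s) / 2)) / to_fract (1 - t_pow 2) *
    to_fract (torus_J p q -
      (\<Sum>i<nat s. (- 1) ^ i *
        t_pow (of_int (- int i + s + k + l - k * l) + of_int (k * q + l * p - 1) / 2) *
        torus_J (p - 2 * k) (q - 2 * l)))"
proof -
  obtain r where r: "r = 0 \<or> r = 2" and l: "p * l + r - 1 = q * k" and k1: "k \<ge> 1" and k2: "2 * k < p"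
    and l0: "l \<ge> 0" and ql: "2 * l \<le> q" and cop': "coprime (p - 2 * k) (q - 2 * l)"
    and before: "\<And>t. 1 \<le> t \<Longrightarrow> t < k \<Longrightarrow> (q * t) mod p \<notin> {0, 1, p - 1}"
    using twist_pair_arithmetic[OF assms(1-3,6)] by metis
  obtain P Q S K L where P: "p = int P" and Q: "q = int Q" and S: "s = int S" and K: "k = int K" and L: "l = int L"
    using assms k1 l0 by (metis nonneg_int_cases int_one_le_iff_zero_less less_imp_le mult_nonneg_nonneg order_trans zero_le_numeral zero_le_one)
  have PQ: "P \<ge> 3" "Q \<ge> 1" "coprime P Q" "even S" "1 \<le> K" "2 * K < P" "2 * L \<le> Q"
    using assms k1 k2 ql unfolding P Q S K L by (auto simp: even_of_nat_iff[symmetric, where ?'a = int])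
  have sub: "p - 2 * k = int (P - 2 * K)" "q - 2 * l = int (Q - 2 * L)"
    using PQ by (simp_all add: P Q K L of_nat_diff)
  interpret m: multiples P Q K
  proof
    fix t :: nat assume t: "1 \<le> t" "t < K"
    have "int (Q * t mod P) \<notin> {0, 1, p - 1}"
      using before[of "int t"] t by (simp add: P Q K zmod_int)
    then show "Q * t mod P \<notin> {0, 1, P - 1}" using PQ(1) by (auto simp: P of_nat_diff)
  qed (use PQ in auto)
  have "(Q * K mod P = 1 \<and> L = Q * K div P) \<or> (Q * K mod P = P - 1 \<and> L = Q * K div P + 1)"
    using r
  proof
    assume "r = 2"
    then have "int (Q * K) = int (1 + L * P)" using l by (simp add: P Q K L mult.commute)
    then have QK: "Q * K = 1 + L * P" by (simp only: of_nat_eq_iff)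
    have "Q * K mod P = 1" "Q * K div P = L"
      unfolding QK mod_mult_self1 using PQ(1) div_mult_self1[of P 1 L] by auto
    then show ?thesis by simp
  next
    assume "r = 0"
    then have eq: "int (Q * K) + 1 = int (P * L)" using l by (simp add: P Q K L)
    then have "int (Suc (Q * K)) = int (P * L)" by simp
    then have "Suc (Q * K) = P * L" by (simp only: of_nat_eq_iff)
    then obtain L' where L': "L = Suc L'" by (cases L) auto
    have "int (Q * K) = int ((P - 1) + L' * P)" using eq PQ(1) unfolding L' by (simp add: of_nat_diff algebra_simps)
    then have QK: "Q * K = (P - 1) + L' * P" by (simp only: of_nat_eq_iff)
    have "Q * K mod P = P - 1" "Q * K div P = L'"
      unfolding QK mod_mult_self1 using PQ(1) div_mult_self1[of P "P - 1" L'] by auto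
    then show ?thesis using L' by simp
  qed
  note e = m.wtrace_twist_smoothing[OF this PQ(7)]
  have cop'': "coprime (P - 2 * K) (Q - 2 * L)" using cop' unfolding sub by simp
  define X where "X = jones_polynomial P (twisted_torus_braid P Q S)"
  define al :: rat where "al = of_int ((p - 1) * (q - 1) + s) / 2"
  define be :: "nat \<Rightarrow> rat" where "be i = of_int (- int i + s + k + l - k * l) + of_int (k * q + l * p - 1) / 2" for i
  let ?J = "torus_J p q" and ?J' = "torus_J (p - 2 * k) (q - 2 * l)"
  have "P \<ge> 2" using PQ(1) by simp
  note XA = X_twisted_torus[OF this PQ(3,4) e cop'' PQ(6)]
  define m1 where "m1 = - 3 * (q * (p - 1) + s) + (s + (q * (p - 1) + 2 * p + 2))"
  define m2 where "m2 j = - 3 * (q * (p - 1) + s) + (s - 2 - 4 * int j + (- 6 * l + ((q - 2 * l) * (p - 2 * k - 1) + 2 * (p - 2 * k) + 2)))" for j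
  have XA': "(A_pow 4 - A_pow (- 4)) * X_polynomial P (twisted_torus_braid P Q S)
      = A_pow m1 * torus_J_A p q + (\<Sum>j<S. (- 1) ^ j * (A_pow (m2 j) * torus_J_A (p - 2 * k) (q - 2 * l)))"
    unfolding XA P[symmetric] Q[symmetric] S[symmetric] L[symmetric] sub[symmetric] m1_def m2_def
    unfolding distrib_left sum_distrib_right sum_distrib_left A_pow_mult_left mult.assoc mult.left_commute[of "A_pow _" "(- 1) ^ _"] ..
  \<comment> \<open>the shift by \<open>-1\<close> is the factor \<open>t\<^sup>-\<^sup>1\<close> in \<open>t\<^sup>-\<^sup>1 - t = t\<^sup>-\<^sup>1 (1 - t\<^sup>2)\<close>\<close>
  have e1: "- of_int m1 / 4 = al - 1"
    unfolding m1_def al_def by (simp add: field_simps)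
  have e2: "- of_int (m2 j) / 4 = al - 1 + be (S - Suc j)" if "j < S" for j
  proof -
    have "int (S - Suc j) = s - 1 - int j" using that S by simp
    then show ?thesis unfolding m2_def al_def be_def by (simp add: field_simps)
  qed
  have "t_pow (- 1) * X - t_pow 1 * X = A_to_t ((A_pow 4 - A_pow (- 4)) * X_polynomial P (twisted_torus_braid P Q S))"
    by (simp add: left_diff_distrib A_to_t_diff A_to_t_mult X_def jones_polynomial_def)
  also have "\<dots> = t_pow (- of_int m1 / 4) * ?J + (\<Sum>j<S. (- 1) ^ j * (t_pow (- of_int (m2 j) / 4) * ?J'))"
    unfolding XA' A_to_t_add A_to_t_sum A_to_t_sign A_to_t_mult A_to_t_torus_J ..
  also have "\<dots> = t_pow (al - 1) * ?J + (\<Sum>j<S. (- 1) ^ j * (t_pow (al - 1 + be (S - Suc j)) * ?J'))"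
  proof -
    have "t_pow (- of_int (m2 j) / 4) = t_pow (al - 1 + be (S - Suc j))" if "j \<in> {..<S}" for j
      using e2[of j] that by (simp only: lessThan_iff)
    then show ?thesis unfolding e1 by (simp only: cong: sum.cong)
  qed
  finally have "t_pow 1 * (t_pow (- 1) * X - t_pow 1 * X)
      = t_pow 1 * (t_pow (al - 1) * ?J + (\<Sum>j<S. (- 1) ^ j * (t_pow (al - 1 + be (S - Suc j)) * ?J')))" by simp
  moreover have "t_pow 1 * (t_pow (- 1) * X - t_pow 1 * X) = (1 - t_pow 2) * X"
    unfolding right_diff_distrib mult.assoc[symmetric] t_pow_mult by (simp add: t_pow_0 left_diff_distrib)
  moreover have "t_pow 1 * (t_pow (al - 1) * ?J + (\<Sum>j<S. (- 1) ^ j * (t_pow (al - 1 + be (S - Suc j)) * ?J')))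
      = t_pow al * (?J + (\<Sum>j<S. (- 1) ^ j * t_pow (be (S - Suc j)) * ?J'))"
  proof -
    have "t_pow 1 * ((- 1) ^ j * (t_pow (al - 1 + y) * ?J')) = t_pow al * ((- 1) ^ j * t_pow y * ?J')" for j y
    proof -
      have E: "t_pow 1 * t_pow (al - 1 + y) = t_pow al * t_pow y" by (simp add: t_pow_mult)
      have "t_pow 1 * ((- 1) ^ j * (t_pow (al - 1 + y) * ?J')) = (- 1) ^ j * ((t_pow 1 * t_pow (al - 1 + y)) * ?J')"
        by (simp only: ac_simps)
      also have "\<dots> = t_pow al * ((- 1) ^ j * t_pow y * ?J')" unfolding E by (simp only: ac_simps)
      finally show ?thesis .
    qed
    moreover have "t_pow 1 * (t_pow (al - 1) * ?J) = t_pow al * ?J"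
      by (simp add: t_pow_mult flip: mult.assoc)
    ultimately show ?thesis by (simp only: distrib_left sum_distrib_left)
  qed
  \<comment> \<open>the expansion of \<open>\<sigma>\<^sub>1\<^sup>s\<close> lists the terms in the opposite order; \<open>s\<close> is even, so reversal changes the sign\<close>
  moreover have "(\<Sum>j<S. (- 1) ^ j * t_pow (be (S - Suc j)) * ?J') = - (\<Sum>i<S. (- 1) ^ i * t_pow (be i) * ?J')"
  proof -
    have "(\<Sum>j<S. (- 1) ^ j * t_pow (be (S - Suc j)) * ?J') = (\<Sum>j<S. (- 1) ^ (S - Suc (S - Suc j)) * t_pow (be (S - Suc j)) * ?J')"
      by (intro sum.cong) (auto simp: Suc_diff_Suc)
    also have "\<dots> = (\<Sum>i<S. (- 1) ^ (S - Suc i) * t_pow (be i) * ?J')"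
      by (rule sum.nat_diff_reindex)
    also have "\<dots> = (\<Sum>i<S. - ((- 1) ^ i * t_pow (be i) * ?J'))"
    proof (rule sum.cong)
      fix i assume "i \<in> {..<S}"
      then have "even (S - Suc i) \<longleftrightarrow> odd i" using PQ(4) by simp
      then have "(- 1) ^ (S - Suc i) = - ((- 1) ^ i :: t_laurent)" by (cases "even i") simp_all
      then show "(- 1) ^ (S - Suc i) * t_pow (be i) * ?J' = - ((- 1) ^ i * t_pow (be i) * ?J')" by simp
    qed simp
    finally show ?thesis by (simp add: sum_negf)
  qed
  ultimately have main: "(1 - t_pow 2) * X = t_pow al * (?J - (\<Sum>i<S. (- 1) ^ i * t_pow (be i) * ?J'))"
    by simp
  have "1 - t_pow 2 \<noteq> 0"
  proof
    assume "1 - t_pow 2 = 0"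
    then have "Poly_Mapping.lookup (t_pow 0) 2 = Poly_Mapping.lookup (t_pow 2) 2" by (simp add: t_pow_0)
    then show False by (simp add: t_pow_def lookup_single lookup_one)
  qed
  then have nz: "to_fract (1 - t_pow 2) \<noteq> 0" by (simp only: to_fract_eq_0_iff not_False_eq_True)
  have "to_fract (1 - t_pow 2) * to_fract X = to_fract (t_pow al) * to_fract (?J - (\<Sum>i<S. (- 1) ^ i * t_pow (be i) * ?J'))"
    unfolding to_fract_mult[symmetric] main ..
  then have "to_fract X = to_fract (t_pow al) / to_fract (1 - t_pow 2) * to_fract (?J - (\<Sum>i<S. (- 1) ^ i * t_pow (be i) * ?J'))"
    using nz by (simp add: field_simps)
  then show ?thesis
    unfolding X_def al_def be_def by (simp only: P Q S nat_int)
qed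

end
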